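(* Let $r\in\mathbb N$, let $x\in L^r_{\infty,\infty}(\mathbb R)$ be a $1$-periodic function, and let $p,q\in(0,\infty)$ with $q>p$. Suppose that for some $\lambda>0$ one of the following conditions holds: a) the numbers $a_1=0$, $a_2\ge 0$ and $b\ne 0$ are such that $\|x^{(k)}\|\le\|\Psi^{(k)}_{a_1,a_2,b,\lambda}\|$ for $k\in\{r-1,r\}$; b) $r\ge 2$ and the numbers $a_1\ge 0$, $a_2=0$ and $b\neq 0$ are such that $\|x^{(k)}\|\le\|\Psi^{(k)}_{a_1,a_2,b,\lambda}\|$ for $k\in\{r-2,r\}$; c) $r\ge 2$ and the numbers $a_1\ge 0$, $a_2\ge 0$ and $b\ne 0$ are such that $\|x^{(k)}\|\le\|\Psi^{(k)}_{a_1,a_2,b,\lambda}\|$ for $k\in\{r-2,r-1,r\}$; and suppose that $\|\Psi_{a_1,a_2,b,\lambda}\|_{L_p(0,\lambda)}=\|x-c(x)\|_{L_p(0,1)}$. Then $$\|\Psi_{a_1,a_2,b,\lambda}\|_{L_q(0,\lambda)}\ge\|x-c(x)\|_{L_q(0,1)}.$$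
   Context: $\|\cdot\|$ is the norm of $L_\infty(\mathbb R)$, and $\|f\|_{L_p(\alpha,\beta)}=\left(\int_\alpha^\beta|f(t)|^p\,dt\right)^{1/p}$ for $p\in(0,\infty)$. $L^r_\infty(\mathbb R)$ is the space of functions $x:\mathbb R\to\mathbb R$ such that $x^{(r-1)}$ (with $x^{(0)}=x$) is locally absolutely continuous and $x^{(r)}\in L_\infty(\mathbb R)$; $L^r_{\infty,\infty}(\mathbb R)=L^r_\infty(\mathbb R)\cap L_\infty(\mathbb R)$. For $x\in L_\infty(\mathbb R)$, $c(x)$ denotes the constant of best approximation of $x$ in $L_\infty(\mathbb R)$, i.e. $\|x-c(x)\|=\inf_{c\in\mathbb R}\|x-c\|$. For $a_1,a_2\ge 0$ put $T=a_1+a_2+2$ and define $\psi_1(a_1,a_2;t)$ on $[0,T]$ to be $0$ for $t\in[0,a_1]$, $t-a_1$ for $t\in[a_1,a_1+1]$, $1$ for $t\in[a_1+1,a_1+a_2+1]$, and $2+a_1+a_2-t$ for $t\in[a_1+a_2+1,T]$. Extend it to $[T,2T]$ by $\psi_1(a_1,a_2;t)=-\psi_1(a_1,a_2;t-T)$ and then $2T$-periodically to $\mathbb R$. For $r\ge 2$, $\psi_r(a_1,a_2;\cdot)$ is the $2T$-periodic function with zero mean over the period such that $\psi_r'(a_1,a_2;t)=\psi_{r-1}(a_1,a_2;t)$. For $r\in\mathbb N$, $a_1,a_2\ge0$, $\lambda>0$, $b\in\mathbb R$, $$\Psi_{a_1,a_2,b,\lambda}(t)=\Psi_{r;a_1,a_2,b,\lambda}(t)=b\left(\frac{\lambda}{2a_1+2a_2+4}\right)^{r}\psi_r\!\left(a_1,a_2;\frac{2a_1+2a_2+4}{\lambda}\,t\right),$$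 a $\lambda$-periodic function. *)

theory Defs
  imports "HOL-Probability.Essential_Supremum" "HOL-Library.Real_Mod"
begin

text \<open>The essential supremum is \<^term>\<open>\<infinity>\<close> for a function that is not Lebesgue measurable.\<close>

definition Linf_norm :: "(real \<Rightarrow> real) \<Rightarrow> ereal" where
  "Linf_norm f = esssup lebesgue (\<lambda>t. ereal \<bar>f t\<bar>)"

definition Linf :: "(real \<Rightarrow> real) set" where
  "Linf = {f. f \<in> borel_measurable lebesgue \<and> Linf_norm f < \<infinity>}"

definition Lp_norm :: "real \<Rightarrow> real \<Rightarrow> real \<Rightarrow> (real \<Rightarrow> real) \<Rightarrow> real" where
  "Lp_norm p \<alpha> \<beta> f = (LINT t:{\<alpha>..\<beta>}|lebesgue. \<bar>f t\<bar> powr p) powr (1 / p)"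

text \<open>The members of a division are nondegenerate or degenerate compact intervals
  \<open>{Inf K..Sup K}\<close>; the latter contribute nothing to either sum.\<close>

definition absolutely_continuous_on_Icc :: "real \<Rightarrow> real \<Rightarrow> (real \<Rightarrow> real) \<Rightarrow> bool" where
  "absolutely_continuous_on_Icc a b f \<longleftrightarrow>
     (\<forall>\<epsilon>>0. \<exists>\<delta>>0. \<forall>\<D> S. \<D> division_of S \<and> S \<subseteq> {a..b} \<and>
        (\<Sum>K\<in>\<D>. Sup K - Inf K) < \<delta> \<longrightarrow>
        (\<Sum>K\<in>\<D>. \<bar>f (Sup K) - f (Inf K)\<bar>) < \<epsilon>)"

definition locally_absolutely_continuous :: "(real \<Rightarrow> real) \<Rightarrow> bool" where
  "locally_absolutely_continuous f \<longleftrightarrow> (\<forall>a b. absolutely_continuous_on_Icc a b f)"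

text \<open>For \<open>x\<close> in the following space, the iterated derivatives of order less than \<open>r\<close> exist
  everywhere. The one of order \<open>r\<close> exists only almost everywhere; the unspecified value of
  \<^const>\<open>deriv\<close> at the remaining points is invisible to \<^const>\<open>Linf\<close> and \<^const>\<open>Linf_norm\<close>.\<close>

definition Lr_inf :: "nat \<Rightarrow> (real \<Rightarrow> real) set" where
  "Lr_inf r = {x. (\<forall>k<r - 1. \<forall>t. (deriv ^^ k) x differentiable at t) \<and>
                  locally_absolutely_continuous ((deriv ^^ (r - 1)) x) \<and>
                  (deriv ^^ r) x \<in> Linf}"

definition Lr_inf_inf :: "nat \<Rightarrow> (real \<Rightarrow> real) set" where
  "Lr_inf_inf r = Lr_inf r \<inter> Linf"

definition best_const :: "(real \<Rightarrow> real) \<Rightarrow> real" where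
  "best_const x = (THE c. Linf_norm (\<lambda>t. x t - c) = (INF d. Linf_norm (\<lambda>t. x t - d)))"

definition psi_base :: "real \<Rightarrow> real \<Rightarrow> real \<Rightarrow> real" where
  "psi_base a1 a2 t =
     (if t \<le> a1 then 0
      else if t \<le> a1 + 1 then t - a1
      else if t \<le> a1 + a2 + 1 then 1
      else 2 + a1 + a2 - t)"

definition psi1 :: "real \<Rightarrow> real \<Rightarrow> real \<Rightarrow> real" where
  "psi1 a1 a2 t =
     (let T = a1 + a2 + 2; s = t rmod (2 * T)
      in if s \<le> T then psi_base a1 a2 s else - psi_base a1 a2 (s - T))"

text \<open>The index starts at 1; the value at index 0 is a dummy.\<close>

fun psi :: "nat \<Rightarrow> real \<Rightarrow> real \<Rightarrow> real \<Rightarrow> real" where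
  "psi 0 a1 a2 = (\<lambda>t. 0)"
| "psi (Suc 0) a1 a2 = psi1 a1 a2"
| "psi (Suc (Suc n)) a1 a2 =
     (THE g. (\<forall>t. g (t + 2 * (a1 + a2 + 2)) = g t) \<and>
             (\<forall>t. (g has_real_derivative psi (Suc n) a1 a2 t) (at t)) \<and>
             (g has_integral 0) {0..2 * (a1 + a2 + 2)})"

definition Psi :: "nat \<Rightarrow> real \<Rightarrow> real \<Rightarrow> real \<Rightarrow> real \<Rightarrow> real \<Rightarrow> real" where
  "Psi r a1 a2 b lam t =
     b * (lam / (2 * a1 + 2 * a2 + 4)) ^ r * psi r a1 a2 ((2 * a1 + 2 * a2 + 4) / lam * t)"

end

theory Submission
  imports Defs
begin

text \<open>
  Let \<open>G\<close> be a derivative of \<open>\<Psi>\<close> and \<open>f\<close> the derivative of \<open>x\<close> of the same order. Say that \<open>f\<close> falls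
  slower than \<open>G\<close> if, whenever \<open>f t\<close> exceeds the value of \<open>G\<close> at some point of its quarter wave from the
  maximum down to zero, \<open>f\<close> stays above \<open>G\<close> while both arguments move on until \<open>G\<close> reaches zero.
  At order \<open>r - 1\<close>, where \<open>G\<close> is a trapezoid, this follows from the Lipschitz bound on \<open>f\<close> that the
  condition of order \<open>r\<close> gives, together with \<open>\<bar>f\<bar> \<le> max G\<close> or \<open>a2 = 0\<close>. If \<open>f t\<close>, \<open>- f t\<close>, \<open>f (- t)\<close> and
  \<open>- f (- t)\<close> all fall slower than \<open>G\<close>, then so do the antiderivatives, provided that of \<open>f\<close> is bounded by
  the maximum of that of \<open>G\<close>: otherwise, going back to the preceding maximum of the latter, the former
  would exceed it.

  The norm bounds that are not assumed are obtained by contradiction. Replacing \<open>\<lambda>\<close> by a larger period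
  preserves the assumed bounds, so there is a least period \<open>\<lambda>' \<ge> \<lambda>\<close> for which all bounds hold. If
  \<open>\<lambda>' > \<lambda>\<close>, equality holds at some order, it propagates to order zero, and then \<open>x - c(x)\<close> has
  a larger \<open>L\<^sub>p\<close> norm than \<open>\<Psi>\<close>.

  Finally, the comparison at order zero shows that \<open>\<bar>x - c(x)\<bar>\<close> spends at least as much time in each band
  of values as \<open>\<bar>\<Psi>\<bar>\<close> does, so the two distribution functions cross at most once.
\<close>

subsection \<open>Total variation\<close>

text \<open>Why the assumed bounds sit at the orders \<open>r - 1\<close> and \<open>r - 2\<close>:
  the trapezoid \<open>psi1\<close> is flat at height 1 over a length \<open>a2\<close> and flat at
  height 0 over a length \<open>a1\<close>. Integration turns the second stretch into a flat maximum
  of \<open>psi 2\<close>; from \<open>psi 3\<close> on there are no flat maxima. A function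
  touching a flat maximum may leave it at once, so equality there says nothing about neighbouring
  values and does not propagate. The bounds at orders with a flat maximum are therefore the ones
  taken as hypotheses.

  The constant of best approximation is the midrange of \<open>x\<close>. It makes the extreme
  values of \<open>x - c(x)\<close> opposite, so that one period contains four crossings of each
  band of values, matching the four quarters of \<open>Psi\<close>.

  The condition of order \<open>r\<close> concerns a derivative that exists only almost everywhere.
  Turning it into a Lipschitz bound uses absolute continuity essentially, which enters in its
  epsilon-delta form; the route to it leads through total variation and Radon-Nikodym
  densities.\<close>

text \<open>A pair \<open>(c, d)\<close> stands for the interval \<open>{c..d}\<close>.\<close>
definition nonoverlapping :: "(real \<times> real) set \<Rightarrow> real \<Rightarrow> real \<Rightarrow> bool" where
  "nonoverlapping D s t \<longleftrightarrow> finite D \<and> (\<forall>p\<in>D. s \<le> fst p \<and> fst p < snd p \<and> snd p \<le> t) \<and>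
     (\<forall>p\<in>D. \<forall>p'\<in>D. p \<noteq> p' \<longrightarrow> snd p \<le> fst p' \<or> snd p' \<le> fst p)"

definition vsum :: "(real \<Rightarrow> real) \<Rightarrow> (real \<times> real) set \<Rightarrow> real" where
  "vsum f D = (\<Sum>p\<in>D. \<bar>f (snd p) - f (fst p)\<bar>)"

definition tvar :: "(real \<Rightarrow> real) \<Rightarrow> real \<Rightarrow> real \<Rightarrow> real" where
  "tvar f s t = Sup {vsum f D | D. nonoverlapping D s t}"

definition bvar :: "(real \<Rightarrow> real) \<Rightarrow> real \<Rightarrow> real \<Rightarrow> bool" where
  "bvar f s t \<longleftrightarrow> bdd_above {vsum f D | D. nonoverlapping D s t}"

lemma nonoverlapping_mono: "nonoverlapping D s t \<Longrightarrow> s' \<le> s \<Longrightarrow> t \<le> t' \<Longrightarrow> nonoverlapping D s' t'"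
  unfolding nonoverlapping_def by force

lemma nonoverlapping_empty [simp]: "nonoverlapping {} s t"
  by (simp add: nonoverlapping_def)

lemma nonoverlapping_Un:
  assumes D: "nonoverlapping D s t" and E: "nonoverlapping E t u" and "s \<le> t" "t \<le> u"
  shows "nonoverlapping (D \<union> E) s u" "D \<inter> E = {}"
proof -
  show "D \<inter> E = {}" using D E unfolding nonoverlapping_def by force
  have D': "p \<in> D \<Longrightarrow> s \<le> fst p \<and> fst p < snd p \<and> snd p \<le> t"
    and E': "p \<in> E \<Longrightarrow> t \<le> fst p \<and> fst p < snd p \<and> snd p \<le> u" for p
    using D E unfolding nonoverlapping_def by auto
  show "nonoverlapping (D \<union> E) s u" unfolding nonoverlapping_def
  proof (intro conjI ballI impI)
    show "finite (D \<union> E)" using D E unfolding nonoverlapping_def by auto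
    fix p assume p: "p \<in> D \<union> E"
    show "s \<le> fst p" "fst p < snd p" "snd p \<le> u" using p D' E' assms(3,4) by fastforce+
    fix p' assume p': "p' \<in> D \<union> E" and ne: "p \<noteq> p'"
    show "snd p \<le> fst p' \<or> snd p' \<le> fst p"
    proof (cases "p \<in> D \<longleftrightarrow> p' \<in> D")
      case True
      then have "p \<in> D \<and> p' \<in> D \<or> p \<in> E \<and> p' \<in> E" using p p' by auto
      then show ?thesis using ne D E unfolding nonoverlapping_def by meson
    next
      case False
      then have "p \<in> D \<and> p' \<in> E \<or> p \<in> E \<and> p' \<in> D" using p p' by auto
      then show ?thesis using D' E' by (meson order_trans)
    qed
  qed
qed

lemma vsum_Un:
  "finite D \<Longrightarrow> finite E \<Longrightarrow> D \<inter> E = {} \<Longrightarrow> vsum f (D \<union> E) = vsum f D + vsum f E"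
  unfolding vsum_def by (rule sum.union_disjoint)

text \<open>At most one interval of \<open>D\<close> has \<open>t\<close> in its interior. Cutting
  it there can only increase the sum, by the triangle inequality.\<close>

lemma nonoverlapping_split:
  assumes D: "nonoverlapping D s u" and "s \<le> t" "t \<le> u"
  obtains D1 D2 where "nonoverlapping D1 s t" "nonoverlapping D2 t u"
    "vsum f D \<le> vsum f D1 + vsum f D2"
proof -
  have fin: "finite D" and b: "\<And>p. p \<in> D \<Longrightarrow> s \<le> fst p \<and> fst p < snd p \<and> snd p \<le> u"
    and disj: "\<And>p p'. p \<in> D \<Longrightarrow> p' \<in> D \<Longrightarrow> p \<noteq> p' \<Longrightarrow> snd p \<le> fst p' \<or> snd p' \<le> fst p"
    using D unfolding nonoverlapping_def by auto
  define L where "L = {p\<in>D. snd p \<le> t}"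
  define R where "R = {p\<in>D. t \<le> fst p}"
  define C where "C = {p\<in>D. fst p < t \<and> t < snd p}"
  have L: "nonoverlapping L s t" and R: "nonoverlapping R t u"
    using fin b disj unfolding nonoverlapping_def L_def R_def by auto
  have LR: "L \<inter> R = {}" unfolding L_def R_def using b by force
  have DE: "D = (L \<union> R) \<union> C" "(L \<union> R) \<inter> C = {}"
    unfolding L_def R_def C_def by auto
  have finLRC: "finite L" "finite R" "finite C" using fin unfolding L_def R_def C_def by auto
  have vD: "vsum f D = vsum f L + vsum f R + vsum f C"
    using DE finLRC LR vsum_Un[of "L \<union> R" C f] vsum_Un[of L R f] by auto
  show thesis
  proof (cases "C = {}")
    case True
    then show thesis using that[OF L R] vD by (simp add: vsum_def)
  next
    case False
    then obtain p where p: "p \<in> C" by auto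
    have "C = {p}"
    proof -
      have "x = p" if x: "x \<in> C" for x
      proof (rule ccontr)
        assume "x \<noteq> p"
        moreover have "x \<in> D" "p \<in> D" "fst x < t" "t < snd x" "fst p < t" "t < snd p"
          using x p by (simp_all add: C_def)
        ultimately show False using disj[of x p] by linarith
      qed
      then show ?thesis using p by blast
    qed
    have pb: "p \<in> D" "fst p < t" "t < snd p" using p by (auto simp: C_def)
    have 1: "nonoverlapping (insert (fst p, t) L) s t"
      unfolding nonoverlapping_def
    proof (intro conjI ballI impI)
      show "finite (insert (fst p, t) L)" using finLRC by simp
      fix x assume x: "x \<in> insert (fst p, t) L"
      show "s \<le> fst x" "fst x < snd x" "snd x \<le> t" using x b[of x] b[of p] pb unfolding L_def by auto
      fix y assume y: "y \<in> insert (fst p, t) L" "x \<noteq> y"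
      have A: "snd z \<le> fst p" if "z \<in> L" for z
        using that disj[of z p] pb b[of z] unfolding L_def by force
      show "snd x \<le> fst y \<or> snd y \<le> fst x"
      proof (cases "x \<in> L \<and> y \<in> L")
        case True then show ?thesis using y(2) L unfolding nonoverlapping_def by blast
      next
        case False then show ?thesis using x y A[of x] A[of y] by auto
      qed
    qed
    have 2: "nonoverlapping (insert (t, snd p) R) t u"
      unfolding nonoverlapping_def
    proof (intro conjI ballI impI)
      show "finite (insert (t, snd p) R)" using finLRC by simp
      fix x assume x: "x \<in> insert (t, snd p) R"
      show "t \<le> fst x" "fst x < snd x" "snd x \<le> u" using x b[of x] b[of p] pb unfolding R_def by auto
      fix y assume y: "y \<in> insert (t, snd p) R" "x \<noteq> y"
      have A: "snd p \<le> fst z" if "z \<in> R" for z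
        using that disj[of z p] pb b[of z] unfolding R_def by force
      show "snd x \<le> fst y \<or> snd y \<le> fst x"
      proof (cases "x \<in> R \<and> y \<in> R")
        case True then show ?thesis using y(2) R unfolding nonoverlapping_def by blast
      next
        case False then show ?thesis using x y A[of x] A[of y] by auto
      qed
    qed
    \<comment> \<open>\<open>vsum\<close> runs over a set, so the new pair must not occur in
      \<open>L\<close> already; if it did, it would overlap \<open>p\<close>.\<close>
    have n1: "(fst p, t) \<notin> L"
      using pb disj[of "(fst p, t)" p] by (cases p) (auto simp: L_def)
    have n2: "(t, snd p) \<notin> R"
      using pb disj[of "(t, snd p)" p] by (cases p) (auto simp: R_def)
    have "vsum f (insert (fst p, t) L) = \<bar>f t - f (fst p)\<bar> + vsum f L"
      using n1 finLRC by (simp add: vsum_def)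
    moreover have "vsum f (insert (t, snd p) R) = \<bar>f (snd p) - f t\<bar> + vsum f R"
      using n2 finLRC by (simp add: vsum_def)
    moreover have "vsum f C = \<bar>f (snd p) - f (fst p)\<bar>" using \<open>C = {p}\<close> by (simp add: vsum_def)
    ultimately show thesis using that[OF 1 2] vD by linarith
  qed
qed

lemma tvar_upper: "bvar f s t \<Longrightarrow> nonoverlapping D s t \<Longrightarrow> vsum f D \<le> tvar f s t"
  unfolding tvar_def bvar_def by (rule cSup_upper) auto

lemma tvar_least: "(\<And>D. nonoverlapping D s t \<Longrightarrow> vsum f D \<le> c) \<Longrightarrow> tvar f s t \<le> c"
  unfolding tvar_def by (rule cSup_least) (auto intro: nonoverlapping_empty)

lemma tvar_approx:
  assumes "bvar f s t" "c < tvar f s t"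
  obtains D where "nonoverlapping D s t" "c < vsum f D"
  using assms tvar_least[of s t f c] by (meson not_le)

lemma bvar_trans:
  assumes "bvar f s t" "bvar f t u" "s \<le> t" "t \<le> u"
  shows "bvar f s u"
  unfolding bvar_def
proof (rule bdd_aboveI)
  fix v assume "v \<in> {vsum f D | D. nonoverlapping D s u}"
  then obtain D where D: "nonoverlapping D s u" "v = vsum f D" by auto
  from nonoverlapping_split[OF D(1) assms(3,4), of f] obtain D1 D2 where
    "nonoverlapping D1 s t" "nonoverlapping D2 t u" "vsum f D \<le> vsum f D1 + vsum f D2" by blast
  then show "v \<le> tvar f s t + tvar f t u"
    using tvar_upper[OF assms(1), of D1] tvar_upper[OF assms(2), of D2] D by linarith
qed

lemma tvar_add:
  assumes "bvar f s t" "bvar f t u" "s \<le> t" "t \<le> u"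
  shows "tvar f s u = tvar f s t + tvar f t u"
proof (rule antisym)
  show "tvar f s u \<le> tvar f s t + tvar f t u"
  proof (rule tvar_least)
    fix D assume D: "nonoverlapping D s u"
    from nonoverlapping_split[OF D(1) assms(3,4), of f] obtain D1 D2 where
      "nonoverlapping D1 s t" "nonoverlapping D2 t u" "vsum f D \<le> vsum f D1 + vsum f D2" by blast
    then show "vsum f D \<le> tvar f s t + tvar f t u"
      using tvar_upper[OF assms(1), of D1] tvar_upper[OF assms(2), of D2] by linarith
  qed
  note bv = bvar_trans[OF assms]
  have *: "vsum f D \<le> tvar f s u - vsum f E" if D: "nonoverlapping D s t" and E: "nonoverlapping E t u" for D E
    using tvar_upper[OF bv nonoverlapping_Un(1)[OF that assms(3,4)]]
      vsum_Un[of D E f] nonoverlapping_Un(2)[OF that assms(3,4)] D E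
    by (simp add: nonoverlapping_def)
  have "vsum f E \<le> tvar f s u - tvar f s t" if E: "nonoverlapping E t u" for E
    using tvar_least[of s t f "tvar f s u - vsum f E"] *[OF _ E] by simp
  from tvar_least[where s = t and t = u, OF this] show "tvar f s t + tvar f t u \<le> tvar f s u" by auto
qed

text \<open>Lets the epsilon-delta condition be applied to a simultaneous refinement of all
  intervals of a family.\<close>

lemma nonoverlapping_UN:
  assumes D: "nonoverlapping D s t" and E: "\<And>p. p \<in> D \<Longrightarrow> nonoverlapping (E p) (fst p) (snd p)"
  shows "nonoverlapping (\<Union>p\<in>D. E p) s t" "vsum f (\<Union>p\<in>D. E p) = (\<Sum>p\<in>D. vsum f (E p))"
proof -
  have fin: "finite D" and b: "\<And>p. p \<in> D \<Longrightarrow> s \<le> fst p \<and> fst p < snd p \<and> snd p \<le> t"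
    and disj: "\<And>p p'. p \<in> D \<Longrightarrow> p' \<in> D \<Longrightarrow> p \<noteq> p' \<Longrightarrow> snd p \<le> fst p' \<or> snd p' \<le> fst p"
    using D unfolding nonoverlapping_def by auto
  have Eb: "fst p \<le> fst x \<and> fst x < snd x \<and> snd x \<le> snd p" if "p \<in> D" "x \<in> E p" for p x
    using E[OF that(1)] that(2) unfolding nonoverlapping_def by auto
  have Edisj: "snd x \<le> fst y \<or> snd y \<le> fst x" if "p \<in> D" "x \<in> E p" "y \<in> E p" "x \<noteq> y" for p x y
    using E[OF that(1)] that(2-) unfolding nonoverlapping_def by auto
  have Efin: "finite (E p)" if "p \<in> D" for p using E[OF that] unfolding nonoverlapping_def by auto
  show "nonoverlapping (\<Union>p\<in>D. E p) s t" unfolding nonoverlapping_def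
  proof (intro conjI ballI impI)
    show "finite (\<Union>p\<in>D. E p)" using fin Efin by auto
    fix x assume "x \<in> (\<Union>p\<in>D. E p)"
    then obtain p where p: "p \<in> D" "x \<in> E p" by auto
    show "s \<le> fst x" "fst x < snd x" "snd x \<le> t" using Eb[OF p] b[OF p(1)] by auto
    fix y assume "y \<in> (\<Union>p\<in>D. E p)" and ne: "x \<noteq> y"
    then obtain p' where p': "p' \<in> D" "y \<in> E p'" by auto
    show "snd x \<le> fst y \<or> snd y \<le> fst x"
    proof (cases "p = p'")
      case True then show ?thesis using Edisj p p' ne by auto
    next
      case False
      show ?thesis using disj[OF p(1) p'(1) False] Eb[OF p] Eb[OF p'] by linarith
    qed
  qed
  have "E p \<inter> E p' = {}" if pp: "p \<in> D" "p' \<in> D" "p \<noteq> p'" for p p'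
  proof (rule ccontr)
    assume "E p \<inter> E p' \<noteq> {}"
    then obtain x where "x \<in> E p" "x \<in> E p'" by auto
    then show False using disj[OF pp] Eb[OF pp(1), of x] Eb[OF pp(2), of x] by linarith
  qed
  then show "vsum f (\<Union>p\<in>D. E p) = (\<Sum>p\<in>D. vsum f (E p))"
    unfolding vsum_def using fin Efin by (subst sum.UNION_disjoint) auto
qed

text \<open>Passes from divisions to pairs of endpoints, which are easier to cut and merge. The
  pairs are nondegenerate, so the map to intervals is injective and both sums carry over.\<close>

lemma AC_vsum:
  assumes "absolutely_continuous_on_Icc a b f" "0 < e"
  obtains d where "0 < d"
    "\<And>D. nonoverlapping D a b \<Longrightarrow> (\<Sum>p\<in>D. snd p - fst p) < d \<Longrightarrow> vsum f D < e"
proof -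
  obtain d where d: "0 < d" "\<And>D S. D division_of S \<and> S \<subseteq> {a..b} \<and> (\<Sum>K\<in>D. Sup K - Inf K) < d \<Longrightarrow>
        (\<Sum>K\<in>D. \<bar>f (Sup K) - f (Inf K)\<bar>) < e"
    using assms unfolding absolutely_continuous_on_Icc_def by meson
  show thesis
  proof (rule that[OF d(1)])
    fix D assume D: "nonoverlapping D a b" and small: "(\<Sum>p\<in>D. snd p - fst p) < d"
    have fin: "finite D" and b: "\<And>p. p \<in> D \<Longrightarrow> a \<le> fst p \<and> fst p < snd p \<and> snd p \<le> b"
      and disj: "\<And>p p'. p \<in> D \<Longrightarrow> p' \<in> D \<Longrightarrow> p \<noteq> p' \<Longrightarrow> snd p \<le> fst p' \<or> snd p' \<le> fst p"
      using D unfolding nonoverlapping_def by auto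
    define I where "I = (\<lambda>p::real\<times>real. {fst p..snd p})"
    have inj: "inj_on I D"
      by (rule inj_onI) (use b in \<open>auto simp: I_def prod_eq_iff dest!: Icc_eq_Icc[THEN iffD1] less_imp_le\<close>)
    have "I ` D division_of \<Union>(I ` D)"
    proof (rule division_ofI)
      show "finite (I ` D)" using fin by simp
      fix K assume "K \<in> I ` D"
      then obtain p where p: "p \<in> D" "K = I p" by auto
      then show "K \<subseteq> \<Union>(I ` D)" by auto
      show "K \<noteq> {}" using p b[of p] by (auto simp: I_def)
      show "\<exists>a b. K = cbox a b" using p by (auto simp: I_def cbox_interval)
      fix K' assume "K' \<in> I ` D" "K \<noteq> K'"
      then obtain p' where p': "p' \<in> D" "K' = I p'" "p \<noteq> p'" using p by auto
      show "interior K \<inter> interior K' = {}"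
        using disj[OF p(1) p'(1,3)] unfolding p p' I_def by (auto simp: interior_atLeastAtMost_real)
    qed auto
    moreover have "\<Union>(I ` D) \<subseteq> {a..b}" using b by (fastforce simp: I_def)
    moreover have "(\<Sum>K\<in>I ` D. Sup K - Inf K) = (\<Sum>p\<in>D. snd p - fst p)"
      unfolding sum.reindex[OF inj] by (rule sum.cong) (use b in \<open>auto simp: I_def less_imp_le\<close>)
    moreover have "(\<Sum>K\<in>I ` D. \<bar>f (Sup K) - f (Inf K)\<bar>) = vsum f D"
      unfolding sum.reindex[OF inj] vsum_def by (rule sum.cong) (use b in \<open>auto simp: I_def less_imp_le\<close>)
    ultimately show "vsum f D < e" using d(2)[of "I ` D" "\<Union>(I ` D)"] small by simp
  qed
qed

lemma nonoverlapping_length: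
  assumes "nonoverlapping D s t" "s \<le> t"
  shows "(\<Sum>p\<in>D. snd p - fst p) \<le> t - s"
proof -
  have "finite D" using assms by (auto simp: nonoverlapping_def)
  then show ?thesis using assms
  proof (induction "card D" arbitrary: D s t)
    case 0 then show ?case by simp
  next
    case (Suc n)
    then have "D \<noteq> {}" by auto
    define m where "m = Max (snd ` D)"
    have "m \<in> snd ` D" unfolding m_def using \<open>finite D\<close> \<open>D \<noteq> {}\<close> by (intro Max_in) auto
    then obtain p where p: "p \<in> D" "snd p = m" by auto
    have mx: "snd x \<le> m" if "x \<in> D" for x unfolding m_def using that \<open>finite D\<close> by auto
    have "nonoverlapping (D - {p}) s (fst p)"
      unfolding nonoverlapping_def
    proof (intro conjI ballI impI)
      fix x assume x: "x \<in> D - {p}"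
      show "s \<le> fst x" "fst x < snd x" using Suc.prems(2) x unfolding nonoverlapping_def by auto
      have "snd p \<le> fst x \<or> snd x \<le> fst p" using Suc.prems(2) x p unfolding nonoverlapping_def by auto
      then show "snd x \<le> fst p" using mx[of x] \<open>fst x < snd x\<close> x p(2) by auto
      fix y assume "y \<in> D - {p}" "x \<noteq> y"
      then show "snd x \<le> fst y \<or> snd y \<le> fst x"
        using Suc.prems(2) x unfolding nonoverlapping_def by blast
    qed (use \<open>finite D\<close> in simp)
    moreover have "s \<le> fst p" "snd p \<le> t" using Suc.prems(2) p unfolding nonoverlapping_def by auto
    moreover have "n = card (D - {p})" using Suc.hyps(2) p \<open>finite D\<close> by simp
    ultimately have "(\<Sum>p\<in>D - {p}. snd p - fst p) \<le> fst p - s"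
      using Suc.hyps(1)[of "D - {p}" s "fst p"] \<open>finite D\<close> by simp
    then show ?case using \<open>snd p \<le> t\<close> by (simp add: sum.remove[OF \<open>finite D\<close> p(1)])
  qed
qed

text \<open>Absolute continuity with \<epsilon> = 1 bounds the variation by 1 on each piece shorter
  than \<open>d\<close>, and finitely many pieces of length \<open>d/2\<close> exhaust
  \<open>{a..b}\<close>.\<close>

lemma AC_bvar:
  assumes "absolutely_continuous_on_Icc a b f" "a \<le> b"
  shows "bvar f a b"
proof -
  obtain d where d: "0 < d"
    "\<And>D. nonoverlapping D a b \<Longrightarrow> (\<Sum>p\<in>D. snd p - fst p) < d \<Longrightarrow> vsum f D < 1"
    using AC_vsum[OF assms(1), of 1] by auto
  have loc: "bvar f s t" if "a \<le> s" "s \<le> t" "t \<le> b" "t - s < d" for s t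
    unfolding bvar_def
  proof (rule bdd_aboveI)
    fix v assume "v \<in> {vsum f D | D. nonoverlapping D s t}"
    then obtain D where D: "nonoverlapping D s t" "v = vsum f D" by auto
    show "v \<le> 1" using d(2)[OF nonoverlapping_mono[OF D(1) that(1,3)]] nonoverlapping_length[OF D(1)] that D(2) by force
  qed
  have "bvar f a (min b (a + real n * (d/2)))" for n
  proof (induction n)
    case 0
    then show ?case using loc[of a a] assms(2) d(1) by simp
  next
    case (Suc n)
    let ?m = "min b (a + real n * (d/2))" and ?m' = "min b (a + real (Suc n) * (d/2))"
    have "a + real (Suc n) * (d/2) = a + real n * (d/2) + d/2" "0 \<le> real n * (d/2)"
      using d(1) by (auto simp: field_simps)
    then have "a \<le> ?m" "?m \<le> ?m'" "?m' - ?m < d" "?m' \<le> b" using assms(2) d(1) by linarith+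
    then show ?case using bvar_trans[OF Suc loc[of ?m ?m']] by blast
  qed
  moreover obtain n :: nat where "(b - a) / (d/2) < real n" using reals_Archimedean2 by blast
  then have "min b (a + real n * (d/2)) = b" using d(1) by (simp add: field_simps)
  ultimately show ?thesis by metis
qed

subsection \<open>Almost everywhere differentiability of absolutely continuous functions\<close>

lemma bvar_subset: "bvar f s t \<Longrightarrow> s \<le> s' \<Longrightarrow> t' \<le> t \<Longrightarrow> bvar f s' t'"
  unfolding bvar_def by (rule bdd_above_mono, assumption) (blast intro: nonoverlapping_mono)

text \<open>Absolute continuity on every bounded interval, with \<open>\<le> e\<close> instead of
  \<open>< e\<close> because it is verified for suprema.\<close>

definition vsum_continuous :: "(real \<Rightarrow> real) \<Rightarrow> bool" where
  "vsum_continuous F \<longleftrightarrow> (\<forall>a b e. 0 < e \<longrightarrow>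
     (\<exists>d>0. \<forall>D. nonoverlapping D a b \<longrightarrow> (\<Sum>p\<in>D. snd p - fst p) < d \<longrightarrow> vsum F D \<le> e))"

lemma vsum_id: "nonoverlapping D s t \<Longrightarrow> vsum (\<lambda>x. x) D = (\<Sum>p\<in>D. snd p - fst p)"
  unfolding vsum_def nonoverlapping_def by (intro sum.cong) auto

text \<open>Absolute continuity passes from \<open>f\<close> to its variation: replace each total
  variation by the sum over a nearly optimal subdivision. All the subdivisions together form one
  family of no greater total length.\<close>

lemma AC_sum_tvar:
  assumes AC: "absolutely_continuous_on_Icc a b f" and "a \<le> b" "0 < e"
  obtains d where "0 < d"
    "\<And>D. nonoverlapping D a b \<Longrightarrow> (\<Sum>p\<in>D. snd p - fst p) < d \<Longrightarrow> (\<Sum>p\<in>D. tvar f (fst p) (snd p)) \<le> e"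
proof -
  obtain d where d: "0 < d"
    "\<And>D. nonoverlapping D a b \<Longrightarrow> (\<Sum>p\<in>D. snd p - fst p) < d \<Longrightarrow> vsum f D < e"
    using AC_vsum[OF AC \<open>0 < e\<close>] by auto
  show thesis
  proof (rule that[OF d(1)], rule ccontr)
    fix D assume D: "nonoverlapping D a b" and small: "(\<Sum>p\<in>D. snd p - fst p) < d"
      and "\<not> (\<Sum>p\<in>D. tvar f (fst p) (snd p)) \<le> e"
    then have gap: "e < (\<Sum>p\<in>D. tvar f (fst p) (snd p))" (is "e < ?s") by simp
    have fin: "finite D" and b: "\<And>p. p \<in> D \<Longrightarrow> a \<le> fst p \<and> fst p < snd p \<and> snd p \<le> b"
      using D unfolding nonoverlapping_def by auto
    \<comment> \<open>The excess over \<open>e\<close> is shared out among the intervals. The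
      \<open>+ 1\<close> covers the empty family and keeps the accumulated error strictly below
      \<open>?s - e\<close>.\<close>
    define n where "n = (?s - e) / (real (card D) + 1)"
    have n: "0 < n" using gap by (simp add: n_def)
    have "\<exists>E. nonoverlapping E (fst p) (snd p) \<and> tvar f (fst p) (snd p) - n < vsum f E" if "p \<in> D" for p
    proof -
      have "bvar f (fst p) (snd p)" using bvar_subset[OF AC_bvar[OF AC \<open>a \<le> b\<close>]] b[OF that] by simp
      from tvar_approx[OF this, of "tvar f (fst p) (snd p) - n"] n show ?thesis by auto
    qed
    then obtain E where E: "\<And>p. p \<in> D \<Longrightarrow> nonoverlapping (E p) (fst p) (snd p)"
      "\<And>p. p \<in> D \<Longrightarrow> tvar f (fst p) (snd p) - n < vsum f (E p)" by metis
    note U = nonoverlapping_UN[OF D E(1)]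
    have "(\<Sum>x\<in>(\<Union>p\<in>D. E p). snd x - fst x) = (\<Sum>p\<in>D. vsum (\<lambda>x. x) (E p))"
      using vsum_id[OF U(1)] U(2)[of "\<lambda>x. x"] by simp
    also have "\<dots> \<le> (\<Sum>p\<in>D. snd p - fst p)"
    proof (rule sum_mono)
      fix p assume p: "p \<in> D"
      show "vsum (\<lambda>x. x) (E p) \<le> snd p - fst p"
        using vsum_id[OF E(1)[OF p]] nonoverlapping_length[OF E(1)[OF p]] b[OF p] by simp
    qed
    also note small
    finally have "vsum f (\<Union>p\<in>D. E p) < e" using d(2)[OF U(1)] by simp
    then have "(\<Sum>p\<in>D. vsum f (E p)) < e" using U(2) by simp
    moreover have "?s - real (card D) * n \<le> (\<Sum>p\<in>D. vsum f (E p))"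
    proof -
      have "(\<Sum>p\<in>D. tvar f (fst p) (snd p) - n) \<le> (\<Sum>p\<in>D. vsum f (E p))"
        by (rule sum_mono) (use E(2) in \<open>auto intro: less_imp_le\<close>)
      then show ?thesis by (simp add: sum_subtractf)
    qed
    moreover have "real (card D) * n < ?s - e"
    proof -
      have "real (card D) * n < (real (card D) + 1) * n" using n by simp
      also have "\<dots> = ?s - e" by (simp add: n_def)
      finally show ?thesis .
    qed
    ultimately show False by linarith
  qed
qed

section \<open>Jordan decomposition of a locally absolutely continuous function\<close>

definition gvar :: "(real \<Rightarrow> real) \<Rightarrow> real \<Rightarrow> real" where
  "gvar f t = (if 0 \<le> t then tvar f 0 t else - tvar f t 0)"

context
  fixes f :: "real \<Rightarrow> real"
  assumes lac: "locally_absolutely_continuous f"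
begin

lemma bvar_lac: "bvar f s t"
proof (cases "s \<le> t")
  case True
  then show ?thesis using AC_bvar lac unfolding locally_absolutely_continuous_def by blast
next
  case False
  have "bvar f (min s t) (max s t)" using AC_bvar lac unfolding locally_absolutely_continuous_def by simp
  then show ?thesis using bvar_subset[of f "min s t" "max s t" s t] by simp
qed

text \<open>Additivity of the variation; the sign in \<open>gvar\<close> at negative arguments is
  what makes it hold across 0.\<close>

lemma gvar_diff:
  assumes "s \<le> t" shows "gvar f t - gvar f s = tvar f s t"
  using tvar_add[OF bvar_lac bvar_lac, of 0 s t] tvar_add[OF bvar_lac bvar_lac, of s 0 t]
    tvar_add[OF bvar_lac bvar_lac, of s t 0] assms
  by (auto simp: gvar_def not_le)

lemma diff_le_tvar:
  assumes "s \<le> t" shows "\<bar>f t - f s\<bar> \<le> tvar f s t"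
proof (cases "s = t")
  case True
  then show ?thesis using tvar_upper[OF bvar_lac nonoverlapping_empty, of s t] by (simp add: vsum_def)
next
  case False
  then have "nonoverlapping {(s,t)} s t" using assms by (simp add: nonoverlapping_def)
  from tvar_upper[OF bvar_lac this] show ?thesis by (simp add: vsum_def)
qed

lemma gvar_mono: "s \<le> t \<Longrightarrow> gvar f s \<le> gvar f t"
  using gvar_diff[of s t] diff_le_tvar[of s t] by linarith

lemma vsum_continuous_gvar: "vsum_continuous (gvar f)"
  unfolding vsum_continuous_def
proof (intro allI impI)
  fix a b e :: real assume e: "0 < e"
  show "\<exists>d>0. \<forall>D. nonoverlapping D a b \<longrightarrow> (\<Sum>p\<in>D. snd p - fst p) < d \<longrightarrow> vsum (gvar f) D \<le> e"
  proof -
    have AC: "absolutely_continuous_on_Icc a (max a b) f"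
      using lac unfolding locally_absolutely_continuous_def by blast
    obtain d where d: "0 < d"
      "\<And>D. nonoverlapping D a (max a b) \<Longrightarrow> (\<Sum>p\<in>D. snd p - fst p) < d \<Longrightarrow> (\<Sum>p\<in>D. tvar f (fst p) (snd p)) \<le> e"
      using AC_sum_tvar[OF AC _ e] by auto
    have "vsum (gvar f) D = (\<Sum>p\<in>D. tvar f (fst p) (snd p))" if D: "nonoverlapping D a b" for D
      unfolding vsum_def
    proof (rule sum.cong)
      fix p assume "p \<in> D"
      then have "fst p \<le> snd p" using D by (auto simp: nonoverlapping_def)
      then show "\<bar>gvar f (snd p) - gvar f (fst p)\<bar> = tvar f (fst p) (snd p)"
        using gvar_diff[OF \<open>fst p \<le> snd p\<close>] gvar_mono[OF \<open>fst p \<le> snd p\<close>] by linarith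
    qed simp
    then show ?thesis using d nonoverlapping_mono[of _ a b a "max a b"] by force
  qed
qed

text \<open>An increment of \<open>f\<close> is at most the variation over the same interval, so
  increments of the difference are at most twice those of \<open>gvar f\<close>; hence the
  \<open>e/2\<close>.\<close>

lemma vsum_continuous_gvar_minus: "vsum_continuous (\<lambda>t. gvar f t - f t)"
  unfolding vsum_continuous_def
proof (intro allI impI)
  fix a b e :: real assume "0 < e"
  then obtain d where d: "0 < d"
    "\<And>D. nonoverlapping D a b \<Longrightarrow> (\<Sum>p\<in>D. snd p - fst p) < d \<Longrightarrow> vsum (gvar f) D \<le> e/2"
    using vsum_continuous_gvar unfolding vsum_continuous_def by (meson half_gt_zero)
  have "vsum (\<lambda>t. gvar f t - f t) D \<le> 2 * vsum (gvar f) D" if D: "nonoverlapping D a b" for D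
    unfolding vsum_def sum_distrib_left
  proof (rule sum_mono)
    fix p assume "p \<in> D"
    then have "fst p \<le> snd p" using D by (auto simp: nonoverlapping_def)
    then show "\<bar>gvar f (snd p) - f (snd p) - (gvar f (fst p) - f (fst p))\<bar> \<le> 2 * \<bar>gvar f (snd p) - gvar f (fst p)\<bar>"
      using gvar_diff[OF \<open>fst p \<le> snd p\<close>] diff_le_tvar[OF \<open>fst p \<le> snd p\<close>] by (smt (verit))
  qed
  then show "\<exists>d>0. \<forall>D. nonoverlapping D a b \<longrightarrow> (\<Sum>p\<in>D. snd p - fst p) < d \<longrightarrow> vsum (\<lambda>t. gvar f t - f t) D \<le> e"
    using d by (intro exI[of _ d]) fastforce
qed

lemma gvar_minus_mono: "s \<le> t \<Longrightarrow> gvar f s - f s \<le> gvar f t - f t"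
  using gvar_diff[of s t] diff_le_tvar[of s t] by linarith

end

section \<open>Density and derivative of a monotone absolutely continuous function\<close>

context
  fixes F :: "real \<Rightarrow> real"
  assumes mono: "\<And>s t. s \<le> t \<Longrightarrow> F s \<le> F t" and vc: "vsum_continuous F"
begin

lemma vc_continuous: "continuous_on UNIV F"
  unfolding continuous_on_iff
proof (intro ballI allI impI)
  fix t e :: real assume "0 < e"
  then obtain d where d: "0 < d"
    "\<And>D. nonoverlapping D (t-1) (t+1) \<Longrightarrow> (\<Sum>p\<in>D. snd p - fst p) < d \<Longrightarrow> vsum F D \<le> e/2"
    using vc unfolding vsum_continuous_def by (meson half_gt_zero)
  have *: "\<bar>F v - F u\<bar> \<le> e/2" if "t - 1 \<le> u" "u < v" "v \<le> t + 1" "v - u < d" for u v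
    using d(2)[of "{(u,v)}"] that by (simp add: nonoverlapping_def vsum_def)
  show "\<exists>d>0. \<forall>x'\<in>UNIV. dist x' t < d \<longrightarrow> dist (F x') (F t) < e"
  proof (intro exI[of _ "min d 1"] conjI ballI impI)
    fix u assume u: "dist u t < min d 1"
    consider "u < t" | "u = t" | "t < u" by linarith
    then show "dist (F u) (F t) < e"
      by cases (use *[of u t] *[of t u] u \<open>0 < e\<close> in \<open>auto simp: dist_real_def abs_minus_commute\<close>)
  qed (use d in auto)
qed

lemma emeasure_Icc: "s \<le> t \<Longrightarrow> emeasure (interval_measure F) {s..t} = ennreal (F t - F s)"
  by (rule emeasure_interval_measure_Icc[OF _ mono vc_continuous])

text \<open>An open set of measure less than \<open>d\<close> around \<open>N\<close> contains a
  countable cover of \<open>N\<close> by nonoverlapping intervals. Any finitely many of these have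
  total length below \<open>d\<close>, hence total increment of \<open>F\<close> at most
  \<open>e\<close>; continuity from below extends this to the whole cover.\<close>

lemma null_bounded:
  assumes N: "N \<in> null_sets lborel" "N \<subseteq> {a..b}" and ab: "a < b"
  shows "emeasure (interval_measure F) N = 0"
proof -
  let ?\<nu> = "interval_measure F"
  have "emeasure ?\<nu> N \<le> 0 + ennreal e" if e: "0 < e" for e
  proof -
    obtain d where d: "0 < d"
      "\<And>D. nonoverlapping D a b \<Longrightarrow> (\<Sum>p\<in>D. snd p - fst p) < d \<Longrightarrow> vsum F D \<le> e"
      using vc e unfolding vsum_continuous_def by meson
    have Nb: "N \<in> sets borel" using N by auto
    obtain U where U: "open U" "N \<subseteq> U" "emeasure lborel (U - N) < d"
      using outer_regular_lborel[OF Nb d(1)] by blast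
    have Ud: "emeasure lborel U < d"
    proof -
      have "emeasure lborel U = emeasure lborel (U - N)"
        using emeasure_Diff_null_set[of N lborel U] N U by simp
      then show ?thesis using U(3) by simp
    qed
    \<comment> \<open>A gauge forcing every interval tagged by a point of \<open>N\<close> to lie in
      \<open>U\<close>; the value \<open>UNIV\<close> elsewhere serves only to make it a
      gauge.\<close>
    define g where "g = (\<lambda>x. if x \<in> U then U else UNIV)"
    have "gauge g" using U(1) by (auto simp: gauge_def g_def)
    moreover have "N \<subseteq> cbox a b" "box a b \<noteq> {}" using N ab by (auto simp: cbox_interval)
    ultimately obtain \<D> where \<D>: "countable \<D>" "\<Union>\<D> \<subseteq> cbox a b"
      "\<And>K. K \<in> \<D> \<Longrightarrow> interior K \<noteq> {} \<and> (\<exists>c d. K = cbox c d)"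
      "pairwise (\<lambda>A B. interior A \<inter> interior B = {}) \<D>"
      "\<And>K. K \<in> \<D> \<Longrightarrow> \<exists>x \<in> N \<inter> K. K \<subseteq> g x" "N \<subseteq> \<Union>\<D>"
      using covering_lemma[of N a b g] by metis
    have "\<exists>p. fst p < snd p \<and> K = {fst p..snd p}" if KD: "K \<in> \<D>" for K
    proof -
      obtain c d where cd: "K = {c..d}" "interior K \<noteq> {}" using \<D>(3)[OF KD] by (auto simp: cbox_interval)
      then have "c < d" by (simp add: interior_atLeastAtMost_real)
      then show ?thesis using cd by (intro exI[of _ "(c,d)"]) simp
    qed
    then obtain I where I: "\<And>K. K \<in> \<D> \<Longrightarrow> fst (I K) < snd (I K)" "\<And>K. K \<in> \<D> \<Longrightarrow> K = {fst (I K)..snd (I K)}"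
      by metis
    have KU: "K \<subseteq> U" if "K \<in> \<D>" for K using \<D>(5)[OF that] U(2) by (auto simp: g_def split: if_splits)
    have Kab: "K \<subseteq> {a..b}" if "K \<in> \<D>" for K using \<D>(2) that by (auto simp: cbox_interval)
    have inj: "inj_on I \<D>" by (rule inj_onI) (metis I(2))
    have fin_bound: "emeasure ?\<nu> (\<Union>\<F>) \<le> e" if \<F>: "finite \<F>" "\<F> \<subseteq> \<D>" for \<F>
    proof -
      have no: "nonoverlapping (I ` \<F>) a b"
        unfolding nonoverlapping_def
      proof (intro conjI ballI impI)
        show "finite (I ` \<F>)" using \<F> by simp
        fix p assume "p \<in> I ` \<F>"
        then obtain K where K: "K \<in> \<D>" "p = I K" using \<F> by blast
        show "fst p < snd p" using I(1)[OF K(1)] K by simp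
        then have "fst p \<in> K" "snd p \<in> K" using K(2) by (subst I(2)[OF K(1)], simp)+
        then show "a \<le> fst p" "snd p \<le> b" using Kab[OF K(1)] by auto
        fix p' assume "p' \<in> I ` \<F>" "p \<noteq> p'"
        then obtain K' where K': "K' \<in> \<D>" "p' = I K'" "K \<noteq> K'" using \<F> K by blast
        have "interior K \<inter> interior K' = {}" using \<D>(4) K K' unfolding pairwise_def by blast
        then have "{fst p<..<snd p} \<inter> {fst p'<..<snd p'} = {}"
          using I(2)[OF K(1)] I(2)[OF K'(1)] K(2) K'(2) by (metis interior_atLeastAtMost_real)
        then show "snd p \<le> fst p' \<or> snd p' \<le> fst p"
          using \<open>fst p < snd p\<close> I(1)[OF K'(1)] K'(2) by (auto simp: max_def min_def split: if_splits)
      qed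
      have len: "(\<Sum>p\<in>I ` \<F>. snd p - fst p) < d"
      proof -
        \<comment> \<open>Open intervals have the same lengths and are truly disjoint, whereas the
          closed ones may share endpoints.\<close>
        have "ennreal (\<Sum>p\<in>I ` \<F>. snd p - fst p) = (\<Sum>p\<in>I ` \<F>. emeasure lborel {fst p<..<snd p})"
          using no by (subst sum_ennreal[symmetric]) (auto simp: nonoverlapping_def less_imp_le intro!: sum.cong)
        also have "\<dots> = emeasure lborel (\<Union>p\<in>I ` \<F>. {fst p<..<snd p})"
        proof (rule sum_emeasure)
          show "disjoint_family_on (\<lambda>p. {fst p<..<snd p}) (I ` \<F>)"
            unfolding disjoint_family_on_def
          proof (intro ballI impI)
            fix p p' assume "p \<in> I ` \<F>" "p' \<in> I ` \<F>" "p \<noteq> p'"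
            then have "snd p \<le> fst p' \<or> snd p' \<le> fst p" using no unfolding nonoverlapping_def by blast
            then show "{fst p<..<snd p} \<inter> {fst p'<..<snd p'} = {}" by auto
          qed
        qed (use \<F> in auto)
        also have "\<dots> \<le> emeasure lborel U"
        proof (rule emeasure_mono)
          show "(\<Union>p\<in>I ` \<F>. {fst p<..<snd p}) \<subseteq> U"
          proof clarsimp
            fix K x assume "K \<in> \<F>" "fst (I K) < x" "x < snd (I K)"
            then have "x \<in> K" using I(2)[of K] \<F> by (metis atLeastAtMost_iff less_imp_le subsetD)
            then show "x \<in> U" using KU \<open>K \<in> \<F>\<close> \<F> by auto
          qed
        qed (use U in auto)
        also note Ud
        finally have "ennreal (\<Sum>p\<in>I ` \<F>. snd p - fst p) < ennreal d" .
        moreover have "0 \<le> (\<Sum>p\<in>I ` \<F>. snd p - fst p)"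
          using no by (intro sum_nonneg) (auto simp: nonoverlapping_def less_imp_le)
        ultimately show ?thesis by (simp add: ennreal_less_iff)
      qed
      have "emeasure ?\<nu> (\<Union>\<F>) \<le> (\<Sum>K\<in>\<F>. emeasure ?\<nu> K)"
      proof -
        have "K \<in> sets ?\<nu>" if "K \<in> \<F>" for K
          using I(2)[of K] \<F> that by (metis sets_interval_measure borel_closed closed_real_atLeastAtMost subsetD)
        then show ?thesis using emeasure_subadditive_finite[of \<F> "\<lambda>K. K" ?\<nu>] \<F> by auto
      qed
      also have "\<dots> = (\<Sum>K\<in>\<F>. ennreal (F (snd (I K)) - F (fst (I K))))"
      proof (rule sum.cong)
        fix K assume "K \<in> \<F>"
        then have K: "K \<in> \<D>" using \<F> by auto
        show "emeasure ?\<nu> K = ennreal (F (snd (I K)) - F (fst (I K)))"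
          using emeasure_Icc[of "fst (I K)" "snd (I K)"] I[OF K] by simp
      qed simp
      also have "\<dots> = (\<Sum>p\<in>I ` \<F>. ennreal \<bar>F (snd p) - F (fst p)\<bar>)"
        using inj \<F> I(1) by (subst sum.reindex) (auto intro!: sum.cong inj_on_subset[OF inj] simp: mono less_imp_le subset_iff)
      also have "\<dots> = ennreal (vsum F (I ` \<F>))"
        unfolding vsum_def by (rule sum_ennreal) auto
      also have "\<dots> \<le> e" using d(2)[OF no len] by (simp add: ennreal_leI)
      finally show ?thesis .
    qed
    show ?thesis
    proof (cases "\<D> = {}")
      case True then show ?thesis using \<D>(6) by auto
    next
      case False
      define A where "A = (\<lambda>n::nat. \<Union>(from_nat_into \<D> ` {..n}))"
      have inD: "from_nat_into \<D> i \<in> \<D>" for i using False from_nat_into by blast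
      have As: "A n \<in> sets ?\<nu>" for n
        unfolding A_def
      proof (rule sets.finite_Union)
        show "from_nat_into \<D> ` {..n} \<subseteq> sets ?\<nu>"
          using I(2)[OF inD] by (metis sets_interval_measure borel_closed closed_real_atLeastAtMost image_subsetI)
      qed simp
      have "incseq A" unfolding A_def incseq_def by force
      have "\<Union>\<D> = (\<Union>n. A n)"
      proof (intro equalityI subsetI)
        fix x assume "x \<in> \<Union>\<D>"
        then obtain K where K: "K \<in> \<D>" "x \<in> K" by blast
        then obtain i where "from_nat_into \<D> i = K" using from_nat_into_surj[OF \<D>(1)] by blast
        then show "x \<in> (\<Union>n. A n)" using K(2) unfolding A_def by blast
      next
        fix x assume "x \<in> (\<Union>n. A n)"
        then show "x \<in> \<Union>\<D>" using inD unfolding A_def by blast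
      qed
      then have "emeasure ?\<nu> N \<le> emeasure ?\<nu> (\<Union>n. A n)"
        using \<D>(6) As by (intro emeasure_mono) auto
      also have "\<dots> = (SUP n. emeasure ?\<nu> (A n))"
        using \<open>incseq A\<close> As by (intro SUP_emeasure_incseq[symmetric]) auto
      also have "\<dots> \<le> ennreal e"
        unfolding A_def by (intro SUP_least fin_bound) (auto simp: inD)
      finally show ?thesis by simp
    qed
  qed
  then have "emeasure ?\<nu> N \<le> 0" by (rule ennreal_le_epsilon)
  then show ?thesis by simp
qed

lemma ac_interval_measure: "absolutely_continuous lborel (interval_measure F)"
  unfolding absolutely_continuous_def
proof
  fix N :: "real set" assume N: "N \<in> null_sets lborel"
  have "N \<inter> {- real (Suc n)..real (Suc n)} \<in> null_sets (interval_measure F)" for n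
  proof (rule null_setsI)
    show "emeasure (interval_measure F) (N \<inter> {- real (Suc n)..real (Suc n)}) = 0"
      using N by (intro null_bounded[of _ "- real (Suc n)" "real (Suc n)"] null_set_Int2) auto
  qed (use N in auto)
  then have "(\<Union>n. N \<inter> {- real (Suc n)..real (Suc n)}) \<in> null_sets (interval_measure F)"
    by (rule null_sets_UN)
  moreover have "(\<Union>n. N \<inter> {- real (Suc n)..real (Suc n)}) = N"
  proof -
    have "\<exists>n. x \<in> {- real (Suc n)..real (Suc n)}" for x
    proof -
      obtain n where "\<bar>x\<bar> \<le> real n" using real_arch_simple by blast
      then show ?thesis by (intro exI[of _ n]) auto
    qed
    then show ?thesis by blast
  qed
  ultimately show "N \<in> null_sets (interval_measure F)" by simp
qed

text \<open>Radon-Nikodym for the Stieltjes measure of \<open>F\<close>. Bounded intervals have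
  finite measure, so the density is infinite at most on a null set and can be replaced by a real
  function.\<close>

lemma mono_density:
  obtains \<phi> :: "real \<Rightarrow> real" where "\<phi> \<in> borel_measurable borel" "\<And>x. 0 \<le> \<phi> x"
    "\<And>s t. s \<le> t \<Longrightarrow> (\<phi> has_integral F t - F s) {s..t}"
proof -
  obtain h where h: "h \<in> borel_measurable lborel" "density lborel h = interval_measure F"
    using sigma_finite_measure.Radon_Nikodym[OF sigma_finite_lborel ac_interval_measure] by auto
  have [measurable]: "h \<in> borel_measurable borel" using h(1) by simp
  have int: "(\<integral>\<^sup>+x. h x * indicator {s..t} x \<partial>lborel) = ennreal (F t - F s)" if "s \<le> t" for s t
    using emeasure_Icc[OF that] emeasure_density[of h lborel "{s..t}"] h by simp
  define \<phi> where "\<phi> = (\<lambda>x. enn2real (h x))"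
  have m: "\<phi> \<in> borel_measurable borel" unfolding \<phi>_def by measurable
  show thesis
  proof (rule that[OF m])
    show "0 \<le> \<phi> x" for x by (simp add: \<phi>_def)
    fix s t :: real assume st: "s \<le> t"
    have "AE x in lborel. h x * indicator {s..t} x \<noteq> \<infinity>"
      using int[OF st] by (intro nn_integral_PInf_AE) auto
    then have ae: "AE x in lborel. ennreal (\<phi> x * indicator {s..t} x) = h x * indicator {s..t} x"
      by eventually_elim (auto simp: \<phi>_def indicator_def less_top)
    have "(\<integral>\<^sup>+x. ennreal (\<phi> x * indicator {s..t} x) \<partial>lborel) = ennreal (F t - F s)"
      using nn_integral_cong_AE[OF ae] int[OF st] by simp
    then have "((\<lambda>x. \<phi> x * indicator {s..t} x) has_integral (F t - F s)) UNIV"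
      using mono[OF st] m by (intro nn_integral_has_integral) (auto simp: \<phi>_def)
    moreover have "(\<lambda>x. \<phi> x * indicator {s..t} x) = (\<lambda>x. if x \<in> {s..t} then \<phi> x else 0)"
      by (auto simp: indicator_def)
    ultimately show "(\<phi> has_integral F t - F s) {s..t}"
      using has_integral_restrict_UNIV by metis
  qed
qed

text \<open>The differentiation theorem used here concerns averages over intervals to the right of a
  point. Applied to the reflected density it also yields the averages to the left, and the two
  exceptional sets are united.\<close>

lemma mono_differentiable:
  obtains \<phi> N where "negligible N" "\<And>x. x \<notin> N \<Longrightarrow> (F has_real_derivative \<phi> x) (at x)"
    "\<And>s t. s \<le> t \<Longrightarrow> (\<phi> has_integral F t - F s) {s..t}"
proof -
  obtain \<phi> where \<phi>: "\<phi> \<in> borel_measurable borel" "\<And>x. 0 \<le> \<phi> x"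
    "\<And>s t. s \<le> t \<Longrightarrow> (\<phi> has_integral F t - F s) {s..t}" using mono_density by blast
  have refl: "((\<lambda>x. \<phi> (-x)) has_integral F (-s) - F (-t)) {s..t}" if "s \<le> t" for s t
    using has_integral_reflect_real[of \<phi> "F (-s) - F (-t)" "-s" "-t"] \<phi>(3)[of "-t" "-s"] that by simp
  have i1: "\<phi> integrable_on cbox a b" for a b
    using \<phi>(3)[of a b] by (cases "a \<le> b") (auto simp: cbox_interval integrable_on_def)
  have i2: "(\<lambda>x. \<phi> (-x)) integrable_on cbox a b" for a b
    using refl[of a b] by (cases "a \<le> b") (auto simp: cbox_interval integrable_on_def)
  obtain N1 where N1: "negligible N1" "\<And>x e. \<lbrakk>x \<notin> N1; 0 < e\<rbrakk> \<Longrightarrow> \<exists>d>0. \<forall>h. 0 < h \<and> h < d \<longrightarrow>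
       norm(integral (cbox x (x + h *\<^sub>R One)) \<phi> /\<^sub>R h ^ DIM(real) - \<phi> x) < e"
    using integrable_ccontinuous_explicit[of \<phi>, OF i1] by blast
  obtain N2 where N2: "negligible N2" "\<And>x e. \<lbrakk>x \<notin> N2; 0 < e\<rbrakk> \<Longrightarrow> \<exists>d>0. \<forall>h. 0 < h \<and> h < d \<longrightarrow>
       norm(integral (cbox x (x + h *\<^sub>R One)) (\<lambda>x. \<phi> (-x)) /\<^sub>R h ^ DIM(real) - \<phi> (-x)) < e"
    using integrable_ccontinuous_explicit[of "\<lambda>x. \<phi> (-x)", OF i2] by blast
  have negl: "negligible (N1 \<union> uminus ` N2)"
    using N1(1) N2(1) by (auto intro!: negligible_Un negligible_differentiable_image_negligible derivative_intros)
  show thesis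
  proof (rule that[OF negl _ \<phi>(3)])
    fix x assume "x \<notin> N1 \<union> uminus ` N2"
    then have x: "x \<notin> N1" "-x \<notin> N2" by (auto simp: image_iff)
    have "((\<lambda>h. (F (x + h) - F x) / h) \<longlongrightarrow> \<phi> x) (at 0)"
      unfolding LIM_eq
    proof (intro allI impI)
      fix e :: real assume e: "0 < e"
      obtain d1 where d1: "d1 > 0" "\<And>h. 0 < h \<and> h < d1 \<Longrightarrow>
         norm(integral (cbox x (x + h *\<^sub>R One)) \<phi> /\<^sub>R h ^ DIM(real) - \<phi> x) < e"
        using N1(2)[OF x(1) e] by blast
      obtain d2 where d2: "d2 > 0" "\<And>h. 0 < h \<and> h < d2 \<Longrightarrow>
         norm(integral (cbox (-x) (-x + h *\<^sub>R One)) (\<lambda>x. \<phi> (-x)) /\<^sub>R h ^ DIM(real) - \<phi> (-(-x))) < e"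
        using N2(2)[OF x(2) e] by blast
      show "\<exists>s>0. \<forall>h. h \<noteq> 0 \<and> norm (h - 0) < s \<longrightarrow> norm ((F (x + h) - F x) / h - \<phi> x) < e"
      proof (intro exI[of _ "min d1 d2"] conjI allI impI)
        fix h :: real assume h: "h \<noteq> 0 \<and> norm (h - 0) < min d1 d2"
        show "norm ((F (x + h) - F x) / h - \<phi> x) < e"
        proof (cases "0 < h")
          case True
          have "integral {x..x + h} \<phi> = F (x + h) - F x" using \<phi>(3)[of x "x + h"] True by (simp add: integral_unique)
          then show ?thesis using d1(2)[of h] h True by (simp add: cbox_interval field_simps)
        next
          case False
          then have h0: "0 < - h" using h by simp
          have "integral {-x..-x + (-h)} (\<lambda>x. \<phi> (-x)) = F (-(-x)) - F (-(-x + (-h)))"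
            using refl[of "-x" "-x + (-h)"] h0 by (intro integral_unique) auto
          then have *: "integral {-x..-x + (-h)} (\<lambda>x. \<phi> (-x)) = F x - F (x + h)" by (simp add: add.commute)
          have "norm ((F x - F (x + h)) / (-h) - \<phi> x) < e"
            using d2(2)[of "-h"] h h0 * by (simp add: cbox_interval divide_inverse_commute)
          moreover have "(F x - F (x + h)) / (-h) = (F (x + h) - F x) / h" using h0 by (simp add: field_simps)
          ultimately show ?thesis by simp
        qed
      qed (use d1 d2 in auto)
    qed
    then show "(F has_real_derivative \<phi> x) (at x)" by (simp add: DERIV_def)
  qed
qed

end

text \<open>\<open>f\<close> is the difference of \<open>gvar f\<close> and
  \<open>gvar f - f\<close>, both monotone and absolutely continuous.\<close>

theorem locally_absolutely_continuous_FTC: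
  assumes lac: "locally_absolutely_continuous f"
  obtains \<phi> N where "negligible N" "\<And>x. x \<notin> N \<Longrightarrow> (f has_real_derivative \<phi> x) (at x)"
    "\<And>s t. s \<le> t \<Longrightarrow> (\<phi> has_integral f t - f s) {s..t}"
proof -
  obtain N p where p: "negligible N" "\<And>x. x \<notin> N \<Longrightarrow> (gvar f has_real_derivative p x) (at x)"
    "\<And>s t. s \<le> t \<Longrightarrow> (p has_integral gvar f t - gvar f s) {s..t}"
    by (rule mono_differentiable[OF gvar_mono[OF lac] vsum_continuous_gvar[OF lac]], assumption, rule that)
  obtain M q where q: "negligible M"
    "\<And>x. x \<notin> M \<Longrightarrow> ((\<lambda>t. gvar f t - f t) has_real_derivative q x) (at x)"
    "\<And>s t. s \<le> t \<Longrightarrow> (q has_integral (gvar f t - f t) - (gvar f s - f s)) {s..t}"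
    by (rule mono_differentiable[OF gvar_minus_mono[OF lac] vsum_continuous_gvar_minus[OF lac]], assumption, rule that)
  show thesis
  proof (rule that[of "N \<union> M" "\<lambda>x. p x - q x"])
    show "negligible (N \<union> M)" using p q by auto
    fix x assume "x \<notin> N \<union> M"
    then have "((\<lambda>t. gvar f t - (gvar f t - f t)) has_real_derivative p x - q x) (at x)"
      using p q by (intro derivative_intros) auto
    then show "(f has_real_derivative p x - q x) (at x)" by simp
  next
    fix s t :: real assume st: "s \<le> t"
    show "((\<lambda>x. p x - q x) has_integral f t - f s) {s..t}"
      using has_integral_diff[OF p(3)[OF st] q(3)[OF st]] by simp
  qed
qed

text \<open>Off a null set \<open>deriv f\<close> is a genuine derivative and equals the density
  whose integral recovers \<open>f\<close>. A merely continuous \<open>f\<close> could increase with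
  derivative 0 almost everywhere.\<close>

theorem locally_absolutely_continuous_lipschitz:
  assumes lac: "locally_absolutely_continuous f" and ae: "AE t in lebesgue. \<bar>deriv f t\<bar> \<le> S"
  shows "\<bar>f t - f s\<bar> \<le> S * \<bar>t - s\<bar>"
proof -
  obtain \<phi> N where \<phi>: "negligible N" "\<And>x. x \<notin> N \<Longrightarrow> (f has_real_derivative \<phi> x) (at x)"
    "\<And>s t. s \<le> t \<Longrightarrow> (\<phi> has_integral f t - f s) {s..t}"
    using locally_absolutely_continuous_FTC[OF lac] by metis
  obtain M where M: "M \<in> null_sets lebesgue" "{t \<in> space lebesgue. \<not> \<bar>deriv f t\<bar> \<le> S} \<subseteq> M"
    using ae unfolding eventually_ae_filter by blast
  have "negligible (N \<union> M)" using \<phi>(1) M(1) by (auto simp: negligible_iff_null_sets)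
  have b: "\<bar>\<phi> x\<bar> \<le> S" if "x \<notin> N \<union> M" for x
  proof -
    have "\<bar>deriv f x\<bar> \<le> S" using that M(2) by auto
    then show ?thesis using DERIV_imp_deriv[OF \<phi>(2)[of x]] that by simp
  qed
  have *: "\<bar>f t - f s\<bar> \<le> S * (t - s)" if st: "s \<le> t" for s t
  proof -
    define \<psi> where "\<psi> = (\<lambda>x. if x \<in> N \<union> M then 0 else \<phi> x)"
    have i: "(\<psi> has_integral f t - f s) (cbox s t)"
      using has_integral_spike[OF \<open>negligible (N \<union> M)\<close> _ \<phi>(3)[OF st], of \<psi>] by (auto simp: \<psi>_def cbox_interval)
    have S0: "0 \<le> S"
    proof -
      have "\<exists>x. x \<notin> N \<union> M" using \<open>negligible (N \<union> M)\<close> non_negligible_UNIV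
        by (metis UNIV_eq_I)
      then show ?thesis using b abs_ge_zero order_trans by blast
    qed
    have "norm (f t - f s) \<le> S * measure lborel (cbox s t)"
      by (rule has_integral_bound[OF S0 i]) (use b S0 in \<open>auto simp: \<psi>_def\<close>)
    then show ?thesis using st by (simp add: cbox_interval)
  qed
  show ?thesis using *[of s t] *[of t s] by (cases "s \<le> t") (auto simp: abs_minus_commute)
qed

lemma lipschitz_locally_absolutely_continuous:
  assumes lip: "\<And>s t. \<bar>f t - f s\<bar> \<le> C * \<bar>t - s\<bar>" and "0 \<le> C"
  shows "locally_absolutely_continuous f"
  unfolding locally_absolutely_continuous_def absolutely_continuous_on_Icc_def
proof (intro allI impI)
  fix a b e :: real assume e: "0 < e"
  show "\<exists>\<delta>>0. \<forall>\<D> S. \<D> division_of S \<and> S \<subseteq> {a..b} \<and> (\<Sum>K\<in>\<D>. Sup K - Inf K) < \<delta> \<longrightarrow>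
        (\<Sum>K\<in>\<D>. \<bar>f (Sup K) - f (Inf K)\<bar>) < e"
  proof (intro exI[of _ "e / (C + 1)"] conjI allI impI)
    fix \<D> S assume D: "\<D> division_of S \<and> S \<subseteq> {a..b} \<and> (\<Sum>K\<in>\<D>. Sup K - Inf K) < e / (C + 1)"
    have "Inf K \<le> Sup K" if "K \<in> \<D>" for K
    proof -
      have "\<D> division_of S" using D by blast
      from division_ofD(3,4)[OF this that] obtain c d where "K = cbox c d" "K \<noteq> {}" by auto
      then show ?thesis by (auto simp: cbox_interval)
    qed
    then have "(\<Sum>K\<in>\<D>. \<bar>f (Sup K) - f (Inf K)\<bar>) \<le> C * (\<Sum>K\<in>\<D>. Sup K - Inf K)"
      unfolding sum_distrib_left by (intro sum_mono) (metis abs_of_nonneg diff_ge_0_iff_ge lip)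
    also have "\<dots> \<le> C * (e / (C + 1))" using D \<open>0 \<le> C\<close> by (intro mult_left_mono) auto
    also have "\<dots> < e" using e \<open>0 \<le> C\<close> by (simp add: field_simps)
    finally show "(\<Sum>K\<in>\<D>. \<bar>f (Sup K) - f (Inf K)\<bar>) < e" .
  qed (use e \<open>0 \<le> C\<close> in auto)
qed

subsection \<open>Comparison with a quarter wave\<close>

text \<open>The premise is strict so that, for \<open>f\<close> bounded by \<open>P 0\<close>, it
  cannot hold with \<open>s\<close> on a flat top of \<open>P\<close>, where any descent of
  \<open>f\<close> would be faster than that of \<open>P\<close>. In the applications
  \<open>l\<close> is the point where \<open>P\<close> first vanishes, which may lie before the end
  of the quarter.\<close>

definition falls_slower :: "real \<Rightarrow> (real \<Rightarrow> real) \<Rightarrow> (real \<Rightarrow> real) \<Rightarrow> bool" where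
  "falls_slower l P f \<longleftrightarrow>
     (\<forall>t s w. 0 \<le> s \<longrightarrow> 0 \<le> w \<longrightarrow> s + w \<le> l \<longrightarrow> P s < f t \<longrightarrow> P (s + w) < f (t + w))"

text \<open>Integrating one of the four conditions consumes another of them, with sign and direction
  of time reversed; only all four together are stable.\<close>

definition comparison :: "real \<Rightarrow> (real \<Rightarrow> real) \<Rightarrow> (real \<Rightarrow> real) \<Rightarrow> bool" where
  "comparison l P f \<longleftrightarrow> (\<forall>\<alpha>\<in>{1,-1}. \<forall>\<beta>\<in>{1,-1}. falls_slower l P (\<lambda>t. \<alpha> * f (\<beta> * t)))"

lemma falls_slowerD:
  "falls_slower l P f \<Longrightarrow> 0 \<le> s \<Longrightarrow> 0 \<le> w \<Longrightarrow> s + w \<le> l \<Longrightarrow> P s < f t \<Longrightarrow> P (s + w) < f (t + w)"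
  unfolding falls_slower_def by blast

lemma comparison_reflect:
  assumes "comparison l P f" "\<alpha> \<in> {1,-1}" "\<beta> \<in> {1,-1}"
  shows "comparison l P (\<lambda>t. \<alpha> * f (\<beta> * t))"
  unfolding comparison_def
proof (intro ballI)
  fix a b :: real assume ab: "a \<in> {1,-1}" "b \<in> {1,-1}"
  have "falls_slower l P (\<lambda>t. (a * \<alpha>) * f ((\<beta> * b) * t))"
    using assms ab unfolding comparison_def by (elim insertE emptyE) auto
  then show "falls_slower l P (\<lambda>t. a * (\<alpha> * f (\<beta> * (b * t))))" by (simp add: mult.assoc)
qed

lemma comparison_falls_slower:
  assumes "comparison l P f"
  shows "falls_slower l P f" "falls_slower l P (\<lambda>t. - f t)"
    "falls_slower l P (\<lambda>t. f (- t))" "falls_slower l P (\<lambda>t. - f (- t))"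
  using assms unfolding comparison_def by auto

lemma comparison_uminus: "comparison l P f \<Longrightarrow> comparison l P (\<lambda>t. - f t)"
  using comparison_reflect[of l P f "-1" 1] by simp

lemma falls_slower_antiderivative:
  assumes cmp: "falls_slower l P (\<lambda>t. - f (- t))"
    and F: "\<And>t. (F has_real_derivative f t) (at t)"
    and H: "\<And>s. (H has_real_derivative - P (q - s)) (at s)"
    and bound: "\<And>t. F t \<le> H 0"
    and flat: "\<And>s. 0 \<le> s \<Longrightarrow> s \<le> q - l \<Longrightarrow> H s = H 0"
    and l: "l \<le> q"
  shows "falls_slower q H F"
  unfolding falls_slower_def
proof (intro allI impI, rule ccontr)
  fix t s w assume s: "0 \<le> s" and w: "0 \<le> w" "s + w \<le> q" and start: "H s < F t"
    and fin: "\<not> H (s + w) < F (t + w)"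
  define g where "g = (\<lambda>u. F (t + u) - H (s + u))"
  have g': "(g has_real_derivative f (t + u) + P (q - (s + u))) (at u)" for u
    unfolding g_def
    by (rule derivative_eq_intros DERIV_chain2[OF F] DERIV_chain2[OF H] refl | simp)+
  have gc: "continuous_on A g" for A
    using g' by (meson DERIV_isCont continuous_at_imp_continuous_on)
  \<comment> \<open>\<open>u0\<close> will be the first moment at which \<open>F\<close> is no
    longer above \<open>H\<close>. The mean value theorem before \<open>u0\<close> gives a moment at
    which \<open>F\<close> is still above \<open>H\<close> but falls faster.\<close>
  have "closed ({0..w} \<inter> {u. g u \<le> 0})"
    using gc by (intro closed_Int closed_Collect_le) auto
  then have "compact ({0..w} \<inter> {u. g u \<le> 0})"
    by (simp add: compact_eq_bounded_closed bounded_Int)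
  moreover have "w \<in> {0..w} \<inter> {u. g u \<le> 0}" using w fin by (auto simp: g_def)
  then have "{0..w} \<inter> {u. g u \<le> 0} \<noteq> {}" by blast
  ultimately obtain u0 where "u0 \<in> {0..w} \<inter> {u. g u \<le> 0}" "\<forall>u\<in>{0..w} \<inter> {u. g u \<le> 0}. u0 \<le> u"
    using compact_attains_inf by blast
  then have u0: "u0 \<in> {0..w}" "g u0 \<le> 0" "\<And>u. u \<in> {0..w} \<Longrightarrow> g u \<le> 0 \<Longrightarrow> u0 \<le> u"
    by blast+
  have g0: "0 < g 0" using start by (simp add: g_def)
  then have "0 < u0" using u0 by (cases "u0 = 0") auto
  from MVT2[OF this g'] obtain v where v: "0 < v" "v < u0"
    "g u0 - g 0 = (u0 - 0) * (f (t + v) + P (q - (s + v)))" by blast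
  have neg: "f (t + v) + P (q - (s + v)) < 0"
    using v g0 u0(2) \<open>0 < u0\<close> by (smt (verit) mult_nonneg_nonneg)
  have pos: "H (s + v) < F (t + v)"
    using u0(3)[of v] v u0(1) by (force simp: g_def)
  define s' t' where "s' = s + v" and "t' = t + v"
  \<comment> \<open>On its flat top \<open>H\<close> has its maximal value, which bounds
    \<open>F\<close>. So \<open>s'\<close> lies beyond it, and \<open>q - s'\<close> lies before the
    foot \<open>l\<close> of \<open>P\<close>.\<close>
  have s': "q - l < s'"
  proof (rule ccontr)
    assume "\<not> q - l < s'"
    then have "H s' = H 0" using s v(1) by (intro flat) (auto simp: s'_def)
    then show False using pos bound[of t'] unfolding s'_def t'_def by linarith
  qed
  have s'q: "s' \<le> q" using v(2) w u0(1) by (simp add: s'_def)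
  \<comment> \<open>Time runs backwards from \<open>s'\<close> to the end of the flat top of
    \<open>H\<close>. By the hypothesis on the reflected derivative, \<open>- f\<close> stays above
    the rate of fall of \<open>H\<close> all the way, so the excess of \<open>F\<close> over
    \<open>H\<close> cannot shrink.\<close>
  define G where "G = (\<lambda>u. F (t' - u) - H (s' - u))"
  have G': "(G has_real_derivative - f (t' - u) - P (q - (s' - u))) (at u)" for u
    unfolding G_def
    by (rule derivative_eq_intros DERIV_chain2[OF F] DERIV_chain2[OF H] refl | simp)+
  have "0 \<le> - f (t' - u) - P (q - (s' - u))" if "0 \<le> u" "u \<le> s' - (q - l)" for u
  proof -
    have "P (q - s') < - f (- (- t'))" using neg by (simp only: s'_def t'_def minus_minus)
    then have "P (q - s' + u) < - f (- (- t' + u))"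
      using falls_slowerD[OF cmp, of "q - s'" u "-t'"] that s'q by simp
    moreover have "q - s' + u = q - (s' - u)" "- (- t' + u) = t' - u" by simp_all
    ultimately show ?thesis by simp
  qed
  then have "\<exists>y. DERIV G u :> y \<and> 0 \<le> y" if "0 \<le> u" "u \<le> s' - (q - l)" for u
    using G'[of u] that by blast
  then have "G 0 \<le> G (s' - (q - l))"
    using s' by (intro DERIV_nonneg_imp_nondecreasing[of 0 _ G]) auto
  then have "H 0 < F (t' - (s' - (q - l)))"
    using pos flat[of "q - l"] l by (simp add: G_def s'_def t'_def)
  then show False using bound[of "t' - (s' - (q - l))"] by simp
qed

lemma comparison_antiderivative:
  assumes cmp: "comparison l P f"
    and F: "\<And>t. (F has_real_derivative f t) (at t)"
    and H: "\<And>s. (H has_real_derivative - P (q - s)) (at s)"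
    and bound: "\<And>t. \<bar>F t\<bar> \<le> H 0"
    and flat: "\<And>s. 0 \<le> s \<Longrightarrow> s \<le> q - l \<Longrightarrow> H s = H 0"
    and l: "l \<le> q"
  shows "comparison q H F"
  unfolding comparison_def
proof (intro ballI)
  fix \<alpha> \<beta> :: real assume ab: "\<alpha> \<in> {1,-1}" "\<beta> \<in> {1,-1}"
  \<comment> \<open>The chain rule: reflecting \<open>F\<close> by \<alpha> and \<beta> reflects its
    derivative by \<open>\<alpha> * \<beta>\<close> and \<beta>.\<close>
  have "comparison l P (\<lambda>t. (\<alpha> * \<beta>) * f (\<beta> * t))"
    using ab by (intro comparison_reflect[OF cmp]) auto
  from comparison_falls_slower(4)[OF this]
  show "falls_slower q H (\<lambda>t. \<alpha> * F (\<beta> * t))"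
  proof (rule falls_slower_antiderivative[OF _ _ H _ flat l])
    show "((\<lambda>t. \<alpha> * F (\<beta> * t)) has_real_derivative \<alpha> * \<beta> * f (\<beta> * t)) (at t)" for t
      by (rule derivative_eq_intros DERIV_chain2[OF F] refl | simp)+
    show "\<alpha> * F (\<beta> * t) \<le> H 0" for t using ab bound[of "\<beta> * t"] by auto
  qed
qed

text \<open>Past the flat top a slight increase of \<open>s\<close> makes the premise strict, and
  continuity of \<open>P\<close> removes the shift from the conclusion. The strict
  \<open>s + w < l\<close> leaves room for the shift.\<close>

lemma falls_slower_le:
  assumes fs: "falls_slower l P f" and cont: "\<And>s. isCont P s"
    and dec: "\<And>s s'. e \<le> s \<Longrightarrow> s < s' \<Longrightarrow> s' \<le> l \<Longrightarrow> P s' < P s"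
    and "0 \<le> e" "e \<le> s" "0 \<le> w" "s + w < l" "P s \<le> f t"
  shows "P (s + w) \<le> f (t + w)"
proof (rule ccontr)
  assume "\<not> P (s + w) \<le> f (t + w)"
  then have "\<forall>\<^sub>F x in at (s + w). f (t + w) < P x"
    using cont[of "s + w"] by (intro order_tendstoD) (auto simp: isCont_def)
  then obtain d where d: "d > 0" "\<And>x. x \<noteq> s + w \<Longrightarrow> dist x (s + w) < d \<Longrightarrow> f (t + w) < P x"
    unfolding eventually_at by auto
  define n where "n = min (d/2) (l - (s + w))"
  have n: "0 < n" "n < d" "s + w + n \<le> l" using assms d(1) by (auto simp: n_def)
  have "f (t + w) < P (s + n + w)" using d(2)[of "s + n + w"] n by (simp add: dist_real_def)
  moreover have "P (s + n) < f t"
  proof -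
    have "s + n \<le> l" using n(3) \<open>0 \<le> w\<close> by linarith
    from dec[OF \<open>e \<le> s\<close> _ this] show ?thesis using n(1) assms(8) by simp
  qed
  then have "P (s + n + w) < f (t + w)" using falls_slowerD[OF fs, of "s + n" w t] assms n by simp
  ultimately show False by simp
qed

text \<open>Since \<open>P\<close> has no flat top, \<open>f\<close> dominates it for a whole
  quarter on both sides of \<open>t\<close>. Over these two quarters \<open>F\<close> grows by at
  least \<open>2 * H 0\<close>, so at one of their ends its modulus is at least
  \<open>H 0\<close>.\<close>

lemma comparison_peak:
  assumes cmp: "comparison l P f" and cont: "\<And>s. isCont P s"
    and dec: "\<And>s s'. 0 \<le> s \<Longrightarrow> s < s' \<Longrightarrow> s' \<le> l \<Longrightarrow> P s' < P s"
    and l: "0 < l"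
    and F: "\<And>t. (F has_real_derivative f t) (at t)"
    and H: "\<And>s. (H has_real_derivative - P (l - s)) (at s)"
    and Hl: "H l = 0" and peak: "P 0 \<le> f t"
  shows "\<exists>t. H 0 \<le> \<bar>F t\<bar>"
proof -
  have 1: "P u \<le> f (t + u)" "P u \<le> f (t - u)" if "0 \<le> u" "u < l" for u
    using falls_slower_le[OF comparison_falls_slower(1)[OF cmp] cont dec, of 0 0 u t]
      falls_slower_le[OF comparison_falls_slower(3)[OF cmp] cont dec, of 0 0 u "-t"] that peak
    by (simp_all add: algebra_simps)
  define g where "g = (\<lambda>u. F (t + u) - H (l - u))"
  define h where "h = (\<lambda>u. - F (t - u) - H (l - u))"
  have g': "(g has_real_derivative f (t + u) - P u) (at u)" for u
    unfolding g_def
    by (rule derivative_eq_intros DERIV_chain2[OF F] DERIV_chain2[OF H] refl | simp)+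
  have h': "(h has_real_derivative f (t - u) - P u) (at u)" for u
    unfolding h_def
    by (rule derivative_eq_intros DERIV_chain2[OF F] DERIV_chain2[OF H] refl | simp)+
  have "g 0 \<le> g l"
  proof (rule DERIV_nonneg_imp_increasing_open[of 0 l g])
    show "\<exists>y. DERIV g x :> y \<and> 0 \<le> y" if "0 < x" "x < l" for x
      using g'[of x] 1[of x] that by (intro exI[of _ "f (t + x) - P x"]) auto
    show "continuous_on {0..l} g" using g' by (meson DERIV_isCont continuous_at_imp_continuous_on)
  qed (use l in auto)
  moreover have "h 0 \<le> h l"
  proof (rule DERIV_nonneg_imp_increasing_open[of 0 l h])
    show "\<exists>y. DERIV h x :> y \<and> 0 \<le> y" if "0 < x" "x < l" for x
      using h'[of x] 1[of x] that by (intro exI[of _ "f (t - x) - P x"]) auto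
    show "continuous_on {0..l} h" using h' by (meson DERIV_isCont continuous_at_imp_continuous_on)
  qed (use l in auto)
  ultimately have "F t + H 0 \<le> F (t + l)" "F (t - l) \<le> F t - H 0" using Hl by (auto simp: g_def h_def)
  then have "H 0 \<le> \<bar>F (t + l)\<bar> \<or> H 0 \<le> \<bar>F (t - l)\<bar>" by linarith
  then show ?thesis by blast
qed

lemma comparison_peak_abs:
  assumes cmp: "comparison l P f" and cont: "\<And>s. isCont P s"
    and dec: "\<And>s s'. 0 \<le> s \<Longrightarrow> s < s' \<Longrightarrow> s' \<le> l \<Longrightarrow> P s' < P s"
    and l: "0 < l"
    and F: "\<And>t. (F has_real_derivative f t) (at t)"
    and H: "\<And>s. (H has_real_derivative - P (l - s)) (at s)"
    and Hl: "H l = 0" and peak: "P 0 \<le> \<bar>f t\<bar>"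
  shows "\<exists>t. H 0 \<le> \<bar>F t\<bar>"
proof (cases "0 \<le> f t")
  case True
  then show ?thesis using comparison_peak[OF cmp cont dec l F H Hl, of t] peak by simp
next
  case False
  have "\<exists>t. H 0 \<le> \<bar>- F t\<bar>"
    using comparison_peak[OF comparison_uminus[OF cmp] cont dec l _ H Hl, of "\<lambda>t. - F t" t] F peak False
    by (auto intro: DERIV_minus)
  then show ?thesis by simp
qed

text \<open>Take \<tau> to be the last point of \<open>{\<alpha>..\<beta>}\<close> with
  \<open>P a \<le> z \<tau>\<close>. After it \<open>z\<close> is below \<open>P a\<close>, and by
  comparison it remains above \<open>P b\<close> for as long as \<open>P\<close> needs to fall from
  the upper level to the lower.\<close>

lemma descent_interval:
  assumes fs: "falls_slower q P z" and cont: "\<And>s. isCont P s"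
    and dec: "\<And>s s'. e \<le> s \<Longrightarrow> s < s' \<Longrightarrow> s' \<le> q \<Longrightarrow> P s' < P s"
    and e: "0 \<le> e" "e \<le> a" "a < b" "b \<le> q" "0 \<le> P b"
    and z: "continuous_on UNIV z" and "\<alpha> < \<beta>" "P a \<le> z \<alpha>" "z \<beta> \<le> 0"
  shows "\<exists>\<tau>. {\<tau><..<\<tau> + (b - a)} \<subseteq> {t \<in> {\<alpha><..<\<beta>}. P b < z t \<and> z t \<le> P a}"
proof -
  have Pab: "P b < P a" using dec e by simp
  have "closed ({\<alpha>..\<beta>} \<inter> {t. P a \<le> z t})"
    using z by (intro closed_Int closed_Collect_le) auto
  then have "compact ({\<alpha>..\<beta>} \<inter> {t. P a \<le> z t})"
    by (simp add: compact_eq_bounded_closed bounded_Int)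
  moreover have "\<alpha> \<in> {\<alpha>..\<beta>} \<inter> {t. P a \<le> z t}" using \<open>\<alpha> < \<beta>\<close> \<open>P a \<le> z \<alpha>\<close> by auto
  then have "{\<alpha>..\<beta>} \<inter> {t. P a \<le> z t} \<noteq> {}" by blast
  ultimately obtain \<tau> where "\<tau> \<in> {\<alpha>..\<beta>} \<inter> {t. P a \<le> z t}" "\<forall>t\<in>{\<alpha>..\<beta>} \<inter> {t. P a \<le> z t}. t \<le> \<tau>"
    using compact_attains_sup by blast
  then have \<tau>: "\<alpha> \<le> \<tau>" "\<tau> \<le> \<beta>" "P a \<le> z \<tau>"
    "\<And>t. \<alpha> \<le> t \<Longrightarrow> t \<le> \<beta> \<Longrightarrow> P a \<le> z t \<Longrightarrow> t \<le> \<tau>"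
    by auto
  have below: "z t < P a" if "\<tau> < t" "t \<le> \<beta>" for t using \<tau>(4)[of t] \<tau>(1) that by force
  have above: "P b < z (\<tau> + u)" if "0 \<le> u" "u < b - a" for u
  proof -
    have "P (a + u) \<le> z (\<tau> + u)"
      using falls_slower_le[OF fs cont dec, of e a u \<tau>] e that \<tau>(3) by simp
    moreover have "P b < P (a + u)" using dec[of "a + u" b] e that by simp
    ultimately show ?thesis by simp
  qed
  have "\<tau> + (b - a) \<le> \<beta>"
  proof (rule ccontr)
    assume "\<not> \<tau> + (b - a) \<le> \<beta>"
    then show False using above[of "\<beta> - \<tau>"] \<tau>(2) assms by simp
  qed
  then have "{\<tau><..<\<tau> + (b - a)} \<subseteq> {t \<in> {\<alpha><..<\<beta>}. P b < z t \<and> z t \<le> P a}"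
    using above[of "_ - \<tau>"] below \<tau>(1) by (auto intro: less_imp_le)
  then show ?thesis by blast
qed

text \<open>Between \<open>z \<alpha>\<close> and \<open>- z \<alpha>\<close> the band of moduli is
  crossed twice: once by a descent on the positive side, once on the negative side, where the
  reflected function \<open>- z (- t)\<close> shows a descent starting from \<beta>.\<close>

lemma band_measure_half:
  assumes cmp: "comparison q P z" and cont: "\<And>s. isCont P s"
    and dec: "\<And>s s'. e \<le> s \<Longrightarrow> s < s' \<Longrightarrow> s' \<le> q \<Longrightarrow> P s' < P s"
    and e: "0 \<le> e" "e \<le> a" "a < b" "b \<le> q" "0 \<le> P b"
    and z: "continuous_on UNIV z" and ab: "\<alpha> < \<beta>" "P a \<le> z \<alpha>" "z \<beta> = - z \<alpha>"
  shows "ennreal (2 * (b - a)) \<le> emeasure lborel {t \<in> {\<alpha><..<\<beta>}. P b < \<bar>z t\<bar> \<and> \<bar>z t\<bar> \<le> P a}"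
proof -
  have Pab: "P b < P a" using dec e by simp
  obtain \<tau> where \<tau>: "{\<tau><..<\<tau> + (b - a)} \<subseteq> {t \<in> {\<alpha><..<\<beta>}. P b < z t \<and> z t \<le> P a}"
    using descent_interval[OF comparison_falls_slower(1)[OF cmp] cont dec e z ab(1,2)] ab e Pab by auto
  have zr: "continuous_on UNIV (\<lambda>t. - z (- t))"
    using z by (intro continuous_intros continuous_on_compose2[OF z]) auto
  obtain \<sigma> where \<sigma>: "{\<sigma><..<\<sigma> + (b - a)} \<subseteq> {t \<in> {-\<beta><..<-\<alpha>}. P b < - z (- t) \<and> - z (- t) \<le> P a}"
    using descent_interval[OF comparison_falls_slower(4)[OF cmp] cont dec e zr, of "-\<beta>" "-\<alpha>"] ab e Pab by auto
  have \<sigma>': "{-\<sigma> - (b - a)<..<-\<sigma>} \<subseteq> {t \<in> {\<alpha><..<\<beta>}. P b < - z t \<and> - z t \<le> P a}"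
  proof
    fix t assume "t \<in> {-\<sigma> - (b - a)<..<-\<sigma>}"
    then have "- t \<in> {\<sigma><..<\<sigma> + (b - a)}" by auto
    then show "t \<in> {t \<in> {\<alpha><..<\<beta>}. P b < - z t \<and> - z t \<le> P a}" using \<sigma> by auto
  qed
  let ?S = "{t \<in> {\<alpha><..<\<beta>}. P b < \<bar>z t\<bar> \<and> \<bar>z t\<bar> \<le> P a}"
  have [measurable]: "z \<in> borel_measurable borel" using z by (rule borel_measurable_continuous_onI)
  have disj: "{\<tau><..<\<tau> + (b - a)} \<inter> {-\<sigma> - (b - a)<..<-\<sigma>} = {}"
  proof (rule ccontr)
    assume "{\<tau><..<\<tau> + (b - a)} \<inter> {-\<sigma> - (b - a)<..<-\<sigma>} \<noteq> {}"
    then obtain t where "t \<in> {\<tau><..<\<tau> + (b - a)}" "t \<in> {-\<sigma> - (b - a)<..<-\<sigma>}" by blast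
    then have "P b < z t" "P b < - z t" using \<tau> \<sigma>' by blast+
    then show False using e by linarith
  qed
  have "ennreal (2 * (b - a)) = emeasure lborel {\<tau><..<\<tau> + (b - a)} + emeasure lborel {-\<sigma> - (b - a)<..<-\<sigma>}"
    using e by (simp flip: ennreal_plus)
  also have "\<dots> = emeasure lborel ({\<tau><..<\<tau> + (b - a)} \<union> {-\<sigma> - (b - a)<..<-\<sigma>})"
    using disj by (intro plus_emeasure) auto
  also have "\<dots> \<le> emeasure lborel ?S"
  proof (rule emeasure_mono)
    have "{t \<in> {\<alpha><..<\<beta>}. P b < z t \<and> z t \<le> P a} \<subseteq> ?S" "{t \<in> {\<alpha><..<\<beta>}. P b < - z t \<and> - z t \<le> P a} \<subseteq> ?S"
      using e by auto
    then show "{\<tau><..<\<tau> + (b - a)} \<union> {-\<sigma> - (b - a)<..<-\<sigma>} \<subseteq> ?S"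
      using \<tau> \<sigma>' by blast
    show "?S \<in> sets lborel" by measurable
  qed
  finally show ?thesis .
qed

text \<open>Two crossings on the way down and two on the way back. The bound is the time that the
  modulus of the wave itself spends in the band during a full period.\<close>

lemma band_measure:
  assumes cmp: "comparison q P z" and cont: "\<And>s. isCont P s"
    and dec: "\<And>s s'. e \<le> s \<Longrightarrow> s < s' \<Longrightarrow> s' \<le> q \<Longrightarrow> P s' < P s"
    and e: "0 \<le> e" "e \<le> a" "a < b" "b \<le> q" "0 \<le> P b"
    and z: "continuous_on UNIV z" and "\<alpha> < \<beta>" "\<beta> < \<gamma>" "P a \<le> z \<alpha>" "z \<beta> = - z \<alpha>" "z \<gamma> = z \<alpha>"
  shows "ennreal (4 * (b - a)) \<le> emeasure lborel {t \<in> {\<alpha>..\<gamma>}. P b < \<bar>z t\<bar> \<and> \<bar>z t\<bar> \<le> P a}"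
proof -
  let ?S = "\<lambda>A. {t \<in> A. P b < \<bar>z t\<bar> \<and> \<bar>z t\<bar> \<le> P a}"
  have [measurable]: "z \<in> borel_measurable borel" using z by (rule borel_measurable_continuous_onI)
  have "ennreal (4 * (b - a)) = ennreal (2 * (b - a)) + ennreal (2 * (b - a))"
    using e by (simp flip: ennreal_plus)
  also have "\<dots> \<le> emeasure lborel (?S {\<alpha><..<\<beta>}) + emeasure lborel (?S {\<beta><..<\<gamma>})"
  proof (rule add_mono)
    show "ennreal (2 * (b - a)) \<le> emeasure lborel (?S {\<alpha><..<\<beta>})"
      by (rule band_measure_half[OF cmp cont dec e z]) (use assms in auto)
    have "ennreal (2 * (b - a)) \<le> emeasure lborel {t \<in> {\<beta><..<\<gamma>}. P b < \<bar>- z t\<bar> \<and> \<bar>- z t\<bar> \<le> P a}"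
      by (rule band_measure_half[OF comparison_uminus[OF cmp] cont dec e])
        (use assms in \<open>auto intro: continuous_on_minus\<close>)
    then show "ennreal (2 * (b - a)) \<le> emeasure lborel (?S {\<beta><..<\<gamma>})" by simp
  qed
  also have "\<dots> = emeasure lborel (?S {\<alpha><..<\<beta>} \<union> ?S {\<beta><..<\<gamma>})"
    by (intro plus_emeasure) auto
  also have "\<dots> \<le> emeasure lborel (?S {\<alpha>..\<gamma>})"
    by (intro emeasure_mono) (use assms in auto)
  finally show ?thesis .
qed

subsection \<open>Distribution functions and power integrals\<close>

lemma nn_integral_shift:
  fixes f :: "real \<Rightarrow> ennreal"
  assumes [measurable]: "f \<in> borel_measurable borel"
  shows "(\<integral>\<^sup>+t\<in>{a + c..<b + c}. f t \<partial>lborel) = (\<integral>\<^sup>+t\<in>{a..<b}. f (t + c) \<partial>lborel)"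
proof -
  have "(\<integral>\<^sup>+t\<in>{a + c..<b + c}. f t \<partial>lborel) = (\<integral>\<^sup>+t. f (c + 1 * t) * indicator {a + c..<b + c} (c + 1 * t) \<partial>lborel)"
    by (subst nn_integral_real_affine[where c = 1 and t = c]) auto
  also have "\<dots> = (\<integral>\<^sup>+t\<in>{a..<b}. f (t + c) \<partial>lborel)"
    by (intro nn_integral_cong) (auto simp: indicator_def add.commute)
  finally show ?thesis .
qed

lemma nn_integral_reflect:
  fixes f :: "real \<Rightarrow> ennreal"
  assumes [measurable]: "f \<in> borel_measurable borel"
  shows "(\<integral>\<^sup>+t\<in>{a..b}. f t \<partial>lborel) = (\<integral>\<^sup>+t\<in>{c - b..c - a}. f (c - t) \<partial>lborel)"
proof -
  have "(\<integral>\<^sup>+t\<in>{a..b}. f t \<partial>lborel) = (\<integral>\<^sup>+t. f (c + (-1) * t) * indicator {a..b} (c + (-1) * t) \<partial>lborel)"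
    by (subst nn_integral_real_affine[where c = "-1" and t = c]) auto
  also have "\<dots> = (\<integral>\<^sup>+t\<in>{c - b..c - a}. f (c - t) \<partial>lborel)"
    by (intro nn_integral_cong) (auto simp: indicator_def)
  finally show ?thesis .
qed

lemma nn_integral_Ico_split:
  fixes f :: "real \<Rightarrow> ennreal"
  assumes [measurable]: "f \<in> borel_measurable borel" and "a \<le> b" "b \<le> c"
  shows "(\<integral>\<^sup>+t\<in>{a..<c}. f t \<partial>lborel) = (\<integral>\<^sup>+t\<in>{a..<b}. f t \<partial>lborel) + (\<integral>\<^sup>+t\<in>{b..<c}. f t \<partial>lborel)"
  by (subst nn_integral_add[symmetric])
    (use assms in \<open>auto intro!: nn_integral_cong simp: indicator_def\<close>)

lemma nn_integral_Icc_Ico: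
  fixes f :: "real \<Rightarrow> ennreal"
  shows "(\<integral>\<^sup>+t\<in>{a..b}. f t \<partial>lborel) = (\<integral>\<^sup>+t\<in>{a..<b}. f t \<partial>lborel)"
proof (rule nn_integral_cong_AE)
  show "AE t in lborel. f t * indicator {a..b} t = f t * indicator {a..<b} t"
    using AE_lborel_singleton[of b] by eventually_elim (auto simp: indicator_def)
qed

lemma periodic_int:
  fixes f :: "real \<Rightarrow> 'a"
  assumes "\<And>t. f (t + p) = f t"
  shows "f (t + of_int k * p) = f t"
proof -
  have nat: "f (t + real n * p) = f t" for n t
    by (induction n arbitrary: t) (use assms in \<open>simp_all add: algebra_simps, metis add.assoc\<close>)
  show ?thesis
  proof (cases "0 \<le> k")
    case True
    then show ?thesis using nat[of t "nat k"] by simp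
  next
    case False
    then show ?thesis using nat[of "t + of_int k * p" "nat (- k)"] by (simp add: algebra_simps)
  qed
qed

lemma nn_integral_periodic:
  fixes f :: "real \<Rightarrow> ennreal"
  assumes [measurable]: "f \<in> borel_measurable borel" and per: "\<And>t. f (t + p) = f t" and "0 < p"
  shows "(\<integral>\<^sup>+t\<in>{a..a + p}. f t \<partial>lborel) = (\<integral>\<^sup>+t\<in>{0..p}. f t \<partial>lborel)"
proof -
  define k where "k = \<lfloor>a / p\<rfloor>"
  define a0 where "a0 = a - of_int k * p"
  have a0: "0 \<le> a0" "a0 < p"
    using \<open>0 < p\<close> floor_divide_lower[of p a] floor_divide_upper[of p a]
    by (auto simp: a0_def k_def algebra_simps)
  have "(\<integral>\<^sup>+t\<in>{a..<a + p}. f t \<partial>lborel) = (\<integral>\<^sup>+t\<in>{a0 + of_int k * p..<(a0 + p) + of_int k * p}. f t \<partial>lborel)"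
    by (simp add: a0_def)
  also have "\<dots> = (\<integral>\<^sup>+t\<in>{a0..<a0 + p}. f t \<partial>lborel)"
    by (subst nn_integral_shift) (simp_all add: periodic_int[of f, OF per])
  also have "\<dots> = (\<integral>\<^sup>+t\<in>{a0..<p}. f t \<partial>lborel) + (\<integral>\<^sup>+t\<in>{0 + p..<a0 + p}. f t \<partial>lborel)"
    using a0 nn_integral_Ico_split[of f a0 p "a0 + p"] by simp
  also have "(\<integral>\<^sup>+t\<in>{0 + p..<a0 + p}. f t \<partial>lborel) = (\<integral>\<^sup>+t\<in>{0..<a0}. f t \<partial>lborel)"
    by (subst nn_integral_shift) (simp_all add: per)
  also have "(\<integral>\<^sup>+t\<in>{a0..<p}. f t \<partial>lborel) + (\<integral>\<^sup>+t\<in>{0..<a0}. f t \<partial>lborel) = (\<integral>\<^sup>+t\<in>{0..<p}. f t \<partial>lborel)"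
    using a0 nn_integral_Ico_split[of f 0 a0 p] by (simp add: add.commute)
  finally show ?thesis by (simp add: nn_integral_Icc_Ico)
qed

text \<open>Here \<open>f\<close> stands for a function of the modulus of a wave with period
  \<open>4 * q\<close>; taking the modulus halves the period. Evenness about \<open>c\<close> makes
  all four quarters contribute equally.\<close>

lemma nn_integral_quarter:
  fixes f :: "real \<Rightarrow> ennreal"
  assumes [measurable]: "f \<in> borel_measurable borel" and per: "\<And>t. f (t + 2 * q) = f t" and "0 < q"
    and even: "\<And>s. f (c - s) = f (c + s)"
  shows "(\<integral>\<^sup>+t\<in>{0..4 * q}. f t \<partial>lborel) = 4 * (\<integral>\<^sup>+s\<in>{0..q}. f (c + s) \<partial>lborel)"
proof -
  have per4: "f (t + 4 * q) = f t" for t using per[of "t + 2 * q"] per[of t] by (simp add: algebra_simps)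
  have shift: "(\<integral>\<^sup>+t\<in>{c..c + q}. f t \<partial>lborel) = (\<integral>\<^sup>+s\<in>{0..q}. f (c + s) \<partial>lborel)"
    using nn_integral_shift[of f 0 c q] by (simp add: nn_integral_Icc_Ico add.commute)
  have "(\<integral>\<^sup>+t\<in>{c - q..c}. f t \<partial>lborel) = (\<integral>\<^sup>+t\<in>{c..c + q}. f (2 * c - t) \<partial>lborel)"
    by (subst nn_integral_reflect[where c = "2 * c"]) (simp_all add: algebra_simps)
  also have "\<dots> = (\<integral>\<^sup>+t\<in>{c..c + q}. f t \<partial>lborel)"
    using even[of "_ - c"] by (simp add: algebra_simps)
  finally have refl: "(\<integral>\<^sup>+t\<in>{c - q..c}. f t \<partial>lborel) = (\<integral>\<^sup>+t\<in>{c..c + q}. f t \<partial>lborel)" .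
  have half: "(\<integral>\<^sup>+t\<in>{c - q..c + q}. f t \<partial>lborel) = 2 * (\<integral>\<^sup>+t\<in>{c..c + q}. f t \<partial>lborel)"
    using nn_integral_Ico_split[of f "c - q" c "c + q"] refl \<open>0 < q\<close>
    by (simp add: nn_integral_Icc_Ico mult_2)
  have half': "(\<integral>\<^sup>+t\<in>{c + q..c + 3 * q}. f t \<partial>lborel) = (\<integral>\<^sup>+t\<in>{c - q..c + q}. f t \<partial>lborel)"
  proof -
    have e: "c - q + 2 * q = c + q" "c + q + 2 * q = c + 3 * q" by simp_all
    show ?thesis
      using nn_integral_shift[of f "c - q" "2 * q" "c + q", unfolded e] by (simp add: nn_integral_Icc_Ico per)
  qed
  have "(\<integral>\<^sup>+t\<in>{0..4 * q}. f t \<partial>lborel) = (\<integral>\<^sup>+t\<in>{c - q..c - q + 4 * q}. f t \<partial>lborel)"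
    using nn_integral_periodic[of f "4 * q" "c - q"] per4 \<open>0 < q\<close> by simp
  also have "\<dots> = (\<integral>\<^sup>+t\<in>{c - q..c + q}. f t \<partial>lborel) + (\<integral>\<^sup>+t\<in>{c + q..c + 3 * q}. f t \<partial>lborel)"
    using nn_integral_Ico_split[of f "c - q" "c + q" "c + 3 * q"] \<open>0 < q\<close>
    by (simp add: nn_integral_Icc_Ico algebra_simps)
  also have "\<dots> = 4 * (\<integral>\<^sup>+t\<in>{c..c + q}. f t \<partial>lborel)"
    unfolding half' half by (simp flip: distrib_right mult.assoc)
  finally show ?thesis using shift by simp
qed

lemma nn_integral_powr_Icc:
  assumes "0 < p" "0 \<le> c"
  shows "(\<integral>\<^sup>+v. ennreal (p * v powr (p - 1)) * indicator {0<..<c} v \<partial>lborel) = ennreal (c powr p)"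
proof -
  have "((\<lambda>v. p * (v powr (p - 1))) has_integral p * (c powr (p - 1 + 1) / (p - 1 + 1))) {0..c}"
    using assms by (intro has_integral_mult_right has_integral_powr_from_0) auto
  then have "((\<lambda>v. p * (v powr (p - 1))) has_integral c powr p) {0..c}" using assms by simp
  then have "(\<integral>\<^sup>+v. ennreal (indicator {0..c} v * (p * v powr (p - 1))) \<partial>lborel) = ennreal (c powr p)"
    using assms by (intro nn_integral_has_integral_lebesgue) auto
  moreover have "(\<integral>\<^sup>+v. ennreal (p * v powr (p - 1)) * indicator {0<..<c} v \<partial>lborel)
      = (\<integral>\<^sup>+v. ennreal (indicator {0..c} v * (p * v powr (p - 1))) \<partial>lborel)"
  proof (rule nn_integral_cong_AE)
    show "AE v in lborel. ennreal (p * v powr (p - 1)) * indicator {0<..<c} v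
      = ennreal (indicator {0..c} v * (p * v powr (p - 1)))"
      using AE_lborel_singleton[of 0] AE_lborel_singleton[of c] by eventually_elim (auto simp: indicator_def)
  qed
  ultimately show ?thesis by simp
qed

text \<open>The layer-cake formula: write \<open>Y t powr p\<close> as an integral over the levels
  below \<open>Y t\<close> and exchange the order of integration.\<close>

lemma nn_integral_powr_distribution:
  fixes Y :: "real \<Rightarrow> real"
  assumes [measurable]: "Y \<in> borel_measurable borel" "A \<in> sets borel" and "\<And>t. 0 \<le> Y t" "0 < p"
  shows "(\<integral>\<^sup>+t\<in>A. ennreal (Y t powr p) \<partial>lborel)
    = (\<integral>\<^sup>+v. ennreal (p * v powr (p - 1)) * indicator {0<..} v * emeasure lborel {t\<in>A. v < Y t} \<partial>lborel)"
proof -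
  define g where "g = (\<lambda>t v. ennreal (p * v powr (p - 1)) * indicator {0<..} v * indicator {t\<in>A. v < Y t} t)"
  have [measurable]: "(\<lambda>(t, v). g t v) \<in> borel_measurable (lborel \<Otimes>\<^sub>M lborel)"
  proof -
    have "(\<lambda>(t, v). g t v) = (\<lambda>x. ennreal (p * snd x powr (p - 1)) * indicator {0<..} (snd x) *
        (if fst x \<in> A \<and> snd x < Y (fst x) then 1 else 0))"
      by (auto simp: g_def indicator_def fun_eq_iff)
    then show ?thesis by simp
  qed
  have "(\<integral>\<^sup>+t\<in>A. ennreal (Y t powr p) \<partial>lborel) = (\<integral>\<^sup>+t. \<integral>\<^sup>+v. g t v \<partial>lborel \<partial>lborel)"
  proof (rule nn_integral_cong)
    fix t
    have "(\<integral>\<^sup>+v. g t v \<partial>lborel) = (\<integral>\<^sup>+v. (ennreal (p * v powr (p - 1)) * indicator {0<..<Y t} v) * indicator A t \<partial>lborel)"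
      by (intro nn_integral_cong) (auto simp: g_def indicator_def)
    also have "\<dots> = ennreal (Y t powr p) * indicator A t"
      using nn_integral_powr_Icc[OF \<open>0 < p\<close> assms(3)[of t]] by (simp add: nn_integral_multc)
    finally show "ennreal (Y t powr p) * indicator A t = (\<integral>\<^sup>+v. g t v \<partial>lborel)" by simp
  qed
  also have "\<dots> = (\<integral>\<^sup>+v. \<integral>\<^sup>+t. g t v \<partial>lborel \<partial>lborel)"
    by (rule lborel_pair.Fubini') measurable
  also have "\<dots> = (\<integral>\<^sup>+v. ennreal (p * v powr (p - 1)) * indicator {0<..} v * emeasure lborel {t\<in>A. v < Y t} \<partial>lborel)"
  proof (rule nn_integral_cong)
    fix v
    have [measurable]: "{t\<in>A. v < Y t} \<in> sets borel"
      using assms(2) by measurable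
    show "(\<integral>\<^sup>+t. g t v \<partial>lborel) = ennreal (p * v powr (p - 1)) * indicator {0<..} v * emeasure lborel {t\<in>A. v < Y t}"
      unfolding g_def by (subst nn_integral_cmult_indicator) auto
  qed
  finally show ?thesis .
qed

lemma distribution_borel_measurable:
  fixes Y :: "real \<Rightarrow> real"
  assumes [measurable]: "Y \<in> borel_measurable borel" "A \<in> sets borel"
  shows "(\<lambda>v. emeasure lborel {t\<in>A. v < Y t}) \<in> borel_measurable borel"
proof -
  have "(\<lambda>x. if snd x \<in> A \<and> fst x < Y (snd x) then 1 else 0 :: ennreal) \<in> borel_measurable (borel \<Otimes>\<^sub>M lborel)"
    by measurable
  then have "(\<lambda>v. \<integral>\<^sup>+t. (if t \<in> A \<and> v < Y t then 1 else 0) \<partial>lborel) \<in> borel_measurable borel"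
    using lborel.borel_measurable_nn_integral[of "\<lambda>v t. if t \<in> A \<and> v < Y t then 1 else 0" borel]
    by (simp add: split_beta')
  moreover have "(\<integral>\<^sup>+t. (if t \<in> A \<and> v < Y t then 1 else 0) \<partial>lborel) = emeasure lborel {t\<in>A. v < Y t}" for v
  proof -
    have "(\<integral>\<^sup>+t. (if t \<in> A \<and> v < Y t then 1 else 0) \<partial>lborel) = (\<integral>\<^sup>+t. indicator {t\<in>A. v < Y t} t \<partial>lborel)"
      by (intro nn_integral_cong) auto
    then show ?thesis by simp
  qed
  ultimately show ?thesis by simp
qed

text \<open>If the distribution functions cross once, at \<open>v0\<close>, multiply their difference by
  \<open>v powr (q - p) - v0 powr (q - p)\<close>, which changes sign at the same point.\<close>
lemma nn_integral_powr_compare: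
  fixes Y Z :: "real \<Rightarrow> real"
  assumes [measurable]: "Y \<in> borel_measurable borel" "A \<in> sets borel" "Z \<in> borel_measurable borel" "B \<in> sets borel"
    and nn: "\<And>t. 0 \<le> Y t" "\<And>t. 0 \<le> Z t" and pq: "0 < p" "p < q" and v0: "0 \<le> v0"
    and below: "\<And>v. 0 < v \<Longrightarrow> v < v0 \<Longrightarrow> emeasure lborel {t\<in>B. v < Z t} \<le> emeasure lborel {t\<in>A. v < Y t}"
    and above: "\<And>v. v0 < v \<Longrightarrow> emeasure lborel {t\<in>A. v < Y t} \<le> emeasure lborel {t\<in>B. v < Z t}"
    and eq: "(\<integral>\<^sup>+t\<in>A. ennreal (Y t powr p) \<partial>lborel) = (\<integral>\<^sup>+t\<in>B. ennreal (Z t powr p) \<partial>lborel)"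
    and fin: "(\<integral>\<^sup>+t\<in>A. ennreal (Y t powr p) \<partial>lborel) < \<infinity>"
  shows "(\<integral>\<^sup>+t\<in>A. ennreal (Y t powr q) \<partial>lborel) \<le> (\<integral>\<^sup>+t\<in>B. ennreal (Z t powr q) \<partial>lborel)"
proof -
  define m where "m = (\<lambda>v. emeasure lborel {t\<in>A. v < Y t})"
  define n where "n = (\<lambda>v. emeasure lborel {t\<in>B. v < Z t})"
  have [measurable]: "m \<in> borel_measurable borel" "n \<in> borel_measurable borel"
    unfolding m_def n_def by (auto intro!: distribution_borel_measurable)
  define w where "w = (\<lambda>r v. ennreal (r * v powr (r - 1)) * indicator {0<..} v)"
  have [measurable]: "w r \<in> borel_measurable borel" for r unfolding w_def by measurable
  \<comment> \<open>With this factor the weights \<open>q * v powr (q - 1)\<close> and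
    \<open>k * (p * v powr (p - 1))\<close> agree at \<open>v0\<close>; the first is the smaller one
    below \<open>v0\<close> and the larger one above.\<close>
  define k where "k = q / p * v0 powr (q - p)"
  have k: "0 \<le> k" using pq by (simp add: k_def)
  have I: "(\<integral>\<^sup>+t\<in>A. ennreal (Y t powr r) \<partial>lborel) = (\<integral>\<^sup>+v. w r v * m v \<partial>lborel)"
          "(\<integral>\<^sup>+t\<in>B. ennreal (Z t powr r) \<partial>lborel) = (\<integral>\<^sup>+v. w r v * n v \<partial>lborel)" if "0 < r" for r
    unfolding w_def m_def n_def using that nn by (auto intro!: nn_integral_powr_distribution)
  \<comment> \<open>The differences of the weights and of the distribution functions have the same
    sign, so their product is nonnegative. It is multiplied out with the negative terms moved
    across, because subtraction in \<open>ennreal\<close> truncates.\<close>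
  have pt: "w q v * m v + ennreal k * (w p v * n v) \<le> w q v * n v + ennreal k * (w p v * m v)" for v
  proof (cases "0 < v")
    case False then show ?thesis by (simp add: w_def)
  next
    case v: True
    define X where "X = q * v powr (q - 1)"
    define K where "K = k * (p * v powr (p - 1))"
    have "X = q * v powr (q - p) * v powr (p - 1)" unfolding X_def by (simp flip: powr_add mult.assoc)
    moreover have "K = q * v0 powr (q - p) * v powr (p - 1)" using pq by (simp add: K_def k_def)
    ultimately have ord: "v \<le> v0 \<Longrightarrow> X \<le> K" "v0 \<le> v \<Longrightarrow> K \<le> X"
      using pq v v0 by (auto intro!: mult_right_mono mult_left_mono powr_mono2)
    have nnXK: "0 \<le> X" "0 \<le> K" using pq k by (auto simp: X_def K_def)
    have *: "ennreal X * m v + ennreal K * n v \<le> ennreal X * n v + ennreal K * m v"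
    proof -
      consider "v < v0" | "v = v0" | "v0 < v" by linarith
      then show ?thesis
      proof cases
        case 1
        have "ennreal K = ennreal X + ennreal (K - X)" using ord(1) 1 nnXK by (simp flip: ennreal_plus)
        moreover have "ennreal (K - X) * n v \<le> ennreal (K - X) * m v"
          using below[OF v 1] by (intro mult_left_mono) (auto simp: m_def n_def)
        then have "(ennreal X * m v + ennreal X * n v) + ennreal (K - X) * n v
            \<le> (ennreal X * m v + ennreal X * n v) + ennreal (K - X) * m v" by (rule add_left_mono)
        ultimately show ?thesis by (simp only: distrib_left distrib_right ac_simps)
      next
        case 2
        then have "X = K" using ord by simp
        then show ?thesis by (simp add: add.commute)
      next
        case 3
        have "ennreal X = ennreal K + ennreal (X - K)" using ord(2) 3 nnXK by (simp flip: ennreal_plus)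
        moreover have "ennreal (X - K) * m v \<le> ennreal (X - K) * n v"
          using above[OF 3] by (intro mult_left_mono) (auto simp: m_def n_def)
        then have "(ennreal K * m v + ennreal K * n v) + ennreal (X - K) * m v
            \<le> (ennreal K * m v + ennreal K * n v) + ennreal (X - K) * n v" by (rule add_left_mono)
        ultimately show ?thesis by (simp only: distrib_left distrib_right ac_simps)
      qed
    qed
    have "w q v = ennreal X" using v by (simp add: w_def X_def)
    moreover have "ennreal k * (w p v * c) = ennreal K * c" for c
      using v k by (simp add: w_def K_def ennreal_mult' mult.assoc)
    ultimately show ?thesis using * by simp
  qed
  have "(\<integral>\<^sup>+v. w q v * m v \<partial>lborel) + ennreal k * (\<integral>\<^sup>+v. w p v * n v \<partial>lborel)
      = (\<integral>\<^sup>+v. w q v * m v + ennreal k * (w p v * n v) \<partial>lborel)"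
    by (simp add: nn_integral_add nn_integral_cmult)
  also have "\<dots> \<le> (\<integral>\<^sup>+v. w q v * n v + ennreal k * (w p v * m v) \<partial>lborel)"
    by (intro nn_integral_mono pt)
  also have "\<dots> = (\<integral>\<^sup>+v. w q v * n v \<partial>lborel) + ennreal k * (\<integral>\<^sup>+v. w p v * m v \<partial>lborel)"
    by (simp add: nn_integral_add nn_integral_cmult)
  \<comment> \<open>The \<open>p\<close>-integrals agree, so both sides contain the same term with
    \<open>k\<close>; it is finite and cancels.\<close>
  finally have "c + (\<integral>\<^sup>+t\<in>A. ennreal (Y t powr q) \<partial>lborel) \<le> c + (\<integral>\<^sup>+t\<in>B. ennreal (Z t powr q) \<partial>lborel)"
    if "c = ennreal k * (\<integral>\<^sup>+t\<in>A. ennreal (Y t powr p) \<partial>lborel)" for c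
    using I[of q] I[of p] pq eq that by (simp add: add.commute)
  moreover have "ennreal k * (\<integral>\<^sup>+t\<in>A. ennreal (Y t powr p) \<partial>lborel) \<noteq> \<infinity>"
    using fin by (simp add: ennreal_mult_eq_top_iff)
  ultimately show ?thesis
    by (simp add: ennreal_add_left_cancel_le)
qed

section \<open>Norms of continuous functions as nonnegative integrals\<close>

lemma Lp_norm_continuous:
  assumes f: "continuous_on UNIV f" and "0 < p"
  shows "Lp_norm p a b f = enn2real (\<integral>\<^sup>+t\<in>{a..b}. ennreal (\<bar>f t\<bar> powr p) \<partial>lborel) powr (1 / p)"
    "(\<integral>\<^sup>+t\<in>{a..b}. ennreal (\<bar>f t\<bar> powr p) \<partial>lborel) < \<infinity>"
proof -
  have c: "continuous_on A (\<lambda>t. \<bar>f t\<bar> powr p)" for A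
    using \<open>0 < p\<close> continuous_on_subset[OF f, of A] by (intro continuous_on_powr' continuous_intros) auto
  have m: "(\<lambda>t. \<bar>f t\<bar> powr p) \<in> borel_measurable borel" by (rule borel_measurable_continuous_onI[OF c])
  have "(LINT t:{a..b}|lebesgue. \<bar>f t\<bar> powr p) = (LINT t|lborel. indicator {a..b} t * \<bar>f t\<bar> powr p)"
    unfolding set_lebesgue_integral_def using m by (subst integral_completion) auto
  also have "\<dots> = enn2real (\<integral>\<^sup>+t. ennreal (indicator {a..b} t * \<bar>f t\<bar> powr p) \<partial>lborel)"
    using m by (intro integral_eq_nn_integral) auto
  also have "(\<integral>\<^sup>+t. ennreal (indicator {a..b} t * \<bar>f t\<bar> powr p) \<partial>lborel) = (\<integral>\<^sup>+t\<in>{a..b}. ennreal (\<bar>f t\<bar> powr p) \<partial>lborel)"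
    by (intro nn_integral_cong) (auto simp: indicator_def)
  finally show "Lp_norm p a b f = enn2real (\<integral>\<^sup>+t\<in>{a..b}. ennreal (\<bar>f t\<bar> powr p) \<partial>lborel) powr (1 / p)"
    by (simp add: Lp_norm_def)
  have "bounded ((\<lambda>t. \<bar>f t\<bar> powr p) ` {a..b})"
    by (intro compact_imp_bounded compact_continuous_image c) simp
  then obtain C where C: "\<And>t. t \<in> {a..b} \<Longrightarrow> \<bar>f t\<bar> powr p \<le> C"
    unfolding bounded_iff by fastforce
  have "(\<integral>\<^sup>+t\<in>{a..b}. ennreal (\<bar>f t\<bar> powr p) \<partial>lborel) \<le> (\<integral>\<^sup>+t. ennreal C * indicator {a..b} t \<partial>lborel)"
    by (intro nn_integral_mono) (auto simp: indicator_def C intro!: ennreal_leI)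
  also have "\<dots> = ennreal C * emeasure lborel {a..b}" by (rule nn_integral_cmult_indicator) auto
  also have "\<dots> < \<infinity>" by (simp add: ennreal_mult_less_top emeasure_lborel_Icc_eq)
  finally show "(\<integral>\<^sup>+t\<in>{a..b}. ennreal (\<bar>f t\<bar> powr p) \<partial>lborel) < \<infinity>" .
qed

lemma Lp_norm_eqD:
  assumes "continuous_on UNIV f" "continuous_on UNIV g" "0 < p" "Lp_norm p a b f = Lp_norm p c d g"
  shows "(\<integral>\<^sup>+t\<in>{a..b}. ennreal (\<bar>f t\<bar> powr p) \<partial>lborel) = (\<integral>\<^sup>+t\<in>{c..d}. ennreal (\<bar>g t\<bar> powr p) \<partial>lborel)"
    (is "?I = ?J")
proof -
  note f = Lp_norm_continuous[OF assms(1,3), of a b] and g = Lp_norm_continuous[OF assms(2,3), of c d]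
  have "(enn2real ?I powr (1 / p)) powr p = (enn2real ?J powr (1 / p)) powr p"
    using assms(4) f(1) g(1) by simp
  then have "enn2real ?I = enn2real ?J" using \<open>0 < p\<close> by (simp add: powr_powr)
  moreover have "?I = ennreal (enn2real ?I)" "?J = ennreal (enn2real ?J)" using f(2) g(2) by simp_all
  ultimately show ?thesis by simp
qed

subsection \<open>The functions \<open>\<psi>\<close>\<close>

lemma lipschitz_continuous:
  fixes f :: "real \<Rightarrow> real"
  assumes "\<And>s t. \<bar>f t - f s\<bar> \<le> C * \<bar>t - s\<bar>"
  shows "continuous_on UNIV f"
proof -
  have "(max C 0)-lipschitz_on UNIV f"
  proof (rule lipschitz_onI)
    fix s t :: real
    have "\<bar>f s - f t\<bar> \<le> C * \<bar>s - t\<bar>" by (rule assms)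
    also have "\<dots> \<le> max C 0 * \<bar>s - t\<bar>" by (intro mult_right_mono) auto
    finally show "dist (f s) (f t) \<le> max C 0 * dist s t" by (simp add: dist_real_def)
  qed simp
  then show ?thesis by (rule lipschitz_on_continuous_on)
qed

lemma einterval_UNIV_antiderivative:
  fixes g :: "real \<Rightarrow> real"
  assumes "\<And>t. isCont g t"
  obtains F where "\<And>t. (F has_real_derivative g t) (at t)"
proof -
  have "\<exists>F. \<forall>x. -\<infinity> < ereal x \<longrightarrow> ereal x < \<infinity> \<longrightarrow> (F has_vector_derivative g x) (at x)"
    by (rule einterval_antiderivative) (use assms in auto)
  then show thesis using that by (auto simp: has_real_derivative_iff_has_vector_derivative)
qed

lemma DERIV_zero_const:
  fixes f :: "real \<Rightarrow> real"
  assumes "\<And>x. (f has_real_derivative 0) (at x)"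
  shows "f x = f y"
  using DERIV_isconst_all[of f x y] assms by auto

section \<open>Antiperiodic functions and their primitives\<close>

definition antiperiodic :: "real \<Rightarrow> (real \<Rightarrow> real) \<Rightarrow> bool" where
  "antiperiodic T g \<longleftrightarrow> (\<forall>t. g (t + T) = - g t)"

lemma antiperiodicD: "antiperiodic T g \<Longrightarrow> g (t + T) = - g t"
  by (simp add: antiperiodic_def)

lemma antiperiodicD': "antiperiodic T g \<Longrightarrow> g (t - T) = - g t"
  using antiperiodicD[of T g "t - T"] by simp

text \<open>For any antiderivative \<open>F\<close> the sum \<open>F (t + T) + F t\<close> is
  constant, and half of it is the amount to subtract. This is also the normalisation to zero
  mean.\<close>

lemma antiperiodic_antiderivative:
  assumes cont: "\<And>t. isCont g t" and ap: "antiperiodic T g"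
  obtains h where "\<And>t. (h has_real_derivative g t) (at t)" "antiperiodic T h"
proof -
  obtain F where F: "\<And>t. (F has_real_derivative g t) (at t)"
    using einterval_UNIV_antiderivative[of g] cont by blast
  have d: "((\<lambda>t. F (t + T) + F t) has_real_derivative 0) (at t)" for t
    by (rule derivative_eq_intros DERIV_chain2[OF F] F refl | simp add: antiperiodicD[OF ap])+
  have const: "F (t + T) + F t = F T + F 0" for t
    using DERIV_zero_const[of "\<lambda>t. F (t + T) + F t" t 0, OF d] by simp
  then have "F (t + T) - (F T + F 0) / 2 = - (F t - (F T + F 0) / 2)" for t
    using const[of t] by (simp add: field_simps)
  then have "antiperiodic T (\<lambda>t. F t - (F T + F 0) / 2)"
    unfolding antiperiodic_def by blast
  moreover have "((\<lambda>t. F t - (F T + F 0) / 2) has_real_derivative g t) (at t)" for t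
    by (rule derivative_eq_intros F refl | simp)+
  ultimately show thesis using that by blast
qed

lemma antiperiodic_integral:
  assumes cont: "\<And>t. isCont h t" and ap: "antiperiodic T h" and "0 < T"
  shows "(h has_integral 0) {0..2 * T}"
proof -
  obtain H where H: "\<And>t. (H has_real_derivative h t) (at t)" "antiperiodic T H"
    using antiperiodic_antiderivative[OF cont ap] by blast
  have "(h has_integral H (2 * T) - H 0) {0..2 * T}"
    using H(1) \<open>0 < T\<close>
    by (intro fundamental_theorem_of_calculus)
      (auto simp flip: has_real_derivative_iff_has_vector_derivative intro: has_field_derivative_at_within)
  moreover have "H (2 * T) = H 0"
    using antiperiodicD[OF H(2), of T] antiperiodicD[OF H(2), of 0] by simp
  ultimately show ?thesis by simp
qed

text \<open>Justifies the description operator in \<open>psi\<close>: two candidates differ by a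
  constant, which the zero mean makes 0. Antiperiodicity, absent from that description, comes along
  and feeds the next integration.\<close>

lemma antiperiodic_primitive_unique:
  assumes cont: "\<And>t. isCont g t" and ap: "antiperiodic T g" and "0 < T"
  defines "Q \<equiv> \<lambda>h. (\<forall>t. h (t + 2 * T) = h t) \<and> (\<forall>t. (h has_real_derivative g t) (at t)) \<and>
             (h has_integral 0) {0..2 * T}"
  shows "Q (THE h. Q h)" "antiperiodic T (THE h. Q h)"
proof -
  obtain h where h: "\<And>t. (h has_real_derivative g t) (at t)" "antiperiodic T h"
    using antiperiodic_antiderivative[OF cont ap] by blast
  have "h (t + 2 * T) = h t" for t
    using antiperiodicD[OF h(2), of "t + T"] antiperiodicD[OF h(2), of t] by (simp add: algebra_simps)
  moreover have "(h has_integral 0) {0..2 * T}"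
    using h by (intro antiperiodic_integral[OF _ h(2) \<open>0 < T\<close>]) (meson DERIV_isCont)
  ultimately have Qh: "Q h" using h(1) by (simp add: Q_def)
  have "k = h" if "Q k" for k
  proof
    fix t
    have d: "((\<lambda>t. k t - h t) has_real_derivative 0) (at t)" for t
      using DERIV_diff[of k "g t" t UNIV h "g t"] that h(1) by (simp add: Q_def)
    have c: "k s - h s = k t - h t" for s
      using DERIV_zero_const[of "\<lambda>t. k t - h t" s t, OF d] .
    have "((\<lambda>s. k s - h s) has_integral 0 - 0) {0..2 * T}"
      using that Qh unfolding Q_def by (intro has_integral_diff) auto
    moreover have "(\<lambda>s. k s - h s) = (\<lambda>s. k t - h t)" using c by blast
    ultimately have "((\<lambda>s. k t - h t) has_integral 0) {0..2 * T}" by simp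
    moreover have "((\<lambda>s. k t - h t) has_integral (k t - h t) * (2 * T)) {0..2 * T}"
      using has_integral_const_real[of "k t - h t" 0 "2 * T"] \<open>0 < T\<close> by (simp add: mult.commute)
    ultimately have "(k t - h t) * (2 * T) = 0" using has_integral_unique by blast
    then show "k t = h t" using \<open>0 < T\<close> by simp
  qed
  then have "(THE h. Q h) = h" using Qh by (intro the_equality)
  then show "Q (THE h. Q h)" "antiperiodic T (THE h. Q h)" using Qh h(2) by auto
qed

lemma reduce_mod:
  fixes T :: real
  assumes "0 < T"
  obtains k :: int where "c + of_int k * T \<le> s" "s < c + (of_int k + 1) * T"
proof -
  define k where "k = \<lfloor>(s - c) / T\<rfloor>"
  show thesis
    using that[of k] assms floor_divide_lower[of T "s - c"] floor_divide_upper[of T "s - c"]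
    by (simp add: k_def algebra_simps)
qed

lemma antiperiodic_abs_int:
  assumes "antiperiodic T g"
  shows "\<bar>g (t + of_int k * T)\<bar> = \<bar>g t\<bar>"
proof -
  have nat: "\<bar>g (t + real n * T)\<bar> = \<bar>g t\<bar>" for n t
  proof (induction n)
    case (Suc n)
    have "g (t + real (Suc n) * T) = - g (t + real n * T)"
      using antiperiodicD[OF assms, of "t + real n * T"] by (simp add: algebra_simps)
    then show ?case using Suc by simp
  qed simp
  show ?thesis
  proof (cases "0 \<le> k")
    case True
    then show ?thesis using nat[of t "nat k"] by simp
  next
    case False
    then show ?thesis using nat[of "t + of_int k * T" "nat (- k)"] by (simp add: algebra_simps)
  qed
qed

text \<open>\<open>g\<close> vanishes at all nodes \<open>c + k * T\<close>, so points in different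
  cells are compared through the nodes between them.\<close>

lemma antiperiodic_lipschitz:
  assumes ap: "antiperiodic T g" and "0 < T" and "g c = 0"
    and lip: "\<And>s t. c \<le> s \<Longrightarrow> s \<le> t \<Longrightarrow> t \<le> c + T \<Longrightarrow> \<bar>g t - g s\<bar> \<le> t - s"
  shows "\<bar>g t - g s\<bar> \<le> \<bar>t - s\<bar>"
proof -
  have cell: "\<forall>s t. c + of_int k * T \<le> s \<longrightarrow> s \<le> t \<longrightarrow> t \<le> c + (of_int k + 1) * T \<longrightarrow> \<bar>g t - g s\<bar> \<le> t - s" for k :: int
  proof (induction k rule: int_induct[of _ 0])
    case base
    then show ?case using lip by simp
  next
    case (step1 i)
    show ?case
    proof (intro allI impI)
      fix s t assume st: "c + of_int (i + 1) * T \<le> s" "s \<le> t" "t \<le> c + (of_int (i + 1) + 1) * T"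
      then have "\<bar>g (t - T) - g (s - T)\<bar> \<le> (t - T) - (s - T)"
        using step1(2)[rule_format, of "s - T" "t - T"] by (simp add: algebra_simps)
      then show "\<bar>g t - g s\<bar> \<le> t - s" using antiperiodicD'[OF ap] by simp
    qed
  next
    case (step2 i)
    show ?case
    proof (intro allI impI)
      fix s t assume st: "c + of_int (i - 1) * T \<le> s" "s \<le> t" "t \<le> c + (of_int (i - 1) + 1) * T"
      then have "\<bar>g (t + T) - g (s + T)\<bar> \<le> (t + T) - (s + T)"
        using step2(2)[rule_format, of "s + T" "t + T"] by (simp add: algebra_simps)
      then show "\<bar>g t - g s\<bar> \<le> t - s" using antiperiodicD[OF ap] by simp
    qed
  qed
  have zero: "g (c + of_int k * T) = 0" for k :: int
    using antiperiodic_abs_int[OF ap, of c k] \<open>g c = 0\<close> by simp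
  have *: "\<bar>g t - g s\<bar> \<le> t - s" if st: "s \<le> t" for s t
  proof -
    obtain k :: int where k: "c + of_int k * T \<le> s" "s < c + (of_int k + 1) * T"
      using reduce_mod[OF \<open>0 < T\<close>, of c s] by blast
    obtain m :: int where m: "c + of_int m * T \<le> t" "t < c + (of_int m + 1) * T"
      using reduce_mod[OF \<open>0 < T\<close>, of c t] by blast
    show ?thesis
    proof (cases "t \<le> c + (of_int k + 1) * T")
      case True
      then show ?thesis using cell[of k] k st by blast
    next
      case False
      then have "(of_int k + 1) * T < (of_int m + 1) * T" using m by linarith
      then have "real_of_int k < of_int m" using \<open>0 < T\<close> by simp
      then have "k + 1 \<le> m" by simp
      then have "real_of_int k + 1 \<le> of_int m" by linarith
      then have km: "(real_of_int k + 1) * T \<le> of_int m * T" using \<open>0 < T\<close> by (simp add: mult_right_mono)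
      have "\<bar>g (c + (of_int k + 1) * T) - g s\<bar> \<le> c + (of_int k + 1) * T - s"
        using cell[of k] k by simp
      moreover have "g (c + (of_int k + 1) * T) = 0" using zero[of "k + 1"] by simp
      moreover have "\<bar>g t - g (c + of_int m * T)\<bar> \<le> t - (c + of_int m * T)"
        using cell[of m, rule_format, of "c + of_int m * T" t] m by simp
      moreover have "g (c + of_int m * T) = 0" by (rule zero)
      ultimately show ?thesis using km by linarith
    qed
  qed
  show ?thesis using *[of s t] *[of t s] by (cases "s \<le> t") (auto simp: abs_minus_commute)
qed

text \<open>The difference of the two sides is itself antiperiodic in \<open>s\<close>, hence
  vanishes everywhere once it vanishes on an interval of length \<open>T\<close>.\<close>

lemma antiperiodic_even:
  assumes ap: "antiperiodic T g" and "0 < T"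
    and even: "\<And>s. \<bar>s\<bar> \<le> T / 2 \<Longrightarrow> g (c - s) = g (c + s)"
  shows "g (c - s) = g (c + s)"
proof -
  define E where "E = (\<lambda>s. g (c + s) - g (c - s))"
  have "antiperiodic T E"
    unfolding antiperiodic_def
  proof
    fix s
    show "E (s + T) = - E s"
      using antiperiodicD[OF ap, of "c + s"] antiperiodicD'[OF ap, of "c - s"]
      by (simp add: E_def add.assoc diff_diff_eq)
  qed
  obtain k :: int where k: "- T / 2 + of_int k * T \<le> s" "s < - T / 2 + (of_int k + 1) * T"
    using reduce_mod[OF \<open>0 < T\<close>, of "- T / 2" s] by blast
  have "\<bar>E (s - of_int k * T + of_int k * T)\<bar> = \<bar>E (s - of_int k * T)\<bar>"
    by (rule antiperiodic_abs_int) fact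
  moreover have "E (s - of_int k * T) = 0"
  proof -
    have "(of_int k + 1) * T = of_int k * T + T" by (simp add: algebra_simps)
    then have "\<bar>s - of_int k * T\<bar> \<le> T / 2" using k by linarith
    from even[OF this] show ?thesis by (simp add: E_def)
  qed
  ultimately show ?thesis by (simp add: E_def)
qed

definition half_period :: "real \<Rightarrow> real \<Rightarrow> real" where
  "half_period a1 a2 = a1 + a2 + 2"

context
  fixes a1 a2 :: real
  assumes a1: "0 \<le> a1" and a2: "0 \<le> a2"
begin

private abbreviation (input) T where "T \<equiv> half_period a1 a2"

lemma half_period_eq: "T = a1 + a2 + 2" by (simp add: half_period_def)

lemma half_period_pos: "0 < T" using a1 a2 by (simp add: half_period_eq)

lemma psi1_alt:
  "psi1 a1 a2 t = (if t rmod (2 * T) \<le> T then psi_base a1 a2 (t rmod (2 * T))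
     else - psi_base a1 a2 (t rmod (2 * T) - T))"
  by (simp add: psi1_def Let_def half_period_eq)

lemma psi1_base: "0 \<le> t \<Longrightarrow> t \<le> T \<Longrightarrow> psi1 a1 a2 t = psi_base a1 a2 t"
  using half_period_pos by (simp add: psi1_alt)

lemma psi1_antiperiodic: "antiperiodic T (psi1 a1 a2)"
  unfolding antiperiodic_def
proof
  fix t
  obtain k :: int where k: "of_int k * (2 * T) \<le> t" "t < (of_int k + 1) * (2 * T)"
    using reduce_mod[of "2 * T" 0 t] half_period_pos by auto
  define s where "s = t - of_int k * (2 * T)"
  have s: "0 \<le> s" "s < 2 * T" using k by (auto simp: s_def algebra_simps)
  have ts: "t rmod (2 * T) = s"
    by (rule rmod_unique[of _ _ _ k]) (use s in \<open>auto simp: s_def\<close>)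
  show "psi1 a1 a2 (t + T) = - psi1 a1 a2 t"
  proof (cases "s < T")
    case True
    have "(t + T) rmod (2 * T) = s + T"
      by (rule rmod_unique[of _ _ _ k]) (use s True in \<open>auto simp: s_def\<close>)
    then show ?thesis using True ts s a1 a2 by (auto simp: psi1_alt psi_base_def half_period_eq)
  next
    case False
    have "(t + T) rmod (2 * T) = s - T"
      by (rule rmod_unique[of _ _ _ "k + 1"]) (use s False in \<open>auto simp: s_def algebra_simps\<close>)
    then show ?thesis using False ts s a1 a2 by (auto simp: psi1_alt psi_base_def half_period_eq)
  qed
qed

text \<open>The abscissa of a maximum of \<open>psi n\<close>: for \<open>n = 1\<close> the middle
  of the top side of the trapezoid, and each integration delays it by a quarter of the period,
  \<open>T / 2\<close>.\<close>

definition centre :: "nat \<Rightarrow> real" where "centre n = a1 / 2 + real n * T / 2"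

lemma psi1_trapezoid:
  assumes "\<bar>u\<bar> \<le> T / 2"
  shows "psi1 a1 a2 (centre 1 + u) = max 0 (min 1 (1 + a2 / 2 - \<bar>u\<bar>))"
proof (cases "centre 1 + u \<le> T")
  case True
  then have "psi1 a1 a2 (centre 1 + u) = psi_base a1 a2 (centre 1 + u)"
    using assms a1 a2 by (intro psi1_base) (auto simp: centre_def half_period_eq field_simps abs_le_iff)
  also have "\<dots> = max 0 (min 1 (1 + a2 / 2 - \<bar>u\<bar>))"
    using assms a1 a2 True unfolding psi_base_def centre_def half_period_eq
    by (simp add: field_simps abs_if max_def min_def split: if_splits)
  finally show ?thesis .
next
  case False
  \<comment> \<open>The argument is at most \<open>a1 / 2\<close> beyond \<open>T\<close>, in the
    negated copy of the initial zero stretch.\<close>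
  have "psi1 a1 a2 (centre 1 + u) = - psi1 a1 a2 (centre 1 + u - T)"
    using antiperiodicD[OF psi1_antiperiodic, of "centre 1 + u - T"] by simp
  also have "psi1 a1 a2 (centre 1 + u - T) = psi_base a1 a2 (centre 1 + u - T)"
    using assms a1 a2 False by (intro psi1_base) (auto simp: centre_def half_period_eq field_simps abs_le_iff)
  also have "psi_base a1 a2 (centre 1 + u - T) = 0"
    using assms a1 a2 False by (simp add: psi_base_def centre_def half_period_eq field_simps abs_le_iff)
  also have "- 0 = max 0 (min 1 (1 + a2 / 2 - \<bar>u\<bar>))"
    using assms a1 a2 False by (simp add: centre_def half_period_eq field_simps abs_if max_def min_def split: if_splits)
  finally show ?thesis .
qed

lemma psi1_lipschitz: "\<bar>psi1 a1 a2 t - psi1 a1 a2 s\<bar> \<le> \<bar>t - s\<bar>"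
proof (rule antiperiodic_lipschitz[OF psi1_antiperiodic half_period_pos])
  \<comment> \<open>The cell starts in the middle of a zero stretch, so that it contains one whole
    trapezoid and \<open>psi1\<close> vanishes at both of its ends.\<close>
  have tr: "psi1 a1 a2 t = max 0 (min 1 (1 + a2 / 2 - \<bar>t - centre 1\<bar>))" if "a1 / 2 \<le> t" "t \<le> a1 / 2 + T" for t
    using psi1_trapezoid[of "t - centre 1"] that by (simp add: centre_def field_simps abs_le_iff)
  show "psi1 a1 a2 (a1 / 2) = 0" using tr[of "a1 / 2"] a1 a2 by (simp add: centre_def half_period_eq field_simps)
  fix s t assume st: "a1 / 2 \<le> s" "s \<le> t" "t \<le> a1 / 2 + T"
  have clip: "\<bar>max 0 (min 1 (x::real)) - max 0 (min 1 y)\<bar> \<le> \<bar>x - y\<bar>" for x y by linarith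
  have ts: "psi1 a1 a2 s = max 0 (min 1 (1 + a2 / 2 - \<bar>s - centre 1\<bar>))"
    "psi1 a1 a2 t = max 0 (min 1 (1 + a2 / 2 - \<bar>t - centre 1\<bar>))"
    by (rule tr; use st in linarith)+
  have "\<bar>psi1 a1 a2 t - psi1 a1 a2 s\<bar>
      \<le> \<bar>(1 + a2 / 2 - \<bar>t - centre 1\<bar>) - (1 + a2 / 2 - \<bar>s - centre 1\<bar>)\<bar>"
    unfolding ts by (rule clip)
  also have "\<dots> \<le> t - s" using st by linarith
  finally show "\<bar>psi1 a1 a2 t - psi1 a1 a2 s\<bar> \<le> t - s" .
qed

lemma psi_regular:
  "(\<forall>t. isCont (psi (Suc n) a1 a2) t) \<and> antiperiodic T (psi (Suc n) a1 a2) \<and>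
   (\<forall>t. (psi (Suc (Suc n)) a1 a2 has_real_derivative psi (Suc n) a1 a2 t) (at t))"
proof (induction n)
  case 0
  have c: "isCont (psi1 a1 a2) t" for t
    using lipschitz_continuous[of "psi1 a1 a2" 1] psi1_lipschitz
    by (simp add: continuous_on_eq_continuous_at)
  show ?case
    using antiperiodic_primitive_unique(1)[OF c psi1_antiperiodic half_period_pos] c psi1_antiperiodic
    unfolding half_period_eq psi.simps by blast
next
  case (Suc n)
  have d: "\<And>t. (psi (Suc (Suc n)) a1 a2 has_real_derivative psi (Suc n) a1 a2 t) (at t)" using Suc by blast
  then have c: "\<And>t. isCont (psi (Suc (Suc n)) a1 a2) t" using DERIV_isCont by blast
  have c0: "\<And>t. isCont (psi (Suc n) a1 a2) t" and ap0: "antiperiodic T (psi (Suc n) a1 a2)" using Suc by blast+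
  have ap: "antiperiodic T (psi (Suc (Suc n)) a1 a2)"
    using antiperiodic_primitive_unique(2)[OF c0 ap0 half_period_pos] unfolding half_period_eq psi.simps .
  show ?case
    using antiperiodic_primitive_unique(1)[OF c ap half_period_pos] c ap
    unfolding half_period_eq psi.simps(3)[of "Suc n"] by blast
qed

lemma psi_isCont: "1 \<le> n \<Longrightarrow> isCont (psi n a1 a2) t"
  and psi_antiperiodic: "1 \<le> n \<Longrightarrow> antiperiodic T (psi n a1 a2)"
  and psi_DERIV: "1 \<le> n \<Longrightarrow> (psi (Suc n) a1 a2 has_real_derivative psi n a1 a2 t) (at t)"
  using psi_regular[of "n - 1"] by auto

lemma centre_Suc: "centre (Suc n) = centre n + T / 2"
  by (simp add: centre_def field_simps)

text \<open>Evenness about a maximum together with antiperiodicity gives oddness about the point a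
  quarter period later; the antiderivative is then even about that point.\<close>

lemma psi_even: "1 \<le> n \<Longrightarrow> psi n a1 a2 (centre n - s) = psi n a1 a2 (centre n + s)"
proof (induction n arbitrary: s rule: dec_induct)
  case base
  show ?case
  proof (rule antiperiodic_even)
    show "antiperiodic T (psi 1 a1 a2)" by (rule psi_antiperiodic) simp
    show "psi 1 a1 a2 (centre 1 - s) = psi 1 a1 a2 (centre 1 + s)" if "\<bar>s\<bar> \<le> T / 2" for s
      using psi1_trapezoid[of s] psi1_trapezoid[of "- s"] that by simp
  qed (rule half_period_pos)
next
  case (step n)
  let ?c = "centre (Suc n)"
  have "psi n a1 a2 (?c - s) = - psi n a1 a2 (?c + s)" for s
  proof -
    have "psi n a1 a2 (?c - s) = psi n a1 a2 (centre n + (T / 2 - s))" by (simp add: centre_Suc algebra_simps)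
    also have "\<dots> = psi n a1 a2 (centre n - (T / 2 - s))" by (rule step.IH[symmetric])
    also have "\<dots> = - psi n a1 a2 (centre n - (T / 2 - s) + T)"
      using antiperiodicD[OF psi_antiperiodic[OF step(1)], of "centre n - (T / 2 - s)"] by simp
    also have "centre n - (T / 2 - s) + T = ?c + s" by (simp add: centre_Suc field_simps)
    finally show ?thesis .
  qed
  then have *: "((\<lambda>s. psi (Suc n) a1 a2 (?c - s) - psi (Suc n) a1 a2 (?c + s)) has_real_derivative 0) (at s)" for s
    by - (rule derivative_eq_intros DERIV_chain2[OF psi_DERIV[OF step(1)]] refl | simp)+
  from DERIV_zero_const[OF *, of s 0] show ?case by simp
qed

section \<open>The quarter wave from a maximum to the next zero\<close>

definition qwave :: "nat \<Rightarrow> real \<Rightarrow> real" where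
  "qwave n s = psi n a1 a2 (centre n + s)"

lemma qwave_minus: "1 \<le> n \<Longrightarrow> qwave n (- s) = qwave n s"
  using psi_even[of n s] by (simp add: qwave_def)

lemma qwave_shift: "1 \<le> n \<Longrightarrow> qwave n (s + T) = - qwave n s"
  using antiperiodicD[OF psi_antiperiodic, of n "centre n + s"] by (simp add: qwave_def add.assoc)

lemma qwave_odd: "1 \<le> n \<Longrightarrow> qwave n (T - s) = - qwave n s"
  using qwave_shift[of n "- s"] qwave_minus[of n s] by simp

lemma qwave_zero: "1 \<le> n \<Longrightarrow> qwave n (T / 2) = 0"
proof -
  assume n: "1 \<le> n"
  have "T - T / 2 = T / 2" by simp
  then show ?thesis using qwave_odd[OF n, of "T / 2"] by simp
qed

text \<open>A quarter wave falls at the rate given by its predecessor traversed backwards: slowly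
  near its own maximum, where the predecessor is near zero.\<close>

lemma qwave_DERIV:
  assumes "1 \<le> n"
  shows "(qwave (Suc n) has_real_derivative - qwave n (T / 2 - s)) (at s)"
proof -
  have "qwave n (s + T / 2) = - qwave n (T / 2 - s)"
    using qwave_odd[OF assms, of "T / 2 - s"] by (simp add: add.commute field_simps)
  then have "psi n a1 a2 (centre (Suc n) + s) = - qwave n (T / 2 - s)"
    by (simp add: qwave_def centre_Suc ac_simps)
  moreover have "((\<lambda>s. psi (Suc n) a1 a2 (centre (Suc n) + s)) has_real_derivative
      psi n a1 a2 (centre (Suc n) + s) * 1) (at s)"
    by (rule DERIV_chain2[OF psi_DERIV[OF assms]]) (auto intro!: derivative_eq_intros)
  moreover have "qwave (Suc n) = (\<lambda>s. psi (Suc n) a1 a2 (centre (Suc n) + s))"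
    by (simp add: qwave_def fun_eq_iff)
  ultimately show ?thesis by simp
qed

text \<open>Half the length of the flat maximum. For \<open>n = 2\<close> it stems from the stretch
  of length \<open>a1\<close> on which \<open>psi1\<close> vanishes.\<close>

definition plateau :: "nat \<Rightarrow> real" where
  "plateau n = (if n = 1 then a2 / 2 else if n = 2 then a1 / 2 else 0)"

text \<open>Where the quarter wave first vanishes. Only the trapezoid can reach zero before
  \<open>T / 2\<close>, namely by \<open>a1 / 2\<close>, and this gap is the plateau of the next
  wave.\<close>

definition foot :: "nat \<Rightarrow> real" where
  "foot n = (if n = 1 then 1 + a2 / 2 else T / 2)"

lemma foot_plateau: "1 \<le> n \<Longrightarrow> T / 2 - foot n = plateau (Suc n)"
  by (auto simp: foot_def plateau_def half_period_eq field_simps)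

lemma plateau_foot: "0 \<le> plateau n" "plateau n < foot n" "foot n \<le> T / 2"
  using a1 a2 by (auto simp: foot_def plateau_def half_period_eq field_simps)

lemma qwave_one: "\<bar>s\<bar> \<le> T / 2 \<Longrightarrow> qwave 1 s = max 0 (min 1 (1 + a2 / 2 - \<bar>s\<bar>))"
  using psi1_trapezoid by (simp add: qwave_def)

text \<open>The three claims support each other in the induction: a wave is positive before its foot
  and zero after it, so its successor, whose derivative is the reversed wave negated, is first
  constant and then strictly falling.\<close>

lemma qwave_shape:
  assumes "1 \<le> n"
  shows "(\<forall>s s'. plateau n \<le> s \<longrightarrow> s < s' \<longrightarrow> s' \<le> foot n \<longrightarrow> qwave n s' < qwave n s) \<and>
    (\<forall>s. 0 \<le> s \<longrightarrow> s \<le> plateau n \<longrightarrow> qwave n s = qwave n 0) \<and>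
    (\<forall>s. foot n \<le> s \<longrightarrow> s \<le> T / 2 \<longrightarrow> qwave n s = 0)"
  using assms
proof (induction n rule: dec_induct)
  case base
  then show ?case using a1 a2
    by (auto simp: qwave_one[unfolded One_nat_def] plateau_def foot_def half_period_eq)
next
  case (step n)
  note dec = step.IH[THEN conjunct1, rule_format] and flat = step.IH[THEN conjunct2, THEN conjunct1, rule_format]
    and zero = step.IH[THEN conjunct2, THEN conjunct2, rule_format]
  have pos: "0 < qwave n s" if "0 \<le> s" "s < foot n" for s
  proof (cases "plateau n \<le> s")
    case True
    then show ?thesis using dec[of s "foot n"] zero[of "foot n"] that plateau_foot[of n] by simp
  next
    case False
    then have "qwave n s = qwave n (plateau n)" using flat[of s] flat[of "plateau n"] plateau_foot[of n] that by simp
    then show ?thesis using dec[of "plateau n" "foot n"] zero[of "foot n"] plateau_foot[of n] by simp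
  qed
  have fp: "foot (Suc n) = T / 2" "plateau (Suc n) = T / 2 - foot n"
    using step(1) foot_plateau[OF step(1)] by (auto simp: foot_def)
  have cont: "continuous_on A (qwave (Suc n))" for A
    using qwave_DERIV[OF step(1)] by (meson DERIV_isCont continuous_at_imp_continuous_on)
  show ?case
  proof (intro conjI allI impI)
    fix s s' assume s: "plateau (Suc n) \<le> s" "s < s'" "s' \<le> foot (Suc n)"
    show "qwave (Suc n) s' < qwave (Suc n) s"
    proof (rule DERIV_neg_imp_decreasing_open[OF s(2)])
      fix x assume "s < x" "x < s'"
      then have "0 < qwave n (T / 2 - x)" using s fp by (intro pos) auto
      then show "\<exists>y. DERIV (qwave (Suc n)) x :> y \<and> y < 0"
        using qwave_DERIV[OF step(1), of x] by (intro exI[of _ "- qwave n (T / 2 - x)"]) simp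
    qed (rule cont)
  next
    fix s assume s: "0 \<le> s" "s \<le> plateau (Suc n)"
    show "qwave (Suc n) s = qwave (Suc n) 0"
    proof (cases "s = 0")
      case False
      show ?thesis
      proof (rule DERIV_isconst_end[of 0 s])
        show "0 < s" using s False by simp
        fix x assume "0 < x" "x < s"
        then have "qwave n (T / 2 - x) = 0" using s fp by (intro zero) auto
        then show "DERIV (qwave (Suc n)) x :> 0" using qwave_DERIV[OF step(1), of x] by simp
      qed (rule cont)
    qed simp
  next
    fix s assume "foot (Suc n) \<le> s" "s \<le> T / 2"
    then have "s = T / 2" using fp by simp
    then show "qwave (Suc n) s = 0" using qwave_zero[of "Suc n"] by (simp only:)
  qed
qed

lemma qwave_decreasing:
  "1 \<le> n \<Longrightarrow> plateau n \<le> s \<Longrightarrow> s < s' \<Longrightarrow> s' \<le> foot n \<Longrightarrow> qwave n s' < qwave n s"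
  and qwave_plateau: "1 \<le> n \<Longrightarrow> 0 \<le> s \<Longrightarrow> s \<le> plateau n \<Longrightarrow> qwave n s = qwave n 0"
  and qwave_foot: "1 \<le> n \<Longrightarrow> foot n \<le> s \<Longrightarrow> s \<le> T / 2 \<Longrightarrow> qwave n s = 0"
  using qwave_shape[of n] by blast+

lemma qwave_peak:
  assumes n: "1 \<le> n" and s: "0 \<le> s" "s \<le> T / 2"
  shows "0 \<le> qwave n s" "qwave n s \<le> qwave n 0" "0 < qwave n 0"
proof -
  have pl: "qwave n (plateau n) = qwave n 0" using qwave_plateau[OF n, of "plateau n"] plateau_foot[of n] by simp
  have ft: "qwave n (foot n) = 0" using qwave_foot[OF n, of "foot n"] plateau_foot[of n] by simp
  show "0 < qwave n 0" using qwave_decreasing[OF n, of "plateau n" "foot n"] plateau_foot[of n] pl ft by simp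
  consider "s \<le> plateau n" | "plateau n < s" "s < foot n" | "foot n \<le> s" by linarith
  then have "0 \<le> qwave n s \<and> qwave n s \<le> qwave n 0"
  proof cases
    case 1
    then show ?thesis using qwave_plateau[OF n s(1)] \<open>0 < qwave n 0\<close> by simp
  next
    case 2
    then show ?thesis
      using qwave_decreasing[OF n, of "plateau n" s] qwave_decreasing[OF n, of s "foot n"] pl ft by simp
  next
    case 3
    then show ?thesis using qwave_foot[OF n _ s(2)] \<open>0 < qwave n 0\<close> by simp
  qed
  then show "0 \<le> qwave n s" "qwave n s \<le> qwave n 0" by auto
qed

lemma qwave_antimono:
  assumes n: "1 \<le> n" and s: "0 \<le> s" "s \<le> s'" "s' \<le> T / 2"
  shows "qwave n s' \<le> qwave n s"
proof -
  consider "s \<le> plateau n" | "foot n \<le> s'" | "plateau n < s" "s' < foot n" by linarith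
  then show ?thesis
  proof cases
    case 1
    then show ?thesis using qwave_plateau[OF n s(1)] qwave_peak(2)[OF n, of s'] s by simp
  next
    case 2
    then show ?thesis using qwave_foot[OF n _ s(3)] qwave_peak(1)[OF n, of s] s by simp
  next
    case 3
    then show ?thesis using qwave_decreasing[OF n, of s s'] s by (cases "s = s'") auto
  qed
qed

lemma psi_quarter:
  assumes n: "1 \<le> n"
  obtains s where "0 \<le> s" "s \<le> T / 2" "\<bar>psi n a1 a2 t\<bar> = qwave n s"
proof -
  obtain k :: int where k: "- T / 2 + of_int k * T \<le> t - centre n" "t - centre n < - T / 2 + (of_int k + 1) * T"
    using reduce_mod[OF half_period_pos, of "- T / 2" "t - centre n"] by blast
  define u where "u = t - centre n - of_int k * T"
  have u: "\<bar>u\<bar> \<le> T / 2" 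
  proof -
    have "(of_int k + 1) * T = of_int k * T + T" by (simp add: algebra_simps)
    then show ?thesis using k unfolding u_def by linarith
  qed
  have "\<bar>psi n a1 a2 t\<bar> = \<bar>qwave n u\<bar>"
    using antiperiodic_abs_int[OF psi_antiperiodic[OF n], of "centre n + u" k] by (simp add: u_def qwave_def)
  also have "qwave n u = qwave n \<bar>u\<bar>" using qwave_minus[OF n, of u] by (simp add: abs_if)
  finally show thesis using that[of "\<bar>u\<bar>"] u qwave_peak[OF n, of "\<bar>u\<bar>"] by simp
qed

lemma psi_bound: "1 \<le> n \<Longrightarrow> \<bar>psi n a1 a2 t\<bar> \<le> qwave n 0"
  using psi_quarter[of n t] qwave_peak(2)[of n] by metis

end

subsection \<open>Comparison of distribution functions\<close>

lemma emeasure_periodic: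
  fixes y :: "real \<Rightarrow> real"
  assumes [measurable]: "y \<in> borel_measurable borel" and per: "\<And>t. y (t + p) = y t" and "0 < p"
    and [measurable]: "Measurable.pred borel Q"
  shows "emeasure lborel {t \<in> {a..a + p}. Q (y t)} = emeasure lborel {t \<in> {0..p}. Q (y t)}"
proof -
  have e: "emeasure lborel {t \<in> {c..d}. Q (y t)} = (\<integral>\<^sup>+t\<in>{c..d}. indicator {t. Q (y t)} t \<partial>lborel)" for c d
  proof -
    have "emeasure lborel {t \<in> {c..d}. Q (y t)} = (\<integral>\<^sup>+t. indicator {t \<in> {c..d}. Q (y t)} t \<partial>lborel)"
      by (subst nn_integral_indicator) auto
    also have "\<dots> = (\<integral>\<^sup>+t\<in>{c..d}. indicator {t. Q (y t)} t \<partial>lborel)"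
      by (intro nn_integral_cong) (auto simp: indicator_def)
    finally show ?thesis .
  qed
  show ?thesis unfolding e
    by (rule nn_integral_periodic) (use per \<open>0 < p\<close> in \<open>auto simp: indicator_def\<close>)
qed

text \<open>\<open>P\<close> is the graph of \<open>\<bar>G\<bar>\<close> to the right of its maximum at \<open>c\<close>, over a quarter \<open>q\<close> of the period; \<open>e\<close> is
  half the length of the plateau around the maximum.\<close>
locale quarter_wave =
  fixes G P :: "real \<Rightarrow> real" and c q e :: real
  assumes G_cont: "continuous_on UNIV G" and G_per: "\<And>t. \<bar>G (t + 2 * q)\<bar> = \<bar>G t\<bar>"
    and G_even: "\<And>s. \<bar>G (c - s)\<bar> = \<bar>G (c + s)\<bar>"
    and G_P: "\<And>s. 0 \<le> s \<Longrightarrow> s \<le> q \<Longrightarrow> \<bar>G (c + s)\<bar> = P s"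
    and P_cont: "\<And>s. isCont P s"
    and P_dec: "\<And>s s'. e \<le> s \<Longrightarrow> s < s' \<Longrightarrow> s' \<le> q \<Longrightarrow> P s' < P s"
    and P_flat: "\<And>s. 0 \<le> s \<Longrightarrow> s \<le> e \<Longrightarrow> P s = P 0"
    and P_q: "P q = 0" and e: "0 \<le> e" "e < q"
begin

lemma G_measurable [measurable]: "G \<in> borel_measurable borel"
  using G_cont by (rule borel_measurable_continuous_onI)

lemma P_measurable [measurable]: "P \<in> borel_measurable borel"
  using P_cont by (intro borel_measurable_continuous_onI) (auto intro: continuous_at_imp_continuous_on)

lemma integral_G:
  assumes [measurable]: "f \<in> borel_measurable borel"
  shows "(\<integral>\<^sup>+t\<in>{0..4 * q}. f \<bar>G t\<bar> \<partial>lborel) = 4 * (\<integral>\<^sup>+s\<in>{0..q}. f (P s) \<partial>lborel)"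
proof -
  have "(\<integral>\<^sup>+t\<in>{0..4 * q}. f \<bar>G t\<bar> \<partial>lborel) = 4 * (\<integral>\<^sup>+s\<in>{0..q}. f \<bar>G (c + s)\<bar> \<partial>lborel)"
    by (rule nn_integral_quarter) (use G_per G_even e in auto)
  also have "(\<integral>\<^sup>+s\<in>{0..q}. f \<bar>G (c + s)\<bar> \<partial>lborel) = (\<integral>\<^sup>+s\<in>{0..q}. f (P s) \<partial>lborel)"
    by (intro nn_integral_cong) (auto simp: indicator_def G_P)
  finally show ?thesis .
qed

lemma P_level:
  assumes "0 \<le> v" "v < P 0"
  obtains s where "e < s" "s \<le> q" "P s = v" "{t \<in> {0..q}. v < P t} = {0..<s}"
proof -
  have "P e = P 0" using P_flat[of e] e by simp
  have "\<exists>s. e \<le> s \<and> s \<le> q \<and> P s = v"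
    using assms P_q \<open>P e = P 0\<close> e P_cont by (intro IVT2) auto
  then obtain s where s: "e \<le> s" "s \<le> q" "P s = v" by blast
  then have "e < s" using assms \<open>P e = P 0\<close> by (cases "s = e") auto
  have "v < P t \<longleftrightarrow> t < s" if t: "0 \<le> t" "t \<le> q" for t
  proof (cases "t \<le> e")
    case True
    then show ?thesis using P_flat[OF t(1) True] assms \<open>e < s\<close> by simp
  next
    case False
    then show ?thesis using P_dec[of s t] P_dec[of t s] s t by (cases t s rule: linorder_cases) auto
  qed
  then have "{t \<in> {0..q}. v < P t} = {0..<s}" using s(2) by auto
  then show thesis using that \<open>e < s\<close> s by blast
qed

lemma distribution_G_eq:
  "emeasure lborel {t\<in>{0..4 * q}. v < \<bar>G t\<bar>} = 4 * emeasure lborel {t \<in> {0..q}. v < P t}"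
proof -
  have "emeasure lborel {t\<in>{0..4 * q}. v < \<bar>G t\<bar>} = (\<integral>\<^sup>+t. indicator {t\<in>{0..4 * q}. v < \<bar>G t\<bar>} t \<partial>lborel)"
    by (subst nn_integral_indicator) auto
  also have "\<dots> = (\<integral>\<^sup>+t\<in>{0..4 * q}. indicator {v<..} \<bar>G t\<bar> \<partial>lborel)"
    by (intro nn_integral_cong) (auto simp: indicator_def)
  also have "\<dots> = 4 * (\<integral>\<^sup>+s\<in>{0..q}. indicator {v<..} (P s) \<partial>lborel)"
    by (rule integral_G) simp
  also have "(\<integral>\<^sup>+s\<in>{0..q}. indicator {v<..} (P s) \<partial>lborel) = (\<integral>\<^sup>+t. indicator {t \<in> {0..q}. v < P t} t \<partial>lborel)"
    by (intro nn_integral_cong) (auto simp: indicator_def)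
  also have "\<dots> = emeasure lborel {t \<in> {0..q}. v < P t}" by (subst nn_integral_indicator) auto
  finally show ?thesis .
qed

lemma distribution_G:
  assumes "0 \<le> v" "v < P 0"
  shows "\<exists>s. e < s \<and> s \<le> q \<and> P s = v \<and> emeasure lborel {t\<in>{0..4 * q}. v < \<bar>G t\<bar>} = ennreal (4 * s)"
proof -
  from P_level[OF assms] obtain s where s: "e < s" "s \<le> q" "P s = v" "{t \<in> {0..q}. v < P t} = {0..<s}"
    by blast
  have "emeasure lborel {t\<in>{0..4 * q}. v < \<bar>G t\<bar>} = 4 * ennreal s"
    unfolding distribution_G_eq s(4) using s(1) e by simp
  also have "4 * ennreal s = ennreal (4 * s)" using s(1) e by (simp add: ennreal_mult)
  finally show ?thesis using s by blast
qed

lemma P_le: "0 \<le> s \<Longrightarrow> s \<le> q \<Longrightarrow> P s \<le> P 0"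
  using P_flat[of s] P_flat[of e] P_dec[of e s] e by (cases "s \<le> e") auto

end

text \<open>Opposite extreme values are what subtracting the constant of best approximation
  achieves; they split a period into a passage from \<open>M\<close> to \<open>- M\<close> and one
  back.\<close>

locale compared_function = quarter_wave +
  fixes y :: "real \<Rightarrow> real" and M \<alpha> \<beta> :: real
  assumes y_cont: "continuous_on UNIV y" and y_per: "\<And>t. y (t + 1) = y t"
    and y_bound: "\<And>t. \<bar>y t\<bar> \<le> M" and y_max: "y \<alpha> = M" and y_min: "y \<beta> = - M"
    and M_le: "M \<le> P 0" and cmp: "comparison q P y"
begin

lemma y_measurable [measurable]: "y \<in> borel_measurable borel"
  using y_cont by (rule borel_measurable_continuous_onI)

lemma band_01:
  assumes ab: "e \<le> a" "a < b" "b \<le> q" "P a \<le> M"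
  shows "ennreal (4 * (b - a)) \<le> emeasure lborel {t \<in> {0..1}. P b < \<bar>y t\<bar> \<and> \<bar>y t\<bar> \<le> P a}"
proof -
  have "P b < P a" using P_dec[of a b] ab by simp
  have "0 \<le> P b" using P_dec[of b q] ab P_q by (cases "b = q") auto
  then have "0 < M" using \<open>P b < P a\<close> ab by simp
  obtain k :: int where k: "\<alpha> + of_int k * 1 \<le> \<beta>" "\<beta> < \<alpha> + (of_int k + 1) * 1"
    using reduce_mod[of 1 \<alpha> \<beta>] by auto
  \<comment> \<open>The minimum is moved by whole periods to lie strictly between the consecutive
    maxima \<alpha> and \<open>\<alpha> + 1\<close>.\<close>
  define \<beta>' where "\<beta>' = \<beta> - of_int k"
  have y\<beta>: "y \<beta>' = - M" using periodic_int[of y 1 \<beta>' k] y_per y_min by (simp add: \<beta>'_def)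
  then have "\<beta>' \<noteq> \<alpha>" using y_max \<open>0 < M\<close> by auto
  then have *: "\<alpha> < \<beta>'" "\<beta>' < \<alpha> + 1" using k by (auto simp: \<beta>'_def)
  have "ennreal (4 * (b - a)) \<le> emeasure lborel {t \<in> {\<alpha>..\<alpha> + 1}. P b < \<bar>y t\<bar> \<and> \<bar>y t\<bar> \<le> P a}"
    by (rule band_measure[OF cmp P_cont P_dec e(1) ab(1-3) \<open>0 \<le> P b\<close> y_cont *])
      (use y_max y\<beta> y_per ab in auto)
  also have "\<dots> = emeasure lborel {t \<in> {0..1}. P b < \<bar>y t\<bar> \<and> \<bar>y t\<bar> \<le> P a}"
    by (rule emeasure_periodic[where Q = "\<lambda>x. P b < \<bar>x\<bar> \<and> \<bar>x\<bar> \<le> P a"]) (use y_per in auto)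
  finally show ?thesis .
qed

text \<open>If \<open>y\<close> has the full height of the wave, the band may begin at the very
  maximum, at \<open>a = 0\<close>; this is where the absence of a plateau enters.\<close>

lemma distribution_ge:
  assumes "e = 0" "M = P 0" "0 \<le> v"
  shows "emeasure lborel {t\<in>{0..4 * q}. v < \<bar>G t\<bar>} \<le> emeasure lborel {t\<in>{0..1}. v < \<bar>y t\<bar>}"
proof (cases "v < P 0")
  case True
  from distribution_G[OF \<open>0 \<le> v\<close> this] obtain s where s: "e < s" "s \<le> q" "P s = v"
    "emeasure lborel {t\<in>{0..4 * q}. v < \<bar>G t\<bar>} = ennreal (4 * s)" by blast
  have "ennreal (4 * (s - 0)) \<le> emeasure lborel {t \<in> {0..1}. P s < \<bar>y t\<bar> \<and> \<bar>y t\<bar> \<le> P 0}"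
    by (rule band_01) (use s assms in auto)
  also have "\<dots> \<le> emeasure lborel {t\<in>{0..1}. v < \<bar>y t\<bar>}"
    using s(3) by (intro emeasure_mono) auto
  finally show ?thesis using s(4) by simp
next
  case False
  have "{t \<in> {0..q}. v < P t} = {}" using P_le False by force
  then have "emeasure lborel {t\<in>{0..4 * q}. v < \<bar>G t\<bar>} = 0"
    unfolding distribution_G_eq by (simp only: emeasure_empty mult_zero_right)
  then show ?thesis by simp
qed

text \<open>The set \<open>N\<close> of levels at which \<open>y\<close> has the strictly larger
  distribution function is closed downwards: on lowering the level, \<open>n\<close> gains exactly
  the time that the wave spends in the band, and \<open>m\<close> gains at least as much. The
  crossing is the supremum of \<open>N\<close>.\<close>

lemma distribution_crossing:
  obtains v0 where "0 \<le> v0"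
    "\<And>v. 0 < v \<Longrightarrow> v < v0 \<Longrightarrow> emeasure lborel {t\<in>{0..4 * q}. v < \<bar>G t\<bar>} \<le> emeasure lborel {t\<in>{0..1}. v < \<bar>y t\<bar>}"
    "\<And>v. v0 < v \<Longrightarrow> emeasure lborel {t\<in>{0..1}. v < \<bar>y t\<bar>} \<le> emeasure lborel {t\<in>{0..4 * q}. v < \<bar>G t\<bar>}"
proof -
  define m n where "m = (\<lambda>v. emeasure lborel {t\<in>{0..1}. v < \<bar>y t\<bar>})"
    and "n = (\<lambda>v. emeasure lborel {t\<in>{0..4 * q}. v < \<bar>G t\<bar>})"
  have big: "m v = 0" if "M \<le> v" for v
  proof -
    have "{t\<in>{0..1}. v < \<bar>y t\<bar>} = {}" using y_bound that by (auto simp: not_less) (meson order_trans)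
    then show ?thesis unfolding m_def by (simp only: emeasure_empty)
  qed
  define N where "N = {v. 0 \<le> v \<and> n v < m v}"
  have NM: "v < M" if "v \<in> N" for v using big[of v] that by (force simp: N_def)
  have down: "n u < m u" if v: "v \<in> N" and u: "0 \<le> u" "u < v" for u v
  proof -
    have vP: "v < P 0" "u < P 0" "0 \<le> v" using NM[OF v] M_le u by auto
    obtain a where a: "e < a" "a \<le> q" "P a = v" "n v = ennreal (4 * a)"
      using distribution_G[OF vP(3,1)] unfolding n_def by blast
    obtain b where b: "e < b" "b \<le> q" "P b = u" "n u = ennreal (4 * b)"
      using distribution_G[OF u(1) vP(2)] unfolding n_def by blast
    have "a < b" using P_dec[of b a] a b u by (cases a b rule: linorder_cases) auto
    have "n u = ennreal (4 * a) + ennreal (4 * (b - a))"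
      using \<open>a < b\<close> a(1) e b(4) by (simp flip: ennreal_plus)
    also have "\<dots> < m v + ennreal (4 * (b - a))"
      using v a(4) by (simp add: N_def add.commute[of _ "ennreal (4 * (b - a))"] ennreal_add_left_cancel_less)
    also have "\<dots> \<le> m v + emeasure lborel {t \<in> {0..1}. u < \<bar>y t\<bar> \<and> \<bar>y t\<bar> \<le> v}"
      using band_01[of a b] a b \<open>a < b\<close> NM[OF v] by (intro add_left_mono) auto
    also have "\<dots> = emeasure lborel ({t\<in>{0..1}. v < \<bar>y t\<bar>} \<union> {t \<in> {0..1}. u < \<bar>y t\<bar> \<and> \<bar>y t\<bar> \<le> v})"
      unfolding m_def by (intro plus_emeasure) auto
    also have "{t\<in>{0..1}. v < \<bar>y t\<bar>} \<union> {t \<in> {0..1}. u < \<bar>y t\<bar> \<and> \<bar>y t\<bar> \<le> v} = {t\<in>{0..1}. u < \<bar>y t\<bar>}"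
      using u by auto
    finally show ?thesis by (simp add: m_def)
  qed
  show thesis
  proof (cases "N = {}")
    case True
    show thesis
    proof (rule that[of 0])
      show "emeasure lborel {t\<in>{0..1}. v < \<bar>y t\<bar>} \<le> emeasure lborel {t\<in>{0..4 * q}. v < \<bar>G t\<bar>}" if "0 < v" for v
        proof -
        have "\<not> n v < m v" using True that by (auto simp: N_def)
        then show ?thesis by (simp only: m_def n_def not_less)
      qed
    qed auto
  next
    case False
    have bdd: "bdd_above N" using NM by (intro bdd_aboveI[of _ M]) (auto intro: less_imp_le)
    have S0: "0 \<le> Sup N"
    proof -
      obtain w where w: "w \<in> N" using False by blast
      then have "0 \<le> w" by (simp add: N_def)
      also have "w \<le> Sup N" by (rule cSup_upper[OF w bdd])
      finally show ?thesis .
    qed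
    show thesis
    proof (rule that[of "Sup N", OF S0])
      show "emeasure lborel {t\<in>{0..4 * q}. v < \<bar>G t\<bar>} \<le> emeasure lborel {t\<in>{0..1}. v < \<bar>y t\<bar>}" if v: "0 < v" "v < Sup N" for v
      proof -
        obtain w where "w \<in> N" "v < w" using less_cSupD[OF False v(2)] by blast
        then show ?thesis using down[of w v] v unfolding m_def n_def by (simp only: less_imp_le)
      qed
      show "emeasure lborel {t\<in>{0..1}. v < \<bar>y t\<bar>} \<le> emeasure lborel {t\<in>{0..4 * q}. v < \<bar>G t\<bar>}" if "Sup N < v" for v
      proof (rule ccontr)
        assume "\<not> ?thesis"
        then have "v \<in> N" using that S0 unfolding N_def m_def n_def by (simp only: mem_Collect_eq not_le less_imp_le)
        then show False using cSup_upper[OF _ bdd] that by force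
      qed
    qed
  qed
qed

lemma Lp_norm_compare:
  assumes pq: "0 < p" "p < r" and eq: "Lp_norm p 0 (4 * q) G = Lp_norm p 0 1 y"
  shows "Lp_norm r 0 1 y \<le> Lp_norm r 0 (4 * q) G"
proof -
  have r: "0 < r" using pq by simp
  let ?I = "\<lambda>s. \<integral>\<^sup>+t\<in>{0..1}. ennreal (\<bar>y t\<bar> powr s) \<partial>lborel"
  let ?J = "\<lambda>s. \<integral>\<^sup>+t\<in>{0..4 * q}. ennreal (\<bar>G t\<bar> powr s) \<partial>lborel"
  note I = Lp_norm_continuous[OF y_cont, where a = 0 and b = 1]
  note J = Lp_norm_continuous[OF G_cont, where a = 0 and b = "4 * q"]
  have pe: "?I p = ?J p" by (rule Lp_norm_eqD[OF y_cont G_cont pq(1) eq[symmetric]])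
  obtain v0 where v0: "0 \<le> v0"
    "\<And>v. 0 < v \<Longrightarrow> v < v0 \<Longrightarrow> emeasure lborel {t\<in>{0..4 * q}. v < \<bar>G t\<bar>} \<le> emeasure lborel {t\<in>{0..1}. v < \<bar>y t\<bar>}"
    "\<And>v. v0 < v \<Longrightarrow> emeasure lborel {t\<in>{0..1}. v < \<bar>y t\<bar>} \<le> emeasure lborel {t\<in>{0..4 * q}. v < \<bar>G t\<bar>}"
    using distribution_crossing by blast
  have "?I r \<le> ?J r"
    by (rule nn_integral_powr_compare[OF _ _ _ _ _ _ pq v0 pe I(2)[OF pq(1)]]) auto
  then have "enn2real (?I r) \<le> enn2real (?J r)" using J(2)[OF r] by (intro enn2real_mono) auto
  then show ?thesis unfolding I(1)[OF r] J(1)[OF r] using r by (intro powr_mono2) auto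
qed

lemma Lp_integral_ge:
  assumes "e = 0" "M = P 0" "0 < p"
  shows "4 * (\<integral>\<^sup>+s\<in>{0..q}. ennreal (\<bar>P s\<bar> powr p) \<partial>lborel) \<le> (\<integral>\<^sup>+t\<in>{0..1}. ennreal (\<bar>y t\<bar> powr p) \<partial>lborel)"
proof -
  have "4 * (\<integral>\<^sup>+s\<in>{0..q}. ennreal (\<bar>P s\<bar> powr p) \<partial>lborel) = (\<integral>\<^sup>+t\<in>{0..4 * q}. ennreal (\<bar>G t\<bar> powr p) \<partial>lborel)"
    using integral_G[of "\<lambda>x. ennreal (\<bar>x\<bar> powr p)"] by simp
  also have "\<dots> = (\<integral>\<^sup>+v. ennreal (p * v powr (p - 1)) * indicator {0<..} v * emeasure lborel {t\<in>{0..4 * q}. v < \<bar>G t\<bar>} \<partial>lborel)"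
    using \<open>0 < p\<close> by (intro nn_integral_powr_distribution) auto
  also have "\<dots> \<le> (\<integral>\<^sup>+v. ennreal (p * v powr (p - 1)) * indicator {0<..} v * emeasure lborel {t\<in>{0..1}. v < \<bar>y t\<bar>} \<partial>lborel)"
  proof (rule nn_integral_mono)
    fix v
    show "ennreal (p * v powr (p - 1)) * indicator {0<..} v * emeasure lborel {t\<in>{0..4 * q}. v < \<bar>G t\<bar>}
      \<le> ennreal (p * v powr (p - 1)) * indicator {0<..} v * emeasure lborel {t\<in>{0..1}. v < \<bar>y t\<bar>}"
      using distribution_ge[OF assms(1,2), of v] by (cases "0 < v") (auto intro: mult_left_mono)
  qed
  also have "\<dots> = (\<integral>\<^sup>+t\<in>{0..1}. ennreal (\<bar>y t\<bar> powr p) \<partial>lborel)"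
    using \<open>0 < p\<close> by (intro nn_integral_powr_distribution[symmetric]) auto
  finally show ?thesis .
qed

end

subsection \<open>Essential norms and the constant of best approximation\<close>

text \<open>A violation would occur on a nonempty open set, and such a set is not
  negligible.\<close>

lemma Linf_norm_pointwise:
  assumes f: "continuous_on UNIV f" and le: "Linf_norm f \<le> ereal C"
  shows "\<bar>f t\<bar> \<le> C"
proof (rule ccontr)
  assume t: "\<not> \<bar>f t\<bar> \<le> C"
  have "AE t in lebesgue. ereal \<bar>f t\<bar> \<le> Linf_norm f"
    unfolding Linf_norm_def by (rule esssup_AE)
  then have "AE t in lebesgue. \<bar>f t\<bar> \<le> C"
    by eventually_elim (use le in \<open>metis ereal_less_eq(3) order_trans\<close>)
  then obtain N where N: "N \<in> null_sets lebesgue" "{t \<in> space lebesgue. \<not> \<bar>f t\<bar> \<le> C} \<subseteq> N"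
    unfolding eventually_ae_filter by blast
  have "{t. C < \<bar>f t\<bar>} \<subseteq> N" using N(2) by auto
  moreover have "negligible N" using N(1) by (simp add: negligible_iff_null_sets)
  ultimately have "negligible {t. C < \<bar>f t\<bar>}" by (rule negligible_subset[rotated])
  moreover have "open {t. C < \<bar>f t\<bar>}" using f by (intro open_Collect_less continuous_intros) auto
  moreover have "t \<in> {t. C < \<bar>f t\<bar>}" using t by simp
  ultimately show False using open_not_negligible by blast
qed

lemma Linf_norm_AE:
  assumes le: "Linf_norm f \<le> ereal C"
  shows "AE t in lebesgue. \<bar>f t\<bar> \<le> C"
proof -
  have "AE t in lebesgue. ereal \<bar>f t\<bar> \<le> Linf_norm f"
    unfolding Linf_norm_def by (rule esssup_AE)
  then show ?thesis
    by eventually_elim (use le in \<open>metis ereal_less_eq(3) order_trans\<close>)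
qed

lemma Linf_norm_leI:
  assumes "f \<in> borel_measurable lebesgue" "AE t in lebesgue. \<bar>f t\<bar> \<le> C"
  shows "Linf_norm f \<le> ereal C"
  unfolding Linf_norm_def using assms by (intro esssup_I) auto

lemma Linf_norm_continuous_leI:
  assumes "continuous_on UNIV f" "\<And>t. \<bar>f t\<bar> \<le> C"
  shows "Linf_norm f \<le> ereal C"
  using assms by (intro Linf_norm_leI measurable_completion borel_measurable_continuous_onI) (auto simp: borel_measurable_continuous_onI)

lemma periodic_attains_sup:
  fixes f :: "real \<Rightarrow> real"
  assumes f: "continuous_on UNIV f" and per: "\<And>t. f (t + 1) = f t"
  obtains \<alpha> where "\<And>t. f t \<le> f \<alpha>"
proof -
  obtain \<alpha> where \<alpha>: "\<alpha> \<in> {0..1}" "\<And>t. t \<in> {0..1} \<Longrightarrow> f t \<le> f \<alpha>"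
    using continuous_attains_sup[of "{0..1::real}" f] continuous_on_subset[OF f] by auto
  have "f t \<le> f \<alpha>" for t
  proof -
    have "f t = f (frac t + of_int \<lfloor>t\<rfloor> * 1)" by (simp add: frac_def)
    also have "\<dots> = f (frac t)" by (rule periodic_int[of f 1, OF per])
    also have "\<dots> \<le> f \<alpha>" by (intro \<alpha>(2)) (simp add: frac_lt_1 less_imp_le)
    finally show ?thesis .
  qed
  then show thesis using that by blast
qed

text \<open>The norm of \<open>x - d\<close> is \<open>M + \<bar>d - c\<bar>\<close>, where
  \<open>c\<close> is the midrange and \<open>M\<close> half the oscillation. So the minimiser is
  unique and the description in \<open>best_const\<close> denotes it. The last clause says that
  subtracting it never raises a uniform bound on \<open>x\<close>.\<close>

lemma best_const_periodic:
  fixes x :: "real \<Rightarrow> real"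
  assumes x: "continuous_on UNIV x" and per: "\<And>t. x (t + 1) = x t"
  obtains M \<alpha> \<beta> where "\<And>t. \<bar>x t - best_const x\<bar> \<le> M" "x \<alpha> - best_const x = M" "x \<beta> - best_const x = - M"
    "\<And>C. (\<And>t. \<bar>x t\<bar> \<le> C) \<Longrightarrow> M \<le> C"
proof -
  obtain \<alpha> where \<alpha>: "\<And>t. x t \<le> x \<alpha>" using periodic_attains_sup[OF x per] by blast
  obtain \<beta> where \<beta>: "\<And>t. - x t \<le> - x \<beta>"
    using periodic_attains_sup[of "\<lambda>t. - x t"] x per by (auto intro: continuous_on_minus)
  define c M where "c = (x \<alpha> + x \<beta>) / 2" and "M = (x \<alpha> - x \<beta>) / 2"
  have cM: "x \<alpha> = c + M" "x \<beta> = c - M" by (simp_all add: c_def M_def field_simps)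
  have norm: "Linf_norm (\<lambda>t. x t - d) = ereal (M + \<bar>d - c\<bar>)" for d
  proof (rule antisym)
    have cont: "continuous_on UNIV (\<lambda>t. x t - d)" using x by (intro continuous_intros)
    show "Linf_norm (\<lambda>t. x t - d) \<le> ereal (M + \<bar>d - c\<bar>)"
    proof (rule Linf_norm_continuous_leI[OF cont])
      show "\<bar>x t - d\<bar> \<le> M + \<bar>d - c\<bar>" for t
        using \<alpha>[of t] \<beta>[of t] cM by linarith
    qed
    show "ereal (M + \<bar>d - c\<bar>) \<le> Linf_norm (\<lambda>t. x t - d)"
    proof (rule ccontr)
      assume "\<not> ?thesis"
      then obtain C where C: "Linf_norm (\<lambda>t. x t - d) < ereal C" "ereal C < ereal (M + \<bar>d - c\<bar>)"
        using ereal_dense2 by (metis not_le)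
      then have "\<bar>x t - d\<bar> \<le> C" for t by (intro Linf_norm_pointwise[OF cont]) simp
      from this[of \<alpha>] this[of \<beta>] C(2) show False using cM by simp
    qed
  qed
  have inf: "(INF d. Linf_norm (\<lambda>t. x t - d)) = ereal M"
    unfolding norm by (rule antisym) (auto intro: INF_lower2[of c] INF_greatest)
  have bc: "best_const x = c"
    unfolding best_const_def norm inf[unfolded norm] by (rule the_equality) auto
  show thesis
  proof (rule that[of M \<alpha> \<beta>])
    show "\<bar>x t - best_const x\<bar> \<le> M" for t using \<alpha>[of t] \<beta>[of t] cM by (simp add: bc abs_le_iff)
    show "M \<le> C" if "\<And>t. \<bar>x t\<bar> \<le> C" for C using that[of \<alpha>] that[of \<beta>] cM by linarith
  qed (use cM in \<open>auto simp: bc\<close>)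
qed

text \<open>Off a null set the derivative is a limit of continuous difference quotients.
  Measurability matters because the essential supremum of a nonmeasurable function is
  infinite.\<close>

lemma deriv_borel_measurable:
  assumes lac: "locally_absolutely_continuous f" and f: "continuous_on UNIV f"
  shows "deriv f \<in> borel_measurable lebesgue"
proof -
  obtain \<phi> N where N: "negligible N" "\<And>x. x \<notin> N \<Longrightarrow> (f has_real_derivative \<phi> x) (at x)"
    using locally_absolutely_continuous_FTC[OF lac] by metis
  have lim: "(\<lambda>n. (f (t + inverse (real (Suc n))) - f t) / inverse (real (Suc n))) \<longlonglongrightarrow> deriv f t" if "t \<notin> N" for t
  proof -
    have "((\<lambda>h. (f (t + h) - f t) / h) \<longlongrightarrow> deriv f t) (at 0)"
      using N(2)[OF that] DERIV_imp_deriv[OF N(2)[OF that]] by (simp add: DERIV_def)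
    moreover have "filterlim (\<lambda>n. inverse (real (Suc n))) (at 0) sequentially"
      unfolding filterlim_at using LIMSEQ_inverse_real_of_nat by (auto simp del: of_nat_Suc)
    ultimately show ?thesis by (rule filterlim_compose)
  qed
  have "deriv f \<in> borel_measurable (lebesgue_on (UNIV - N))"
  proof (rule borel_measurable_LIMSEQ_real)
    show "(\<lambda>n. (f (t + inverse (real (Suc n))) - f t) / inverse (real (Suc n))) \<longlonglongrightarrow> deriv f t"
      if "t \<in> space (lebesgue_on (UNIV - N))" for t using lim that by simp
    show "(\<lambda>t. (f (t + inverse (real (Suc n))) - f t) / inverse (real (Suc n))) \<in> borel_measurable (lebesgue_on (UNIV - N))" for n
    proof (rule measurable_restrict_space1, rule measurable_completion)
      have "continuous_on UNIV (\<lambda>t. (f (t + inverse (real (Suc n))) - f t) / inverse (real (Suc n)))"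
        by (intro continuous_intros continuous_on_compose2[OF f]) auto
      then show "(\<lambda>t. (f (t + inverse (real (Suc n))) - f t) / inverse (real (Suc n))) \<in> borel_measurable lborel"
        by (simp add: borel_measurable_continuous_onI)
    qed
  qed
  moreover have "N \<in> null_sets (lebesgue_on UNIV)" using N(1) by (simp add: negligible_iff_null_sets lebesgue_on_UNIV_eq)
  ultimately have "deriv f \<in> borel_measurable (lebesgue_on UNIV)"
    using borel_measurable_diff_null[of N UNIV "deriv f"] by simp
  then show ?thesis by (simp add: lebesgue_on_UNIV_eq)
qed

lemma lipschitz_deriv_norm:
  assumes lip: "\<And>s t. \<bar>f t - f s\<bar> \<le> C * \<bar>t - s\<bar>" and "0 \<le> C"
  shows "Linf_norm (deriv f) \<le> ereal C"
proof -
  have lac: "locally_absolutely_continuous f" by (rule lipschitz_locally_absolutely_continuous[OF assms])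
  have cont: "continuous_on UNIV f" by (rule lipschitz_continuous[OF lip])
  obtain \<phi> N where N: "negligible N" "\<And>x. x \<notin> N \<Longrightarrow> (f has_real_derivative \<phi> x) (at x)"
    using locally_absolutely_continuous_FTC[OF lac] by metis
  have "\<bar>deriv f t\<bar> \<le> C" if "t \<notin> N" for t
  proof -
    have "((\<lambda>h. (f (t + h) - f t) / h) \<longlongrightarrow> deriv f t) (at 0)"
      using N(2)[OF that] DERIV_imp_deriv[OF N(2)[OF that]] by (simp add: DERIV_def)
    then have "((\<lambda>h. \<bar>(f (t + h) - f t) / h\<bar>) \<longlongrightarrow> \<bar>deriv f t\<bar>) (at 0)" by (rule tendsto_rabs)
    moreover have "\<forall>\<^sub>F h in at 0. \<bar>(f (t + h) - f t) / h\<bar> \<le> C"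
      using eventually_neq_at_within[of 0 0 UNIV]
    proof eventually_elim
      case (elim h)
      then show ?case using lip[of "t + h" t] by (simp add: abs_divide divide_le_eq)
    qed
    ultimately show ?thesis by (rule tendsto_upperbound) simp
  qed
  then have "AE t in lebesgue. \<bar>deriv f t\<bar> \<le> C"
    using N(1) unfolding eventually_ae_filter by (intro bexI[of _ N]) (auto simp: negligible_iff_null_sets)
  then show ?thesis by (intro Linf_norm_leI deriv_borel_measurable[OF lac cont])
qed

text \<open>Since \<open>psi r\<close> has period \<open>2 * half_period a1 a2\<close>, the factor
  \<rho> is the dilation that brings the period to \<open>lam\<close>.\<close>

lemma Psi_eq:
  assumes "0 \<le> a1" "0 \<le> a2" "0 < lam"
  defines "\<rho> \<equiv> lam / (2 * half_period a1 a2)"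
  shows "Psi r a1 a2 b lam t = b * \<rho> ^ r * psi r a1 a2 (t / \<rho>)"
  using assms by (simp add: Psi_def \<rho>_def half_period_def field_simps)

lemma deriv_Psi:
  assumes a: "0 \<le> a1" "0 \<le> a2" and lam: "0 < lam" and "k < r"
  defines "\<rho> \<equiv> lam / (2 * half_period a1 a2)"
  shows "(deriv ^^ k) (Psi r a1 a2 b lam) = (\<lambda>t. b * \<rho> ^ (r - k) * psi (r - k) a1 a2 (t / \<rho>))"
  using \<open>k < r\<close>
proof (induction k)
  case 0
  then show ?case using Psi_eq[OF a lam] by (simp add: \<rho>_def fun_eq_iff)
next
  case (Suc k)
  have \<rho>: "0 < \<rho>" using half_period_pos[OF a] lam by (simp add: \<rho>_def)
  obtain j where j: "r - Suc k = j" "1 \<le> j" using Suc.prems by simp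
  then have rk: "r - k = Suc j" using Suc.prems by simp
  have "((\<lambda>t. b * \<rho> ^ Suc j * psi (Suc j) a1 a2 (t / \<rho>)) has_real_derivative
      b * \<rho> ^ Suc j * (psi j a1 a2 (t / \<rho>) * (1 / \<rho>))) (at t)" for t
    using \<rho> by (intro DERIV_cmult DERIV_chain2[OF psi_DERIV[OF a j(2)]]) (auto intro!: derivative_eq_intros)
  from DERIV_imp_deriv[OF this]
  have "deriv (\<lambda>t. b * \<rho> ^ Suc j * psi (Suc j) a1 a2 (t / \<rho>)) t = b * \<rho> ^ j * psi j a1 a2 (t / \<rho>)" for t
    using \<rho> by simp
  moreover have IH: "(deriv ^^ k) (Psi r a1 a2 b lam) = (\<lambda>t. b * \<rho> ^ Suc j * psi (Suc j) a1 a2 (t / \<rho>))"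
    using Suc rk by simp
  ultimately show ?case unfolding j(1) funpow.simps comp_def IH by (intro ext)
qed

text \<open>An upper estimate is enough, as the norms of the derivatives of \<open>Psi\<close> stand
  on the larger side of the assumptions.\<close>

lemma Linf_norm_deriv_Psi:
  assumes a: "0 \<le> a1" "0 \<le> a2" and lam: "0 < lam" and "k < r"
  defines "\<rho> \<equiv> lam / (2 * half_period a1 a2)"
  shows "Linf_norm ((deriv ^^ k) (Psi r a1 a2 b lam)) \<le> ereal (\<bar>b\<bar> * \<rho> ^ (r - k) * qwave a1 a2 (r - k) 0)"
proof -
  have \<rho>: "0 < \<rho>" using half_period_pos[OF a] lam by (simp add: \<rho>_def)
  have rk: "1 \<le> r - k" using \<open>k < r\<close> by simp
  have c: "continuous_on UNIV (psi (r - k) a1 a2)"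
    using psi_isCont[OF a rk] by (intro continuous_at_imp_continuous_on) auto
  show ?thesis unfolding deriv_Psi[OF a lam \<open>k < r\<close>, folded \<rho>_def]
  proof (rule Linf_norm_continuous_leI)
    show "continuous_on UNIV (\<lambda>t. b * \<rho> ^ (r - k) * psi (r - k) a1 a2 (t / \<rho>))"
      using \<rho> by (intro continuous_intros continuous_on_compose2[OF c]) auto
    show "\<bar>b * \<rho> ^ (r - k) * psi (r - k) a1 a2 (t / \<rho>)\<bar> \<le> \<bar>b\<bar> * \<rho> ^ (r - k) * qwave a1 a2 (r - k) 0" for t
      using \<rho> psi_bound[OF a rk, of "t / \<rho>"] by (simp add: abs_mult mult_left_mono)
  qed
qed

lemma Linf_norm_top_deriv_Psi:
  assumes a: "0 \<le> a1" "0 \<le> a2" and lam: "0 < lam" and r: "1 \<le> r"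
  shows "Linf_norm ((deriv ^^ r) (Psi r a1 a2 b lam)) \<le> ereal \<bar>b\<bar>"
proof -
  define \<rho> where "\<rho> = lam / (2 * half_period a1 a2)"
  have \<rho>: "0 < \<rho>" using half_period_pos[OF a] lam by (simp add: \<rho>_def)
  have eq1: "(deriv ^^ r) (Psi r a1 a2 b lam) = deriv ((deriv ^^ (r - 1)) (Psi r a1 a2 b lam))"
    using r by (cases r) auto
  have eq2: "(deriv ^^ (r - 1)) (Psi r a1 a2 b lam) = (\<lambda>t. b * \<rho> * psi1 a1 a2 (t / \<rho>))"
    using deriv_Psi[OF a lam, of "r - 1" r b] r by (simp add: \<rho>_def)
  have "Linf_norm (deriv (\<lambda>t. b * \<rho> * psi1 a1 a2 (t / \<rho>))) \<le> ereal \<bar>b\<bar>"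
  proof (rule lipschitz_deriv_norm)
    fix s t
    have "\<bar>b * \<rho> * psi1 a1 a2 (t / \<rho>) - b * \<rho> * psi1 a1 a2 (s / \<rho>)\<bar>
      = \<bar>b\<bar> * \<rho> * \<bar>psi1 a1 a2 (t / \<rho>) - psi1 a1 a2 (s / \<rho>)\<bar>"
      using \<rho> by (simp flip: right_diff_distrib add: abs_mult)
    also have "\<dots> \<le> \<bar>b\<bar> * \<rho> * \<bar>t / \<rho> - s / \<rho>\<bar>"
      using \<rho> psi1_lipschitz[OF a] by (intro mult_left_mono) auto
    also have "\<bar>t / \<rho> - s / \<rho>\<bar> = \<bar>t - s\<bar> / \<rho>" using \<rho> by (simp flip: diff_divide_distrib)
    finally show "\<bar>b * \<rho> * psi1 a1 a2 (t / \<rho>) - b * \<rho> * psi1 a1 a2 (s / \<rho>)\<bar> \<le> \<bar>b\<bar> * \<bar>t - s\<bar>"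
      using \<rho> by simp
  qed simp
  then show ?thesis unfolding eq1 eq2 .
qed

subsection \<open>Scaled waves and the tower of derivatives\<close>

text \<open>The index counts integrations starting from the trapezoid, so \<open>n\<close> belongs
  to the derivative of order \<open>r - n\<close>. When \<rho> varies, \<open>B\<close> stays fixed,
  and with it the slope bound of order \<open>r\<close>.\<close>

definition wave :: "real \<Rightarrow> real \<Rightarrow> real \<Rightarrow> real \<Rightarrow> nat \<Rightarrow> real \<Rightarrow> real" where
  "wave a1 a2 B \<rho> n s = B * \<rho> ^ n * qwave a1 a2 n (s / \<rho>)"

lemma wave_zero: "wave a1 a2 B \<rho> n 0 = B * \<rho> ^ n * qwave a1 a2 n 0"
  by (simp add: wave_def)

locale scaled_wave =
  fixes a1 a2 B \<rho> :: real
  assumes a: "0 \<le> a1" "0 \<le> a2" and B: "0 < B" and \<rho>: "0 < \<rho>"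
begin

abbreviation W where "W \<equiv> wave a1 a2 B \<rho>"
abbreviation Q where "Q \<equiv> \<rho> * half_period a1 a2 / 2"

lemma Q_pos: "0 < Q" using half_period_pos[OF a] \<rho> by simp

lemma W_DERIV:
  assumes "1 \<le> n"
  shows "(W (Suc n) has_real_derivative - W n (Q - s)) (at s)"
proof -
  have "((\<lambda>s. B * \<rho> ^ Suc n * qwave a1 a2 (Suc n) (s / \<rho>)) has_real_derivative
      B * \<rho> ^ Suc n * (- qwave a1 a2 n (half_period a1 a2 / 2 - s / \<rho>) * (1 / \<rho>))) (at s)"
    using \<rho> by (intro DERIV_cmult DERIV_chain2[OF qwave_DERIV[OF a assms]]) (auto intro!: derivative_eq_intros)
  moreover have "(Q - s) / \<rho> = half_period a1 a2 / 2 - s / \<rho>" using \<rho> by (simp add: field_simps)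
  ultimately show ?thesis using \<rho> unfolding wave_def by (simp add: mult.assoc)
qed

lemma W_cont: "1 \<le> n \<Longrightarrow> isCont (W n) s"
  unfolding wave_def qwave_def[OF a]
  using \<rho> by (intro continuous_intros isCont_o2[OF _ psi_isCont[OF a]]) auto

lemma rescale_le: "\<rho> * x \<le> s \<longleftrightarrow> x \<le> s / \<rho>" "s \<le> \<rho> * x \<longleftrightarrow> s / \<rho> \<le> x"
  using \<rho> by (auto simp: field_simps)

lemma W_decreasing:
  assumes "1 \<le> n" "\<rho> * plateau a1 a2 n \<le> s" "s < s'" "s' \<le> \<rho> * foot a1 a2 n"
  shows "W n s' < W n s"
proof -
  have "qwave a1 a2 n (s' / \<rho>) < qwave a1 a2 n (s / \<rho>)"
    using assms \<rho> by (intro qwave_decreasing[OF a assms(1)]) (auto simp: rescale_le divide_strict_right_mono)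
  then show ?thesis using B \<rho> by (simp add: wave_def)
qed

lemma W_flat:
  assumes "1 \<le> n" "0 \<le> s" "s \<le> \<rho> * plateau a1 a2 n"
  shows "W n s = W n 0"
  using qwave_plateau[OF a assms(1), of "s / \<rho>"] assms \<rho> by (simp add: wave_def rescale_le)

lemma W_nonneg: "1 \<le> n \<Longrightarrow> 0 \<le> s \<Longrightarrow> s \<le> Q \<Longrightarrow> 0 \<le> W n s"
  using qwave_peak(1)[OF a, of n "s / \<rho>"] B \<rho> by (simp add: wave_def field_simps)

lemma W_Q: "1 \<le> n \<Longrightarrow> W n Q = 0"
  using qwave_zero[OF a] \<rho> by (simp add: wave_def)

lemma W_one: "0 \<le> s \<Longrightarrow> s \<le> Q \<Longrightarrow> W 1 s = B * \<rho> * max 0 (min 1 (1 + a2 / 2 - s / \<rho>))"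
  using qwave_one[OF a, of "s / \<rho>"] \<rho> by (simp add: wave_def field_simps)

text \<open>Beyond its flat top the trapezoid falls at the constant rate \<open>B\<close>, the
  fastest possible for \<open>f\<close>. On the flat top the bound makes the premise impossible, and
  for \<open>a2 = 0\<close> there is no flat top.\<close>

lemma comparison_one:
  assumes lip: "\<And>s t. \<bar>f t - f s\<bar> \<le> B * \<bar>t - s\<bar>" and bound: "a2 = 0 \<or> (\<forall>t. \<bar>f t\<bar> \<le> W 1 0)"
  shows "comparison (\<rho> * foot a1 a2 1) (W 1) f"
proof -
  have lQ: "\<rho> * foot a1 a2 1 \<le> Q" using plateau_foot(3)[OF a, of 1] \<rho> by (simp add: field_simps)
  have foot1: "\<rho> * foot a1 a2 1 = \<rho> + \<rho> * a2 / 2" by (simp add: foot_def[OF a] algebra_simps)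
  have edge: "W 1 s = B * (\<rho> + \<rho> * a2 / 2 - s)" if "\<rho> * a2 / 2 \<le> s" "s \<le> \<rho> * foot a1 a2 1" for s
  proof -
    have "0 \<le> s" using that(1) a \<rho> by (meson mult_nonneg_nonneg divide_nonneg_nonneg order_trans less_imp_le zero_le_numeral)
    have "a2 / 2 \<le> s / \<rho>" "s / \<rho> \<le> 1 + a2 / 2" using that \<rho> unfolding foot1 by (auto simp: field_simps)
    then have "W 1 s = B * \<rho> * (1 + a2 / 2 - s / \<rho>)"
      using W_one[OF \<open>0 \<le> s\<close>] that lQ by simp
    also have "\<dots> = B * (\<rho> + \<rho> * a2 / 2 - s)" using \<rho> by (simp add: field_simps)
    finally show ?thesis .
  qed
  show ?thesis unfolding comparison_def
  proof (intro ballI)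
    fix \<alpha> \<beta> :: real assume ab: "\<alpha> \<in> {1,-1}" "\<beta> \<in> {1,-1}"
    define g where "g = (\<lambda>t. \<alpha> * f (\<beta> * t))"
    have glip: "\<bar>g t - g s\<bar> \<le> B * \<bar>t - s\<bar>" for s t
      using ab lip[of t s] lip[of "-t" "-s"] by (auto simp: g_def abs_minus_commute)
    have gbound: "a2 = 0 \<or> (\<forall>t. g t \<le> W 1 0)" using bound ab by (auto simp: g_def abs_le_iff)
    have "falls_slower (\<rho> * foot a1 a2 1) (W 1) g"
      unfolding falls_slower_def
    proof (intro allI impI)
      fix t s w assume s: "0 \<le> s" "0 \<le> w" "s + w \<le> \<rho> * foot a1 a2 1" "W 1 s < g t"
      have "\<rho> * a2 / 2 \<le> s"
      proof (rule ccontr)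
        assume c: "\<not> \<rho> * a2 / 2 \<le> s"
        then have "a2 \<noteq> 0" using s by auto
        then have "g t \<le> W 1 0" using gbound by blast
        moreover have "W 1 s = W 1 0" using c s(1) by (intro W_flat) (auto simp: plateau_def[OF a])
        ultimately show False using s(4) by simp
      qed
      then have "W 1 s = B * (\<rho> + \<rho> * a2 / 2 - s)" "W 1 (s + w) = B * (\<rho> + \<rho> * a2 / 2 - s) - B * w"
        using edge[of s] edge[of "s + w"] s by (auto simp: algebra_simps)
      moreover have "g t - B * w \<le> g (t + w)" using glip[of "t + w" t] s(2) by (simp add: abs_le_iff)
      ultimately show "W 1 (s + w) < g (t + w)" using s(4) by linarith
    qed
    then show "falls_slower (\<rho> * foot a1 a2 1) (W 1) (\<lambda>t. \<alpha> * f (\<beta> * t))" by (simp add: g_def)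
  qed
qed

lemma comparison_Suc:
  assumes n: "1 \<le> n" and cmp: "comparison (\<rho> * foot a1 a2 n) (W n) f"
    and F: "\<And>t. (F has_real_derivative f t) (at t)" and bound: "\<And>t. \<bar>F t\<bar> \<le> W (Suc n) 0"
  shows "comparison (\<rho> * foot a1 a2 (Suc n)) (W (Suc n)) F"
proof -
  have Qf: "\<rho> * foot a1 a2 (Suc n) = Q" using n by (simp add: foot_def[OF a])
  show ?thesis unfolding Qf
  proof (rule comparison_antiderivative[OF cmp F W_DERIV[OF n] bound])
    fix s assume s: "0 \<le> s" "s \<le> Q - \<rho> * foot a1 a2 n"
    have "Q - \<rho> * foot a1 a2 n = \<rho> * plateau a1 a2 (Suc n)"
      unfolding foot_plateau[OF a n, symmetric] by (simp add: algebra_simps)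
    then show "W (Suc n) s = W (Suc n) 0" using s by (intro W_flat) auto
  next
    show "\<rho> * foot a1 a2 n \<le> Q" using plateau_foot(3)[OF a, of n] \<rho> by (simp add: field_simps)
  qed
qed

text \<open>\<open>2 \<le> n\<close> puts the foot at the end of the quarter and the vanishing
  plateau makes the wave fall strictly from its maximum, as \<open>comparison_peak_abs\<close>
  requires.\<close>

lemma peak_Suc:
  assumes n: "2 \<le> n" "plateau a1 a2 n = 0" and cmp: "comparison (\<rho> * foot a1 a2 n) (W n) f"
    and F: "\<And>t. (F has_real_derivative f t) (at t)" and peak: "W n 0 \<le> \<bar>f t\<bar>"
  shows "\<exists>t. W (Suc n) 0 \<le> \<bar>F t\<bar>"
proof -
  have n1: "1 \<le> n" using n by simp
  have Qf: "\<rho> * foot a1 a2 n = Q" using n by (simp add: foot_def[OF a])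
  show ?thesis
    by (rule comparison_peak_abs[OF cmp[unfolded Qf] W_cont[OF n1] _ Q_pos F W_DERIV[OF n1] W_Q peak])
      (use W_decreasing[OF n1] n Qf in auto)
qed

text \<open>The hypothesis on \<open>foot\<close> excludes only the trapezoid with
  \<open>a1 > 0\<close>, which reaches zero before the end of its quarter.\<close>

lemma quarter_wave_Psi:
  assumes n: "1 \<le> n" and foot: "foot a1 a2 n = half_period a1 a2 / 2" and b: "\<bar>b\<bar> = B"
  shows "quarter_wave (Psi n a1 a2 b (4 * Q)) (W n) (\<rho> * centre a1 a2 n) Q (\<rho> * plateau a1 a2 n)"
proof
  have eq: "Psi n a1 a2 b (4 * Q) t = b * \<rho> ^ n * psi n a1 a2 (t / \<rho>)" for t
    using Psi_eq[OF a, of "4 * Q" n b t] Q_pos half_period_pos[OF a] by simp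
  have absG: "\<bar>Psi n a1 a2 b (4 * Q) t\<bar> = B * \<rho> ^ n * \<bar>psi n a1 a2 (t / \<rho>)\<bar>" for t
    unfolding eq using b \<rho> by (simp add: abs_mult)
  have c: "continuous_on UNIV (psi n a1 a2)"
    using psi_isCont[OF a n] by (intro continuous_at_imp_continuous_on) auto
  show "continuous_on UNIV (Psi n a1 a2 b (4 * Q))"
    unfolding eq[abs_def] using \<rho> by (intro continuous_intros continuous_on_compose2[OF c]) auto
  show "\<bar>Psi n a1 a2 b (4 * Q) (t + 2 * Q)\<bar> = \<bar>Psi n a1 a2 b (4 * Q) t\<bar>" for t
  proof -
    have "(t + 2 * Q) / \<rho> = t / \<rho> + half_period a1 a2" using \<rho> by (simp add: field_simps)
    then show ?thesis unfolding absG using antiperiodicD[OF psi_antiperiodic[OF a n], of "t / \<rho>"] by simp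
  qed
  show "\<bar>Psi n a1 a2 b (4 * Q) (\<rho> * centre a1 a2 n - s)\<bar> = \<bar>Psi n a1 a2 b (4 * Q) (\<rho> * centre a1 a2 n + s)\<bar>" for s
  proof -
    have "(\<rho> * centre a1 a2 n - s) / \<rho> = centre a1 a2 n - s / \<rho>" "(\<rho> * centre a1 a2 n + s) / \<rho> = centre a1 a2 n + s / \<rho>"
      using \<rho> by (auto simp: field_simps)
    then show ?thesis unfolding absG using psi_even[OF a n, of "s / \<rho>"] by simp
  qed
  show "\<bar>Psi n a1 a2 b (4 * Q) (\<rho> * centre a1 a2 n + s)\<bar> = W n s" if "0 \<le> s" "s \<le> Q" for s
  proof -
    have "(\<rho> * centre a1 a2 n + s) / \<rho> = centre a1 a2 n + s / \<rho>" using \<rho> by (simp add: field_simps)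
    moreover have "0 \<le> qwave a1 a2 n (s / \<rho>)"
      using qwave_peak(1)[OF a n, of "s / \<rho>"] that \<rho> by (simp add: field_simps)
    ultimately show ?thesis unfolding absG wave_def by (simp add: qwave_def[OF a])
  qed
  show "isCont (W n) s" for s by (rule W_cont[OF n])
  show "W n s' < W n s" if "\<rho> * plateau a1 a2 n \<le> s" "s < s'" "s' \<le> Q" for s s'
  proof (rule W_decreasing[OF n that(1,2)])
    have "\<rho> * foot a1 a2 n = Q" using foot by simp
    then show "s' \<le> \<rho> * foot a1 a2 n" using that(3) by (simp only:)
  qed
  show "W n s = W n 0" if "0 \<le> s" "s \<le> \<rho> * plateau a1 a2 n" for s by (rule W_flat[OF n that])
  show "W n Q = 0" by (rule W_Q[OF n])
  show "0 \<le> \<rho> * plateau a1 a2 n" using plateau_foot(1)[OF a] \<rho> by simp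
  show "\<rho> * plateau a1 a2 n < Q"
    using plateau_foot(2)[OF a, of n] foot \<rho> mult_strict_left_mono[of "plateau a1 a2 n" "half_period a1 a2 / 2" \<rho>] by simp
qed

end

text \<open>\<open>z j\<close> stands for the derivative of order \<open>r - j\<close>: the
  comparison climbs from the Lipschitz function \<open>z 1\<close> to \<open>z r\<close>, the
  function itself.\<close>

locale derivative_tower =
  fixes a1 a2 B :: real and r :: nat and z :: "nat \<Rightarrow> real \<Rightarrow> real"
  assumes a: "0 \<le> a1" "0 \<le> a2" and B: "0 < B"
    and lip: "\<And>s t. \<bar>z 1 t - z 1 s\<bar> \<le> B * \<bar>t - s\<bar>"
    and der: "\<And>j t. 1 \<le> j \<Longrightarrow> j < r \<Longrightarrow> (z (Suc j) has_real_derivative z j t) (at t)"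
    and cont: "\<And>j. 1 \<le> j \<Longrightarrow> j \<le> r \<Longrightarrow> continuous_on UNIV (z j)"
    and per: "\<And>j t. 1 \<le> j \<Longrightarrow> j \<le> r \<Longrightarrow> z j (t + 1) = z j t"
begin

abbreviation W where "W \<equiv> wave a1 a2 B"

lemma comparison_all:
  assumes \<rho>: "0 < \<rho>" and b1: "a2 = 0 \<or> (\<forall>t. \<bar>z 1 t\<bar> \<le> W \<rho> 1 0)"
    and bounds: "\<And>j t. 2 \<le> j \<Longrightarrow> j \<le> r \<Longrightarrow> \<bar>z j t\<bar> \<le> W \<rho> j 0"
    and j: "1 \<le> j" "j \<le> r"
  shows "comparison (\<rho> * foot a1 a2 j) (W \<rho> j) (z j)"
proof -
  interpret w: scaled_wave a1 a2 B \<rho> using a B \<rho> by unfold_locales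
  show ?thesis using j
  proof (induction j rule: dec_induct)
    case base
    show ?case by (rule w.comparison_one[OF lip b1])
  next
    case (step n)
    then show ?case using der[of n] bounds[of "Suc n"] by (intro w.comparison_Suc) auto
  qed
qed

text \<open>The hypothesis \<open>a1 = 0 \<or> 3 \<le> j\<close> keeps the start away from the flat
  maximum of level 2; higher levels have none.\<close>

lemma peak_propagates:
  assumes \<rho>: "0 < \<rho>" and b1: "a2 = 0 \<or> (\<forall>t. \<bar>z 1 t\<bar> \<le> W \<rho> 1 0)"
    and bounds: "\<And>j t. 2 \<le> j \<Longrightarrow> j \<le> r \<Longrightarrow> \<bar>z j t\<bar> \<le> W \<rho> j 0"
    and j: "2 \<le> j" "j \<le> r" and pl: "a1 = 0 \<or> 3 \<le> j" and peak: "\<exists>t. W \<rho> j 0 \<le> \<bar>z j t\<bar>"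
  shows "\<exists>t. W \<rho> r 0 \<le> \<bar>z r t\<bar>"
proof -
  interpret w: scaled_wave a1 a2 B \<rho> using a B \<rho> by unfold_locales
  have "n \<le> r \<Longrightarrow> \<exists>t. W \<rho> n 0 \<le> \<bar>z n t\<bar>" if "j \<le> n" for n using that
  proof (induction n rule: dec_induct)
    case base
    then show ?case using peak by blast
  next
    case (step n)
    then obtain t where t: "W \<rho> n 0 \<le> \<bar>z n t\<bar>" by auto
    show ?case
    proof (rule w.peak_Suc[where f = "z n" and t = t])
      show "2 \<le> n" using step j by simp
      show "W \<rho> n 0 \<le> \<bar>z n t\<bar>" by (rule t)
      show "plateau a1 a2 n = 0" using step pl j by (auto simp: plateau_def[OF a])
      show "comparison (\<rho> * foot a1 a2 n) (W \<rho> n) (z n)"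
        using comparison_all[OF \<rho> b1 bounds, of n] step j by simp
      show "(z (Suc n) has_real_derivative z n t) (at t)" for t using der[of n] step j by simp
    qed
  qed
  then show ?thesis using j by blast
qed

lemma attained: "1 \<le> j \<Longrightarrow> j \<le> r \<Longrightarrow> \<exists>\<tau>. \<forall>t. \<bar>z j t\<bar> \<le> \<bar>z j \<tau>\<bar>"
  using periodic_attains_sup[of "\<lambda>t. \<bar>z j t\<bar>"] cont[of j] per[of j]
  by (metis continuous_on_rabs)

text \<open>If the bound on some level fails at \<open>\<rho>0\<close>, stretch the wave until all bounds hold and one is attained.\<close>
lemma stretch:
  assumes \<rho>0: "0 < \<rho>0" and J: "J \<subseteq> {2..r}"
  obtains "\<And>j t. j \<in> J \<Longrightarrow> \<bar>z j t\<bar> \<le> W \<rho>0 j 0"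
  | \<rho> j where "\<rho>0 < \<rho>" "\<And>j t. j \<in> J \<Longrightarrow> \<bar>z j t\<bar> \<le> W \<rho> j 0" "j \<in> J" "\<exists>t. W \<rho> j 0 \<le> \<bar>z j t\<bar>"
proof -
  have finJ: "finite J" using J finite_subset by blast
  have "\<forall>j\<in>J. \<exists>\<tau>. \<forall>t. \<bar>z j t\<bar> \<le> \<bar>z j \<tau>\<bar>" using J attained by force
  then obtain \<tau> where \<tau>: "\<And>j t. j \<in> J \<Longrightarrow> \<bar>z j t\<bar> \<le> \<bar>z j (\<tau> j)\<bar>" by metis
  \<comment> \<open>The peak of the wave is proportional to \<open>\<rho> ^ j\<close>, so
    \<open>R j\<close> is the threshold for \<rho> above which the bound of level \<open>j\<close>
    holds, with equality at the threshold.\<close>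
  define R where "R = (\<lambda>j. root j (\<bar>z j (\<tau> j)\<bar> / (B * qwave a1 a2 j 0)))"
  have R: "\<bar>z j (\<tau> j)\<bar> \<le> W \<rho> j 0 \<longleftrightarrow> R j \<le> \<rho>" "\<bar>z j (\<tau> j)\<bar> = W \<rho> j 0 \<longleftrightarrow> R j = \<rho>" if "j \<in> J" "0 < \<rho>" for j \<rho>
  proof -
    have j: "0 < j" "1 \<le> j" using that J by auto
    have q: "0 < B * qwave a1 a2 j 0" using B qwave_peak(3)[OF a j(2), of 0] half_period_pos[OF a] by simp
    have Rpow: "R j ^ j = \<bar>z j (\<tau> j)\<bar> / (B * qwave a1 a2 j 0)" and R0: "0 \<le> R j"
      using j q by (auto simp: R_def real_root_pow_pos2)
    have zq: "\<bar>z j (\<tau> j)\<bar> = R j ^ j * (B * qwave a1 a2 j 0)" 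
    proof -
      have "x = x / c * c" if "0 < c" for x c :: real using that by simp
      from this[OF q] show ?thesis unfolding Rpow .
    qed
    have Wq: "W \<rho> j 0 = \<rho> ^ j * (B * qwave a1 a2 j 0)" by (simp add: wave_zero)
    have "\<bar>z j (\<tau> j)\<bar> \<le> W \<rho> j 0 \<longleftrightarrow> R j ^ j \<le> \<rho> ^ j"
      unfolding zq Wq using q by (rule mult_le_cancel_right_pos)
    then show "\<bar>z j (\<tau> j)\<bar> \<le> W \<rho> j 0 \<longleftrightarrow> R j \<le> \<rho>"
      using R0 that(2) j by (simp add: power_mono_iff)
    have "\<bar>z j (\<tau> j)\<bar> = W \<rho> j 0 \<longleftrightarrow> R j ^ j = \<rho> ^ j"
      unfolding zq Wq by (rule mult_right_cancel[OF less_imp_neq[OF q, symmetric]])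
    then show "\<bar>z j (\<tau> j)\<bar> = W \<rho> j 0 \<longleftrightarrow> R j = \<rho>"
      using R0 that(2) j by (simp add: power_eq_iff_eq_base)
  qed
  define \<rho> where "\<rho> = Max (insert \<rho>0 (R ` J))"
  have \<rho>_ge: "\<rho>0 \<le> \<rho>" "\<And>j. j \<in> J \<Longrightarrow> R j \<le> \<rho>" unfolding \<rho>_def using finJ by auto
  have \<rho>_in: "\<rho> \<in> insert \<rho>0 (R ` J)" unfolding \<rho>_def using finJ by (intro Max_in) auto
  have b: "\<bar>z j t\<bar> \<le> W \<rho> j 0" if "j \<in> J" for j t
    using \<tau>[OF that, of t] R(1)[OF that, of \<rho>] \<rho>_ge \<rho>0 that by force
  show thesis
  proof (cases "\<rho> = \<rho>0")
    case True
    then show thesis using that(1) b by blast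
  next
    case False
    then obtain j where j: "j \<in> J" "R j = \<rho>" using \<rho>_in by auto
    then have "W \<rho> j 0 \<le> \<bar>z j (\<tau> j)\<bar>" using R(2)[of j \<rho>] \<rho>0 \<rho>_ge by simp
    then show thesis using that(2)[of \<rho> j] b j False \<rho>_ge by fastforce
  qed
qed

end

lemma deriv_periodic:
  fixes f :: "real \<Rightarrow> real"
  assumes "\<And>t. f (t + 1) = f t"
  shows "deriv f (t + 1) = deriv f t"
proof -
  have "(f has_field_derivative D) (at (t + 1)) \<longleftrightarrow> (f has_field_derivative D) (at t)" for D
    using DERIV_shift[of f D t 1] assms by simp
  then show ?thesis by (simp add: deriv_def)
qed

lemma deriv_funpow_periodic:
  fixes f :: "real \<Rightarrow> real"
  assumes "\<And>t. f (t + 1) = f t"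
  shows "(deriv ^^ k) f (t + 1) = (deriv ^^ k) f t"
  by (induction k arbitrary: t) (simp_all add: assms deriv_periodic)

text \<open>The constant is subtracted at level \<open>r\<close> only, and differentiation removes
  it. Level 1 need not be differentiable everywhere; its continuity comes from the Lipschitz
  bound.\<close>

lemma Lr_inf_tower:
  fixes c :: real
  assumes r: "1 \<le> r" and x: "x \<in> Lr_inf r" and per: "\<And>t. x (t + 1) = x t"
    and top: "Linf_norm ((deriv ^^ r) x) \<le> ereal B" and a: "0 \<le> a1" "0 \<le> a2" and B: "0 < B"
  defines "z \<equiv> \<lambda>j t. (deriv ^^ (r - j)) x t - (if j = r then c else 0)"
  shows "derivative_tower a1 a2 B r z"
proof -
  have lip0: "\<bar>(deriv ^^ (r - 1)) x t - (deriv ^^ (r - 1)) x s\<bar> \<le> B * \<bar>t - s\<bar>" for s t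
  proof (rule locally_absolutely_continuous_lipschitz)
    show "locally_absolutely_continuous ((deriv ^^ (r - 1)) x)" using x by (simp add: Lr_inf_def)
    have "(deriv ^^ r) x = deriv ((deriv ^^ (r - 1)) x)" using r by (cases r) auto
    then show "AE t in lebesgue. \<bar>deriv ((deriv ^^ (r - 1)) x) t\<bar> \<le> B"
      using Linf_norm_AE[OF top] by simp
  qed
  have lip: "\<bar>z 1 t - z 1 s\<bar> \<le> B * \<bar>t - s\<bar>" for s t using lip0 by (simp add: z_def)
  have der: "(z (Suc j) has_real_derivative z j t) (at t)" if j: "1 \<le> j" "j < r" for j t
  proof -
    have k: "r - Suc j < r - 1" "r - j = Suc (r - Suc j)" using j by auto
    then have "(deriv ^^ (r - Suc j)) x differentiable at t" using x by (simp add: Lr_inf_def)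
    then have "((deriv ^^ (r - Suc j)) x has_real_derivative deriv ((deriv ^^ (r - Suc j)) x) t) (at t)"
      by (simp add: DERIV_deriv_iff_real_differentiable)
    then have "((deriv ^^ (r - Suc j)) x has_real_derivative (deriv ^^ (r - j)) x t) (at t)" by (simp add: k(2))
    from DERIV_diff[OF this DERIV_const[of "if Suc j = r then c else 0"]]
    show ?thesis using j unfolding z_def by simp
  qed
  have cont: "continuous_on UNIV (z j)" if "1 \<le> j" "j \<le> r" for j
  proof (cases "j = 1")
    case True
    then show ?thesis using lipschitz_continuous[OF lip] by simp
  next
    case False
    then obtain i where i: "j = Suc i" "1 \<le> i" "i < r" using \<open>1 \<le> j\<close> \<open>j \<le> r\<close> by (cases j) auto
    then show ?thesis using der[OF i(2,3)]
      by (intro continuous_at_imp_continuous_on) (auto intro: DERIV_isCont)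
  qed
  have "z j (t + 1) = z j t" for j t unfolding z_def using deriv_funpow_periodic[of x, OF per] by simp
  then show ?thesis by unfold_locales (use lip der cont a B in auto)
qed

text \<open>Dilating the argument raises a falling wave, so the gain from the factor
  \<open>\<rho> ^ n\<close> survives in full. It is this definite factor that a larger period is
  charged with later.\<close>

lemma (in scaled_wave) W_scale_le:
  assumes n: "1 \<le> n" and r: "\<rho> \<le> \<rho>'" and s: "0 \<le> s" "s \<le> Q"
  shows "(\<rho>' / \<rho>) ^ n * W n s \<le> wave a1 a2 B \<rho>' n s"
proof -
  have "qwave a1 a2 n (s / \<rho>) \<le> qwave a1 a2 n (s / \<rho>')"
    using s r \<rho> by (intro qwave_antimono[OF a n]) (auto simp: field_simps mult_right_mono)
  then have "B * \<rho>' ^ n * qwave a1 a2 n (s / \<rho>) \<le> B * \<rho>' ^ n * qwave a1 a2 n (s / \<rho>')"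
    using B \<rho> r by (intro mult_left_mono) auto
  then show ?thesis using \<rho> by (simp add: wave_def power_divide ac_simps)
qed

theorem theorem6:
  fixes r :: nat and x :: "real \<Rightarrow> real" and p q lam a1 a2 b :: real
  assumes "r \<ge> 1"
    and "x \<in> Lr_inf_inf r"
    and "\<forall>t. x (t + 1) = x t"
    and "0 < p" and "p < q"
    and "lam > 0"
    and "(a1 = 0 \<and> a2 \<ge> 0 \<and> b \<noteq> 0 \<and>
            (\<forall>k\<in>{r - 1, r}. Linf_norm ((deriv ^^ k) x) \<le> Linf_norm ((deriv ^^ k) (Psi r a1 a2 b lam)))) \<or>
         (r \<ge> 2 \<and> a1 \<ge> 0 \<and> a2 = 0 \<and> b \<noteq> 0 \<and>
            (\<forall>k\<in>{r - 2, r}. Linf_norm ((deriv ^^ k) x) \<le> Linf_norm ((deriv ^^ k) (Psi r a1 a2 b lam)))) \<or>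
         (r \<ge> 2 \<and> a1 \<ge> 0 \<and> a2 \<ge> 0 \<and> b \<noteq> 0 \<and>
            (\<forall>k\<in>{r - 2, r - 1, r}. Linf_norm ((deriv ^^ k) x) \<le> Linf_norm ((deriv ^^ k) (Psi r a1 a2 b lam))))"
    and "Lp_norm p 0 lam (Psi r a1 a2 b lam) = Lp_norm p 0 1 (\<lambda>t. x t - best_const x)"
  shows "Lp_norm q 0 lam (Psi r a1 a2 b lam) \<ge> Lp_norm q 0 1 (\<lambda>t. x t - best_const x)"
proof -
  note r = \<open>r \<ge> 1\<close> and cases = assms(7) and norm_eq = assms(8)
  have per: "x (t + 1) = x t" for t using assms(3) by blast
  have a: "0 \<le> a1" "0 \<le> a2" and b: "b \<noteq> 0" using cases by auto
  define B where "B = \<bar>b\<bar>"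
  have B: "0 < B" using b by (simp add: B_def)
  define \<rho>0 where "\<rho>0 = lam / (2 * half_period a1 a2)"
  have \<rho>0: "0 < \<rho>0" using \<open>lam > 0\<close> half_period_pos[OF a] by (simp add: \<rho>0_def)
  have lam: "lam = 4 * (\<rho>0 * half_period a1 a2 / 2)" using half_period_pos[OF a] by (simp add: \<rho>0_def)
  define z where "z = (\<lambda>j t. (deriv ^^ (r - j)) x t - (if j = r then best_const x else 0))"
  have z_r: "z r = (\<lambda>t. x t - best_const x)" by (simp add: z_def)
  have top: "Linf_norm ((deriv ^^ r) x) \<le> ereal B"
    using cases Linf_norm_top_deriv_Psi[OF a \<open>lam > 0\<close> r, of b] unfolding B_def by (auto intro: order_trans)
  interpret tower: derivative_tower a1 a2 B r z
    unfolding z_def by (rule Lr_inf_tower[OF r _ per top a B]) (use assms(2) in \<open>simp add: Lr_inf_inf_def\<close>)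
  let ?W = "wave a1 a2 B"
  have x_cont: "continuous_on UNIV x"
    using continuous_on_add[OF tower.cont[OF r order_refl] continuous_on_const[of _ "best_const x"]] by (simp add: z_r)
  obtain M \<alpha> \<beta> where M: "\<And>t. \<bar>z r t\<bar> \<le> M" "z r \<alpha> = M" "z r \<beta> = - M" "\<And>C. (\<And>t. \<bar>x t\<bar> \<le> C) \<Longrightarrow> M \<le> C"
    using best_const_periodic[OF x_cont per] unfolding z_r by metis
  have given: "\<bar>z j t\<bar> \<le> ?W \<rho>0 j 0"
    if j: "1 \<le> j" "j \<le> r" and le: "Linf_norm ((deriv ^^ (r - j)) x) \<le> Linf_norm ((deriv ^^ (r - j)) (Psi r a1 a2 b lam))" for j t
  proof -
    have "Linf_norm ((deriv ^^ (r - j)) x) \<le> ereal (?W \<rho>0 j 0)"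
      using order_trans[OF le Linf_norm_deriv_Psi[OF a \<open>lam > 0\<close>, of "r - j" r b]] j
      by (simp add: wave_def B_def \<rho>0_def)
    moreover have "continuous_on UNIV ((deriv ^^ (r - j)) x)"
      using continuous_on_add[OF tower.cont[OF j] continuous_on_const[of _ "if j = r then best_const x else 0"]]
      by (simp add: z_def)
    ultimately have pt: "\<bar>(deriv ^^ (r - j)) x t\<bar> \<le> ?W \<rho>0 j 0" for t by (intro Linf_norm_pointwise)
    show ?thesis
    proof (cases "j = r")
      case True
      \<comment> \<open>The assumption bounds \<open>x\<close> itself; the best constant does not
        enlarge a uniform bound.\<close>
      then have "M \<le> ?W \<rho>0 j 0" using M(4) pt by simp
      then show ?thesis using M(1)[of t] True by simp
    next
      case False
      then show ?thesis using pt by (simp add: z_def)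
    qed
  qed
  \<comment> \<open>\<open>J\<close> collects the levels above 1 whose bound is not assumed;
    \<open>plateau_J\<close> ensures that none of them has a flat maximum. \<open>r = 1\<close> can
    occur only under the first condition, which then gives \<open>a1 = 0\<close> and the bound of
    level 1.\<close>
  obtain J where J: "J \<subseteq> {2..r}" and b1: "a2 = 0 \<or> (\<forall>t. \<bar>z 1 t\<bar> \<le> ?W \<rho>0 1 0)"
    and J': "\<And>j t. 2 \<le> j \<Longrightarrow> j \<le> r \<Longrightarrow> j \<notin> J \<Longrightarrow> \<bar>z j t\<bar> \<le> ?W \<rho>0 j 0"
    and plateau_J: "\<And>j. j \<in> J \<Longrightarrow> a1 = 0 \<or> 3 \<le> j" and foot_r: "r = 1 \<Longrightarrow> a1 = 0"
    and bound_r: "r = 1 \<Longrightarrow> \<forall>t. \<bar>z 1 t\<bar> \<le> ?W \<rho>0 1 0"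
    using cases
  proof (elim disjE conjE)
    assume A: "a1 = 0" "\<forall>k\<in>{r - 1, r}. Linf_norm ((deriv ^^ k) x) \<le> Linf_norm ((deriv ^^ k) (Psi r a1 a2 b lam))"
    then have "\<forall>t. \<bar>z 1 t\<bar> \<le> ?W \<rho>0 1 0" using given[of 1] r by blast
    then show thesis using that[of "{2..r}"] A by auto
  next
    assume A: "a2 = 0" "2 \<le> r" "\<forall>k\<in>{r - 2, r}. Linf_norm ((deriv ^^ k) x) \<le> Linf_norm ((deriv ^^ k) (Psi r a1 a2 b lam))"
    then have z2: "\<forall>t. \<bar>z 2 t\<bar> \<le> ?W \<rho>0 2 0" using given[of 2] by simp
    show thesis
    proof (rule that[of "{3..r}"])
      fix j t assume "2 \<le> j" "j \<le> r" "j \<notin> {3..r}"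
      then have "j = 2" by auto
      then show "\<bar>z j t\<bar> \<le> ?W \<rho>0 j 0" using z2 by simp
    qed (use A z2 in auto)
  next
    assume A: "2 \<le> r" "\<forall>k\<in>{r - 2, r - 1, r}. Linf_norm ((deriv ^^ k) x) \<le> Linf_norm ((deriv ^^ k) (Psi r a1 a2 b lam))"
    then have z2: "\<forall>t. \<bar>z 2 t\<bar> \<le> ?W \<rho>0 2 0" "\<forall>t. \<bar>z 1 t\<bar> \<le> ?W \<rho>0 1 0" using given[of 2] given[of 1] by simp_all
    show thesis
    proof (rule that[of "{3..r}"])
      fix j t assume "2 \<le> j" "j \<le> r" "j \<notin> {3..r}"
      then have "j = 2" by auto
      then show "\<bar>z j t\<bar> \<le> ?W \<rho>0 j 0" using z2 by simp
    qed (use A z2 in auto)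
  qed
  have footr: "foot a1 a2 r = half_period a1 a2 / 2"
    using foot_r r by (auto simp: foot_def[OF a] half_period_def)
  have mono: "?W \<rho>0 j 0 \<le> ?W \<rho> j 0" if "\<rho>0 \<le> \<rho>" "1 \<le> j" for \<rho> j
  proof -
    have "0 \<le> qwave a1 a2 j 0" using qwave_peak(3)[OF a that(2), of 0] half_period_pos[OF a] by simp
    then show ?thesis unfolding wave_zero using that(1) \<rho>0 B
      by (intro mult_right_mono mult_left_mono power_mono) auto
  qed
  interpret w0: scaled_wave a1 a2 B \<rho>0 using a B \<rho>0 by unfold_locales
  interpret q0: quarter_wave "Psi r a1 a2 b lam" "?W \<rho>0 r" "\<rho>0 * centre a1 a2 r"
    "\<rho>0 * half_period a1 a2 / 2" "\<rho>0 * plateau a1 a2 r"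
    using w0.quarter_wave_Psi[OF r footr, of b] unfolding lam[symmetric] by (simp add: B_def)
  have bounded: "\<bar>z j t\<bar> \<le> ?W \<rho>0 j 0" if j: "j \<in> J" for j t
  proof (rule tower.stretch[OF \<rho>0 J])
    fix \<rho> i assume \<rho>: "\<rho>0 < \<rho>" and bJ: "\<And>j t. j \<in> J \<Longrightarrow> \<bar>z j t\<bar> \<le> ?W \<rho> j 0"
      and i: "i \<in> J" "\<exists>t. ?W \<rho> i 0 \<le> \<bar>z i t\<bar>"
    have b1': "a2 = 0 \<or> (\<forall>t. \<bar>z 1 t\<bar> \<le> ?W \<rho> 1 0)" using b1 mono[of \<rho> 1] \<rho> by (meson le_less order_refl order_trans)
    have all: "\<bar>z j t\<bar> \<le> ?W \<rho> j 0" if "2 \<le> j" "j \<le> r" for j t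
    proof (cases "j \<in> J")
      case False
      then show ?thesis using J'[OF that False, of t] mono[of \<rho> j] \<rho> that by simp
    qed (rule bJ)
    have \<rho>pos: "0 < \<rho>" using \<rho> \<rho>0 by simp
    have ir: "2 \<le> i" "i \<le> r" using i J by auto
    obtain t where "?W \<rho> r 0 \<le> \<bar>z r t\<bar>"
      using tower.peak_propagates[OF \<rho>pos b1' all ir plateau_J[OF i(1)] i(2)] by blast
    moreover have "2 \<le> r" using ir by simp
    ultimately have M_eq: "M = ?W \<rho> r 0"
      using M(1)[of t] M(2) all[OF \<open>2 \<le> r\<close> order_refl, of \<alpha>] by linarith
    have plr: "plateau a1 a2 r = 0" using plateau_J[OF i(1)] ir by (auto simp: plateau_def[OF a])
    interpret w: scaled_wave a1 a2 B \<rho> using a B \<rho>pos by unfold_locales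
    have r1: "1 \<le> r" by (rule r)
    \<comment> \<open>The plateau parameter is 0 here, as the estimate at full height
      demands.\<close>
    interpret q1: quarter_wave "Psi r a1 a2 b (4 * (\<rho> * half_period a1 a2 / 2))" "?W \<rho> r" "\<rho> * centre a1 a2 r"
      "\<rho> * half_period a1 a2 / 2" 0
      using w.quarter_wave_Psi[OF r footr, of b] plr by (simp add: B_def)
    interpret c1: compared_function "Psi r a1 a2 b (4 * (\<rho> * half_period a1 a2 / 2))" "?W \<rho> r" "\<rho> * centre a1 a2 r"
      "\<rho> * half_period a1 a2 / 2" 0 "z r" M \<alpha> \<beta>
    proof
      show "comparison (\<rho> * half_period a1 a2 / 2) (?W \<rho> r) (z r)"
        using tower.comparison_all[OF \<rho>pos b1' all r order_refl] footr by simp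
    qed (use M M_eq tower.cont[OF r] tower.per[OF r] in auto)
    \<comment> \<open>Stretching multiplies the wave by at least \<open>k\<close>. What follows
      derives \<open>k powr p * ?A \<le> ?A\<close> for the finite positive integral
      \<open>?A\<close>, contrary to \<open>1 < k\<close>.\<close>
    define k where "k = (\<rho> / \<rho>0) ^ r"
    have k: "1 < k" unfolding k_def using \<rho> \<rho>0 r by (intro one_less_power) auto
    let ?Q = "\<rho>0 * half_period a1 a2 / 2"
    let ?A = "\<integral>\<^sup>+s\<in>{0..?Q}. ennreal (\<bar>?W \<rho>0 r s\<bar> powr p) \<partial>lborel"
    have eqA: "(\<integral>\<^sup>+t\<in>{0..1}. ennreal (\<bar>z r t\<bar> powr p) \<partial>lborel) = 4 * ?A" and finA: "?A < \<infinity>"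
    proof -
      have I: "(\<integral>\<^sup>+t\<in>{0..lam}. ennreal (\<bar>Psi r a1 a2 b lam t\<bar> powr p) \<partial>lborel) = 4 * ?A"
        using q0.integral_G[of "\<lambda>x. ennreal (\<bar>x\<bar> powr p)"] unfolding lam[symmetric] by simp
      show "(\<integral>\<^sup>+t\<in>{0..1}. ennreal (\<bar>z r t\<bar> powr p) \<partial>lborel) = 4 * ?A"
        using Lp_norm_eqD[OF q0.G_cont tower.cont[OF r order_refl] \<open>0 < p\<close>, of 0 lam 0 1] norm_eq I
        unfolding z_r by simp
      have "4 * ?A < \<infinity>"
        using Lp_norm_continuous(2)[OF q0.G_cont \<open>0 < p\<close>, of 0 lam] I by simp
      then show "?A < \<infinity>" by (auto simp: ennreal_mult_less_top)
    qed
    have "ennreal (k powr p) * ?A = (\<integral>\<^sup>+s\<in>{0..?Q}. ennreal ((k * \<bar>?W \<rho>0 r s\<bar>) powr p) \<partial>lborel)"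
      using k by (subst nn_integral_cmult[symmetric])
        (auto intro!: nn_integral_cong simp: powr_mult ennreal_mult' mult.assoc)
    also have "\<dots> \<le> (\<integral>\<^sup>+s\<in>{0..\<rho> * half_period a1 a2 / 2}. ennreal (\<bar>?W \<rho> r s\<bar> powr p) \<partial>lborel)"
    proof (rule nn_integral_mono)
      fix s
      show "ennreal ((k * \<bar>?W \<rho>0 r s\<bar>) powr p) * indicator {0..?Q} s
        \<le> ennreal (\<bar>?W \<rho> r s\<bar> powr p) * indicator {0..\<rho> * half_period a1 a2 / 2} s"
      proof (cases "s \<in> {0..?Q}")
        case True
        have "?Q \<le> \<rho> * half_period a1 a2 / 2" using \<rho> half_period_pos[OF a] by simp
        then have s: "s \<in> {0..\<rho> * half_period a1 a2 / 2}" using True by auto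
        have "k * \<bar>?W \<rho>0 r s\<bar> \<le> \<bar>?W \<rho> r s\<bar>"
          using w0.W_scale_le[OF r, of \<rho> s] w0.W_nonneg[OF r, of s] True \<rho> by (simp add: k_def)
        then show ?thesis using True s k \<open>0 < p\<close> by (simp add: powr_mono2 ennreal_leI)
      qed simp
    qed
    finally have "4 * (ennreal (k powr p) * ?A)
        \<le> 4 * (\<integral>\<^sup>+s\<in>{0..\<rho> * half_period a1 a2 / 2}. ennreal (\<bar>?W \<rho> r s\<bar> powr p) \<partial>lborel)"
      by (rule mult_left_mono) simp
    also have "\<dots> \<le> (\<integral>\<^sup>+t\<in>{0..1}. ennreal (\<bar>z r t\<bar> powr p) \<partial>lborel)"
      by (rule c1.Lp_integral_ge[OF refl M_eq \<open>0 < p\<close>])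
    also note eqA
    finally have "4 * (ennreal (k powr p) * ?A) \<le> 4 * ?A" .
    moreover obtain \<gamma> where \<gamma>: "0 \<le> \<gamma>" "?A = ennreal \<gamma>" using finA by (cases ?A) auto
    ultimately have "ennreal (4 * (k powr p * \<gamma>)) \<le> ennreal (4 * \<gamma>)"
      by (simp add: ennreal_mult)
    then have le: "k powr p * \<gamma> \<le> \<gamma>" using \<gamma>(1) by simp
    \<comment> \<open>On the first half of the quarter the wave is at least its value at
      \<open>?Q / 2\<close>, which is positive because the wave falls strictly to 0 at
      \<open>?Q\<close>.\<close>
    have "0 < \<gamma>"
    proof -
      have half: "0 < ?W \<rho>0 r (?Q / 2)"
        using w0.W_decreasing[OF r, of "?Q / 2" ?Q] w0.W_Q[OF r] w0.Q_pos plr footr by simp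
      have "ennreal (?W \<rho>0 r (?Q / 2) powr p) * ennreal (?Q / 2)
        = (\<integral>\<^sup>+s. ennreal (?W \<rho>0 r (?Q / 2) powr p) * indicator {0..?Q / 2} s \<partial>lborel)"
        using w0.Q_pos by (subst nn_integral_cmult_indicator) auto
      also have "\<dots> \<le> ?A"
      proof (rule nn_integral_mono)
        fix s
        show "ennreal (?W \<rho>0 r (?Q / 2) powr p) * indicator {0..?Q / 2} s \<le> ennreal (\<bar>?W \<rho>0 r s\<bar> powr p) * indicator {0..?Q} s"
        proof (cases "s \<in> {0..?Q / 2}")
          case True
          have "?W \<rho>0 r (?Q / 2) \<le> \<bar>?W \<rho>0 r s\<bar>"
          proof (cases "s = ?Q / 2")
            case True
            then show ?thesis by (simp only: abs_ge_self)
          next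
            case False
            then show ?thesis
              using \<open>s \<in> {0..?Q / 2}\<close> w0.W_decreasing[OF r, of s "?Q / 2"] w0.Q_pos plr footr by simp
          qed
          then show ?thesis using True half \<open>0 < p\<close> w0.Q_pos by (simp add: powr_mono2 ennreal_leI)
        qed simp
      qed
      finally have le_A: "ennreal (?W \<rho>0 r (?Q / 2) powr p) * ennreal (?Q / 2) \<le> ?A" .
      have "ennreal (?W \<rho>0 r (?Q / 2) powr p * (?Q / 2)) = ennreal (?W \<rho>0 r (?Q / 2) powr p) * ennreal (?Q / 2)"
        using w0.Q_pos by (intro ennreal_mult) auto
      with le_A have "ennreal (?W \<rho>0 r (?Q / 2) powr p * (?Q / 2)) \<le> ennreal \<gamma>"
        unfolding \<gamma>(2) by (simp only:)
      then have "?W \<rho>0 r (?Q / 2) powr p * (?Q / 2) \<le> \<gamma>" using \<gamma>(1) by simp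
      moreover have "0 < ?W \<rho>0 r (?Q / 2) powr p * (?Q / 2)" using half w0.Q_pos by simp
      ultimately show ?thesis by linarith
    qed
    moreover have "1 < k powr p" using k \<open>0 < p\<close> by simp
    ultimately have False using le by simp
    then show ?thesis ..
  qed (use j in auto)
  have all: "\<bar>z j t\<bar> \<le> ?W \<rho>0 j 0" if "2 \<le> j" "j \<le> r" for j t
    using bounded J'[OF that] by blast
  \<comment> \<open>\<open>all\<close> begins at level 2, so for \<open>r = 1\<close> the assumed
    bound is used directly.\<close>
  have "M \<le> ?W \<rho>0 r 0"
  proof (cases "r = 1")
    case True
    then show ?thesis using bound_r M(2) by (metis abs_le_D1)
  next
    case False
    then show ?thesis using all[of r \<alpha>] M(2) r by (simp add: abs_le_iff)
  qed
  interpret c0: compared_function "Psi r a1 a2 b lam" "?W \<rho>0 r" "\<rho>0 * centre a1 a2 r"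
    "\<rho>0 * half_period a1 a2 / 2" "\<rho>0 * plateau a1 a2 r" "z r" M \<alpha> \<beta>
  proof
    show "comparison (\<rho>0 * half_period a1 a2 / 2) (?W \<rho>0 r) (z r)"
      using tower.comparison_all[OF \<rho>0 b1 all r order_refl] footr by simp
  qed (use M \<open>M \<le> ?W \<rho>0 r 0\<close> tower.cont[OF r] tower.per[OF r] in auto)
  show ?thesis
    using c0.Lp_norm_compare[OF \<open>0 < p\<close> \<open>p < q\<close>] norm_eq unfolding lam[symmetric] z_r by simp
qed

end
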